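(* Let $H_1,H_2\in(0,1)\setminus\{\frac12\}$ with $H=H_1+H_2=\frac32$, let $Y=(Y^1,Y^2)$ be the bivariate fractional Ornstein–Uhlenbeck process, fix an integer $s\ge1$ and let $\hat\rho_n,\hat\eta_{12,n}$ be the estimators defined in the context. Let $\sigma_\rho^2=\lim_{n\to+\infty}\mathrm{Var}\big(\sqrt{n/\log n}\,(\hat\rho_n-\rho)\big)$ and $\sigma_\eta^2=\lim_{n\to+\infty}\mathrm{Var}\big(\sqrt{n/\log n}\,(\hat\eta_{12,n}-\eta_{12})\big)$. Then $$\sqrt{\frac n{\log n}}(\hat\rho_n-\rho)\xrightarrow{d}N_\rho\quad\text{and}\quad\sqrt{\frac n{\log n}}(\hat\eta_{12,n}-\eta_{12})\xrightarrow{d}N_\eta,$$ where $N_\rho\sim\mathcal N(0,\sigma_\rho^2)$ and $N_\eta\sim\mathcal N(0,\sigma_\eta^2)$. Additionally, $$\sqrt{\frac n{\log n}}(\hat\rho_n-\rho,\hat\eta_{12,n}-\eta_{12})\xrightarrow{d}(N_\rho,N_\eta),$$ where $(N_\rho,N_\eta)$ is a centered Gaussian vector with $\mathrm{Cov}(N_\rho,N_\eta)=\lim_{n\to\infty}\frac n{\log n}\mathbb E[(\hat\rho_n-\rho)(\hat\eta_{12,n}-\eta_{12})]$.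
   Context: Bivariate fractional Brownian motion ($H=H_1+H_2\ne1$). $(B^{H_1}_t,B^{H_2}_t)_{t\in\mathbb R}$ is a centered Gaussian process such that each $B^{H_i}$ is a fractional Brownian motion on $\mathbb R$ with Hurst index $H_i$, $\mathrm{Var}(B^{H_i}_1)=1$, and for $i\ne j$ $$\mathbb E[B^{H_i}_tB^{H_j}_s]=\tfrac12\big((\rho+\mathrm{sign}(t)\eta_{ij})|t|^H+(\rho-\mathrm{sign}(s)\eta_{ij})|s|^H-(\rho-\mathrm{sign}(s-t)\eta_{ij})|s-t|^H\big),$$ with $\mathrm{sign}(x)=1$ for $x\ge0$, $-1$ for $x<0$; $\rho\in[-1,1]$ and $\eta_{12}=-\eta_{21}\in\mathbb R$ are such that this is a valid covariance. Bivariate fractional Ornstein–Uhlenbeck process: $Y^i_t=\nu_i\int_{-\infty}^te^{-\alpha_i(t-u)}dB^{H_i}_u$, $t\in\mathbb R$, $i=1,2$ (pathwise Riemann–Stieltjes integrals), with $\alpha_i,\nu_i>0$. Estimators (the marginal parameters $\alpha_i,\nu_i,H_i$ are known). For $s\in\mathbb N$, $s\ge1$, put $I_{ij}(s)=\int_0^se^{\alpha_iu}\big(\int_{-\infty}^0e^{\alpha_jv}(u-v)^{H-2}dv\big)du$ and $$a_1(s)=-\frac{I_{12}(s)+I_{21}(s)}{\nu_1\nu_2H(H-1)I_{12}(s)I_{21}(s)},\quad a_2(s)=\frac{e^{\alpha_1s}}{\nu_1\nu_2H(H-1)I_{12}(s)},\quad a_3(s)=\frac{e^{\alpha_2s}}{\nu_1\nu_2H(H-1)I_{21}(s)},$$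 $$b_1(s)=\frac{I_{12}(s)-I_{21}(s)}{\nu_1\nu_2H(H-1)I_{12}(s)I_{21}(s)},\quad b_2(s)=a_2(s),\quad b_3(s)=-a_3(s).$$ Then $$\hat\rho_n=\frac{a_1(s)}n\sum_{j=1}^nY^1_jY^2_j+\frac{a_2(s)}n\sum_{j=1}^{n-s}Y^1_{j+s}Y^2_j+\frac{a_3(s)}n\sum_{j=1}^{n-s}Y^1_jY^2_{j+s},$$ $$\hat\eta_{12,n}=\frac{b_1(s)}n\sum_{j=1}^nY^1_jY^2_j+\frac{b_2(s)}n\sum_{j=1}^{n-s}Y^1_{j+s}Y^2_j+\frac{b_3(s)}n\sum_{j=1}^{n-s}Y^1_jY^2_{j+s}.$$ *)

theory Defs
  imports "HOL-Probability.Probability"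
begin

section \<open>Gaussian processes and fractional Brownian motion\<close>

text \<open>The normal law with mean \<open>m\<close> and variance \<open>v\<close>; for \<open>v = 0\<close> it is the point mass at \<open>m\<close>.
  (The second parameter of \<^const>\<open>normal_density\<close> is the standard deviation.)\<close>

definition normal_law :: "real \<Rightarrow> real \<Rightarrow> real measure" where
  "normal_law m v =
     (if v = 0 then return borel m
      else density lborel (\<lambda>x. ennreal (normal_density m (sqrt v) x)))"

text \<open>All finite linear combinations are centered normal, possibly degenerate. For a finite index
  set this is a centered Gaussian vector.\<close>

definition centered_gaussian_process ::
  "'a measure \<Rightarrow> 'i set \<Rightarrow> ('i \<Rightarrow> 'a \<Rightarrow> real) \<Rightarrow> bool" where
  "centered_gaussian_process M T X \<longleftrightarrow>
     (\<forall>t\<in>T. X t \<in> borel_measurable M) \<and>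
     (\<forall>J c. finite J \<and> J \<subseteq> T \<longrightarrow>
        (\<exists>v\<ge>0. distr M borel (\<lambda>\<omega>. \<Sum>t\<in>J. c t * X t \<omega>) = normal_law 0 v))"

definition covariance :: "'a measure \<Rightarrow> ('a \<Rightarrow> real) \<Rightarrow> ('a \<Rightarrow> real) \<Rightarrow> real" where
  "covariance M X Z =
     (LINT \<omega>|M. (X \<omega> - integral\<^sup>L M X) * (Z \<omega> - integral\<^sup>L M Z))"

text \<open>Fractional Brownian motion indexed by the whole real line, in its version with (almost surely)
  continuous paths. Note that \<open>0 powr x = 0\<close>, so the diagonal and the origin need no special case.\<close>

definition fractional_brownian_motion ::
  "'a measure \<Rightarrow> real \<Rightarrow> (real \<Rightarrow> 'a \<Rightarrow> real) \<Rightarrow> bool" where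
  "fractional_brownian_motion M h B \<longleftrightarrow>
     centered_gaussian_process M UNIV B \<and>
     (\<forall>t s. (LINT \<omega>|M. B t \<omega> * B s \<omega>) =
        prob_space.variance M (B 1) / 2
          * (\<bar>t\<bar> powr (2 * h) + \<bar>s\<bar> powr (2 * h) - \<bar>t - s\<bar> powr (2 * h))) \<and>
     (AE \<omega> in M. continuous_on UNIV (\<lambda>t. B t \<omega>))"

text \<open>Sign function with value \<open>1\<close> at \<open>0\<close>, unlike \<^const>\<open>sgn\<close>.\<close>

definition sign1 :: "real \<Rightarrow> real" where
  "sign1 x = (if x \<ge> 0 then 1 else -1)"

text \<open>Bivariate objects are indexed by \<open>{1, 2}\<close>; values at other indices are irrelevant. In the
  following, \<open>H i\<close> are the marginal Hurst indices. The formula for the cross covariance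
  is the one for \<open>H 1 + H 2 \<noteq> 1\<close>.\<close>

definition bivariate_fBm ::
  "'a measure \<Rightarrow> (nat \<Rightarrow> real) \<Rightarrow> real \<Rightarrow> (nat \<Rightarrow> nat \<Rightarrow> real) \<Rightarrow> (nat \<Rightarrow> real \<Rightarrow> 'a \<Rightarrow> real) \<Rightarrow> bool" where
  "bivariate_fBm M H \<rho> \<eta> B \<longleftrightarrow>
     H 1 + H 2 \<noteq> 1 \<and> \<rho> \<in> {-1..1} \<and> \<eta> 1 2 = - \<eta> 2 1 \<and>
     centered_gaussian_process M ({1, 2} \<times> UNIV) (\<lambda>(i, t). B i t) \<and>
     (\<forall>i\<in>{1, 2}. fractional_brownian_motion M (H i) (B i) \<and> prob_space.variance M (B i 1) = 1) \<and>
     (\<forall>i\<in>{1, 2}. \<forall>j\<in>{1, 2}. i \<noteq> j \<longrightarrow> (\<forall>t s.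
        (LINT \<omega>|M. B i t \<omega> * B j s \<omega>) =
          1 / 2 * ((\<rho> + sign1 t * \<eta> i j) * \<bar>t\<bar> powr (H 1 + H 2)
                 + (\<rho> - sign1 s * \<eta> i j) * \<bar>s\<bar> powr (H 1 + H 2)
                 - (\<rho> - sign1 (s - t) * \<eta> i j) * \<bar>s - t\<bar> powr (H 1 + H 2))))"


section \<open>Riemann--Stieltjes integrals and the Ornstein--Uhlenbeck process\<close>

text \<open>\<open>J\<close> is the limit of the Riemann--Stieltjes sums of \<open>f\<close> against \<open>g\<close> over tagged partitions of
  \<open>[a, b]\<close> as the mesh tends to zero. Every cell \<open>k\<close> of a tagged division is a nonempty compact
  interval \<open>[Inf k, Sup k]\<close>; degenerate cells contribute nothing.\<close>

definition has_RS_integral ::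
  "(real \<Rightarrow> real) \<Rightarrow> (real \<Rightarrow> real) \<Rightarrow> real \<Rightarrow> real \<Rightarrow> real \<Rightarrow> bool" where
  "has_RS_integral f g a b J \<longleftrightarrow>
     (\<forall>e>0. \<exists>d>0. \<forall>p. p tagged_division_of {a..b} \<and> (\<forall>(x, k)\<in>p. Sup k - Inf k < d) \<longrightarrow>
        \<bar>(\<Sum>(x, k)\<in>p. f x * (g (Sup k) - g (Inf k))) - J\<bar> < e)"

text \<open>The improper integral over \<open>(-\<infinity>, b]\<close>.\<close>

definition has_RS_integral_lower ::
  "(real \<Rightarrow> real) \<Rightarrow> (real \<Rightarrow> real) \<Rightarrow> real \<Rightarrow> real \<Rightarrow> bool" where
  "has_RS_integral_lower f g b J \<longleftrightarrow>
     (\<exists>F. (\<forall>a\<le>b. has_RS_integral f g a b (F a)) \<and> (F \<longlongrightarrow> J) at_bot)"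

definition bivariate_fOU ::
  "'a measure \<Rightarrow> (nat \<Rightarrow> real) \<Rightarrow> (nat \<Rightarrow> real) \<Rightarrow> (nat \<Rightarrow> real \<Rightarrow> 'a \<Rightarrow> real)
     \<Rightarrow> (nat \<Rightarrow> real \<Rightarrow> 'a \<Rightarrow> real) \<Rightarrow> bool" where
  "bivariate_fOU M \<alpha> \<nu> B Y \<longleftrightarrow>
     (\<forall>i\<in>{1, 2}.
        (\<forall>t. Y i t \<in> borel_measurable M) \<and>
        (AE \<omega> in M. \<forall>t. \<exists>J.
           has_RS_integral_lower (\<lambda>u. exp (- \<alpha> i * (t - u))) (\<lambda>u. B i u \<omega>) t J \<and>
           Y i t \<omega> = \<nu> i * J))"


section \<open>The estimators\<close>

text \<open>Throughout, \<open>h\<close> stands for \<open>H 1 + H 2\<close>.\<close>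

definition I_coef :: "(nat \<Rightarrow> real) \<Rightarrow> real \<Rightarrow> nat \<Rightarrow> nat \<Rightarrow> nat \<Rightarrow> real" where
  "I_coef \<alpha> h i j s =
     (LINT u:{0..real s}|lborel. exp (\<alpha> i * u)
        * (LINT v:{..0}|lborel. exp (\<alpha> j * v) * (u - v) powr (h - 2)))"

definition a1_coef :: "(nat \<Rightarrow> real) \<Rightarrow> (nat \<Rightarrow> real) \<Rightarrow> real \<Rightarrow> nat \<Rightarrow> real" where
  "a1_coef \<alpha> \<nu> h s =
     - (I_coef \<alpha> h 1 2 s + I_coef \<alpha> h 2 1 s)
       / (\<nu> 1 * \<nu> 2 * h * (h - 1) * I_coef \<alpha> h 1 2 s * I_coef \<alpha> h 2 1 s)"

definition a2_coef :: "(nat \<Rightarrow> real) \<Rightarrow> (nat \<Rightarrow> real) \<Rightarrow> real \<Rightarrow> nat \<Rightarrow> real" where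
  "a2_coef \<alpha> \<nu> h s = exp (\<alpha> 1 * real s) / (\<nu> 1 * \<nu> 2 * h * (h - 1) * I_coef \<alpha> h 1 2 s)"

definition a3_coef :: "(nat \<Rightarrow> real) \<Rightarrow> (nat \<Rightarrow> real) \<Rightarrow> real \<Rightarrow> nat \<Rightarrow> real" where
  "a3_coef \<alpha> \<nu> h s = exp (\<alpha> 2 * real s) / (\<nu> 1 * \<nu> 2 * h * (h - 1) * I_coef \<alpha> h 2 1 s)"

definition b1_coef :: "(nat \<Rightarrow> real) \<Rightarrow> (nat \<Rightarrow> real) \<Rightarrow> real \<Rightarrow> nat \<Rightarrow> real" where
  "b1_coef \<alpha> \<nu> h s =
     (I_coef \<alpha> h 1 2 s - I_coef \<alpha> h 2 1 s)
       / (\<nu> 1 * \<nu> 2 * h * (h - 1) * I_coef \<alpha> h 1 2 s * I_coef \<alpha> h 2 1 s)"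

definition b2_coef :: "(nat \<Rightarrow> real) \<Rightarrow> (nat \<Rightarrow> real) \<Rightarrow> real \<Rightarrow> nat \<Rightarrow> real" where
  "b2_coef \<alpha> \<nu> h s = a2_coef \<alpha> \<nu> h s"

definition b3_coef :: "(nat \<Rightarrow> real) \<Rightarrow> (nat \<Rightarrow> real) \<Rightarrow> real \<Rightarrow> nat \<Rightarrow> real" where
  "b3_coef \<alpha> \<nu> h s = - a3_coef \<alpha> \<nu> h s"

text \<open>For \<open>n \<le> s\<close> the truncated difference \<open>n - s\<close> makes the two lagged sums empty.\<close>

definition cross_estimator ::
  "real \<Rightarrow> real \<Rightarrow> real \<Rightarrow> nat \<Rightarrow> (nat \<Rightarrow> real \<Rightarrow> 'a \<Rightarrow> real) \<Rightarrow> nat \<Rightarrow> 'a \<Rightarrow> real" where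
  "cross_estimator c1 c2 c3 s Y n \<omega> =
     c1 / real n * (\<Sum>j=1..n. Y 1 (real j) \<omega> * Y 2 (real j) \<omega>)
     + c2 / real n * (\<Sum>j=1..n - s. Y 1 (real (j + s)) \<omega> * Y 2 (real j) \<omega>)
     + c3 / real n * (\<Sum>j=1..n - s. Y 1 (real j) \<omega> * Y 2 (real (j + s)) \<omega>)"

definition rho_hat ::
  "(nat \<Rightarrow> real) \<Rightarrow> (nat \<Rightarrow> real) \<Rightarrow> real \<Rightarrow> nat \<Rightarrow> (nat \<Rightarrow> real \<Rightarrow> 'a \<Rightarrow> real) \<Rightarrow> nat \<Rightarrow> 'a \<Rightarrow> real" where
  "rho_hat \<alpha> \<nu> h s =
     cross_estimator (a1_coef \<alpha> \<nu> h s) (a2_coef \<alpha> \<nu> h s) (a3_coef \<alpha> \<nu> h s) s"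

definition eta12_hat ::
  "(nat \<Rightarrow> real) \<Rightarrow> (nat \<Rightarrow> real) \<Rightarrow> real \<Rightarrow> nat \<Rightarrow> (nat \<Rightarrow> real \<Rightarrow> 'a \<Rightarrow> real) \<Rightarrow> nat \<Rightarrow> 'a \<Rightarrow> real" where
  "eta12_hat \<alpha> \<nu> h s =
     cross_estimator (b1_coef \<alpha> \<nu> h s) (b2_coef \<alpha> \<nu> h s) (b3_coef \<alpha> \<nu> h s) s"


section \<open>Convergence in distribution\<close>

text \<open>The library's \<^const>\<open>weak_conv_m\<close> is restricted to laws on the real line. This is the
  general notion, for random variables \<open>X n\<close> on \<open>M\<close> and a limit \<open>Z\<close> on a possibly different
  probability space \<open>Q\<close>.\<close>

definition conv_in_distribution ::
  "'a measure \<Rightarrow> (nat \<Rightarrow> 'a \<Rightarrow> 'c::topological_space) \<Rightarrow> 'b measure \<Rightarrow> ('b \<Rightarrow> 'c) \<Rightarrow> bool" where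
  "conv_in_distribution M X Q Z \<longleftrightarrow>
     (\<forall>f :: 'c \<Rightarrow> real. continuous_on UNIV f \<and> bounded (range f) \<longrightarrow>
        (\<lambda>n. LINT \<omega>|M. f (X n \<omega>)) \<longlonglongrightarrow> (LINT \<omega>|Q. f (Z \<omega>)))"

end

theory Submission
  imports Defs "HOL-Real_Asymp.Real_Asymp"
begin

text \<open>Both Hurst indices exceed \<open>1/2\<close>, so the increments of \<open>B\<close> have the locally integrable covariance
  density \<open>k (v - u)\<close> with \<open>k x\<close> proportional to \<open>\<bar>x\<bar> powr (H i + H j - 2)\<close> on each half line, and the
  covariances of \<open>Y\<close> are double integrals of \<open>k\<close> against exponentials. Splitting off the part
  \<open>u > 0 \<ge> v\<close> yields both the identity behind the estimators and the decay
  \<open>t powr (H i + H j - 2)\<close> of the covariances.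

  By Isserlis' formula all lagged product sums have, after division by \<open>n ln n\<close>, the same asymptotic
  covariances. Hence each estimation error is in \<open>L\<^sup>2\<close> asymptotically a multiple of the normalised
  sum of \<open>Y 1 j * Y 2 j\<close>: the limit law is concentrated on a line, and it suffices to prove a central limit
  theorem for this one sum. It is a quadratic form \<open>X' A X\<close> of a Gaussian vector with covariance \<open>C\<close>.
  Gaussian integration by parts expresses its moments through the traces of the powers of \<open>A C\<close>, and
  traces of order at least three vanish in the limit because weighted row sums of \<open>A C\<close> are
  \<open>O(1 / sqrt (ln n))\<close>. The method of moments then gives the normal limit.\<close>

section \<open>Normal laws and Gaussian processes\<close>

text \<open>The value 3/2 is a border case: the covariance of two products
  \<open>Y 1 j * Y 2 j\<close> at distance m behaves like \<gamma> / m, so that double sums over the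
  two times grow like n ln n instead of n. A fixed lag leaves the coefficient \<gamma> unchanged,
  which is why all lagged sums share one limit. The logarithm also shapes the proof of normality.
  The bound r for the row sums of A C decays only like 1 / sqrt (ln n), while the crude estimate of
  a trace by row sums carries the factor 2 n, which no fixed power of r absorbs; hence the detour
  through log-convexity of the traces. Eigenvalues and square roots of C are avoided: weighted row
  sums stand in for the operator norm, and positivity of the trace of F C F C comes from an
  expectation. The second obstacle is that Y is given pathwise. Its covariance is reached through
  two almost sure limits, mesh to zero and lower limit to minus infinity. For centred normal
  variables an almost sure limit carries the variances along, and this takes the place of uniform
  integrability.\<close>

lemma normal_law_eq_distr:
  assumes "v \<ge> 0"
  shows "normal_law 0 v = distr std_normal_distribution borel (\<lambda>x. sqrt v * x)"
proof (cases "v = 0")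
  case True
  interpret prob_space std_normal_distribution
    by (rule real_distribution.axioms(1)[OF real_dist_normal_dist])
  show ?thesis
    using True by (simp add: normal_law_def distr_const)
next
  case False
  then have v: "v > 0" using assms by simp
  interpret prob_space std_normal_distribution
    by (rule real_distribution.axioms(1)[OF real_dist_normal_dist])
  have "distr std_normal_distribution lborel (\<lambda>x. x) = std_normal_distribution"
    by (rule distr_id2) simp
  then have "distributed std_normal_distribution lborel (\<lambda>x. x) (\<lambda>x. ennreal (std_normal_density x))"
    by (auto simp: distributed_def)
  from normal_density_affine[OF this, of "sqrt v" 0] v
  have "distributed std_normal_distribution lborel (\<lambda>x. sqrt v * x) (\<lambda>x. ennreal (normal_density 0 (sqrt v) x))"
    by simp
  then have "distr std_normal_distribution lborel (\<lambda>x. sqrt v * x) = density lborel (\<lambda>x. ennreal (normal_density 0 (sqrt v) x))"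
    by (simp add: distributed_def)
  moreover have "distr std_normal_distribution lborel (\<lambda>x. sqrt v * x) = distr std_normal_distribution borel (\<lambda>x. sqrt v * x)"
    by (rule distr_cong) auto
  ultimately show ?thesis
    using v by (simp add: normal_law_def)
qed

lemma real_distribution_normal_law:
  assumes "v \<ge> 0" shows "real_distribution (normal_law 0 v)"
  unfolding normal_law_eq_distr[OF assms]
  by (rule prob_space.real_distribution_distr[OF real_distribution.axioms(1)[OF real_dist_normal_dist]]) auto

lemma char_normal_law:
  assumes "v \<ge> 0"
  shows "char (normal_law 0 v) t = complex_of_real (exp (- (v * t\<^sup>2) / 2))"
proof -
  have "char (normal_law 0 v) t = (CLINT x|std_normal_distribution. iexp (t * (sqrt v * x)))"
    unfolding normal_law_eq_distr[OF assms] char_def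
    by (subst integral_distr) auto
  also have "\<dots> = char std_normal_distribution (t * sqrt v)"
    by (simp add: char_def mult.assoc)
  also have "\<dots> = complex_of_real (exp (- (v * t\<^sup>2) / 2))"
    unfolding char_std_normal_distribution using assms by (simp add: power_mult_distrib mult.commute)
  finally show ?thesis .
qed

lemma integrable_normal_law_power:
  assumes "v \<ge> 0" shows "integrable (normal_law 0 v) (\<lambda>x. x ^ k)"
  unfolding normal_law_eq_distr[OF assms]
  by (subst integrable_distr_eq)
     (auto simp: power_mult_distrib intro!: integrable_std_normal_distribution_moment)

lemma normal_law_even_moment:
  assumes "v \<ge> 0"
  shows "(LINT x|normal_law 0 v. x ^ (2 * k)) = v ^ k * (fact (2 * k) / (2 ^ k * fact k))"
proof -
  have "(LINT x|normal_law 0 v. x ^ (2 * k)) = (LINT x|std_normal_distribution. (sqrt v * x) ^ (2 * k))"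
    unfolding normal_law_eq_distr[OF assms] by (subst integral_distr) auto
  also have "\<dots> = sqrt v ^ (2 * k) * (LINT x|std_normal_distribution. x ^ (2 * k))"
    by (simp add: power_mult_distrib)
  also have "sqrt v ^ (2 * k) = v ^ k"
    using assms by (simp add: power_mult)
  finally show ?thesis
    by (simp only: std_normal_distribution_even_moments)
qed

lemma normal_law_odd_moment:
  assumes "v \<ge> 0" "odd k"
  shows "(LINT x|normal_law 0 v. x ^ k) = 0"
proof -
  have "(LINT x|normal_law 0 v. x ^ k) = (LINT x|std_normal_distribution. (sqrt v * x) ^ k)"
    unfolding normal_law_eq_distr[OF assms(1)] by (subst integral_distr) auto
  also have "\<dots> = sqrt v ^ k * (LINT x|std_normal_distribution. x ^ k)"
    by (simp add: power_mult_distrib)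
  finally show ?thesis
    using assms by (simp add: integral_std_normal_distribution_moment_odd)
qed

text \<open>The recursion is the form needed later: differentiated in a parameter it yields
  integration by parts for linear forms, and it identifies the limits in the method of moments. For
  odd k both sides vanish.\<close>

lemma normal_law_moment_rec:
  assumes "v \<ge> 0"
  shows "(LINT x|normal_law 0 v. x ^ (k + 2)) = real (k + 1) * v * (LINT x|normal_law 0 v. x ^ k)"
proof (cases "even k")
  case True
  then obtain j where k: "k = 2 * j" by (elim evenE)
  have "(LINT x|normal_law 0 v. x ^ (2 * Suc j)) = real (2 * j + 1) * v * (LINT x|normal_law 0 v. x ^ (2 * j))"
  proof -
    have "fact (2 * Suc j) / (2 ^ Suc j * fact (Suc j)) = (real (2 * j + 2) * real (2 * j + 1) * fact (2 * j)) / (real (2 * j + 2) * (2 ^ j * fact j))"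
      by (simp add: algebra_simps)
    also have "\<dots> = real (2 * j + 1) * (fact (2 * j) / (2 ^ j * fact j))"
      by (simp only: mult.assoc mult_divide_mult_cancel_left) simp
    finally show ?thesis
      unfolding normal_law_even_moment[OF assms] by simp
  qed
  then show ?thesis by (simp add: k)
next
  case False
  then show ?thesis
    using normal_law_odd_moment[OF assms, of k] normal_law_odd_moment[OF assms, of "k + 2"] by simp
qed

lemma normal_law_variance:
  assumes "v \<ge> 0" shows "(LINT x|normal_law 0 v. x\<^sup>2) = v"
  using normal_law_moment_rec[OF assms, of 0]
    prob_space.prob_space[OF real_distribution.axioms(1)[OF real_distribution_normal_law[OF assms]]]
  by (simp add: numeral_2_eq_2)

section \<open>Moments and almost sure limits of normal random variables\<close>

context prob_space
begin

lemma normal_law_distrD: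
  assumes X: "X \<in> borel_measurable M" and d: "distr M borel X = normal_law 0 v" and v: "v \<ge> 0"
  shows "integrable M (\<lambda>\<omega>. X \<omega> ^ k)" "expectation (\<lambda>\<omega>. (X \<omega>)\<^sup>2) = v"
    "expectation (\<lambda>\<omega>. X \<omega> ^ (k + 2)) = real (k + 1) * v * expectation (\<lambda>\<omega>. X \<omega> ^ k)"
    "char (distr M borel X) t = complex_of_real (exp (- (v * t\<^sup>2) / 2))"
proof -
  have *: "expectation (\<lambda>\<omega>. X \<omega> ^ k) = (LINT x|normal_law 0 v. x ^ k)" for k
    unfolding d[symmetric] using X by (subst integral_distr) auto
  have "integrable (distr M borel X) (\<lambda>x. x ^ k)"
    unfolding d by (rule integrable_normal_law_power[OF v])
  then show "integrable M (\<lambda>\<omega>. X \<omega> ^ k)"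
    using X by (subst (asm) integrable_distr_eq) auto
  show "expectation (\<lambda>\<omega>. (X \<omega>)\<^sup>2) = v"
    unfolding * by (rule normal_law_variance[OF v])
  show "expectation (\<lambda>\<omega>. X \<omega> ^ (k + 2)) = real (k + 1) * v * expectation (\<lambda>\<omega>. X \<omega> ^ k)"
    unfolding * by (rule normal_law_moment_rec[OF v])
  show "char (distr M borel X) t = complex_of_real (exp (- (v * t\<^sup>2) / 2))"
    unfolding d by (rule char_normal_law[OF v])
qed

text \<open>The characteristic functions exp (-v n t^2 / 2) converge pointwise by dominated
  convergence. The limit is continuous with value 1 at 0, hence nonzero at some t > 0, and taking
  logarithms there makes \<open>v\<close> converge. Boundedness of the variances is thus an outcome
  of the argument.\<close>

lemma AE_limit_normal_law:
  fixes Z :: "nat \<Rightarrow> 'a \<Rightarrow> real"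
  assumes Z: "\<And>n. Z n \<in> borel_measurable M" and W: "W \<in> borel_measurable M"
    and d: "\<And>n. distr M borel (Z n) = normal_law 0 (v n)" and v: "\<And>n. v n \<ge> 0"
    and lim: "AE \<omega> in M. (\<lambda>n. Z n \<omega>) \<longlonglongrightarrow> W \<omega>"
  shows "\<exists>u\<ge>0. distr M borel W = normal_law 0 u \<and> v \<longlonglongrightarrow> u"
proof -
  interpret D: real_distribution "distr M borel W"
    by (rule real_distribution_distr) (rule W)
  define \<phi> where "\<phi> = char (distr M borel W)"
  have conv: "(\<lambda>n. complex_of_real (exp (- (v n * t\<^sup>2) / 2))) \<longlonglongrightarrow> \<phi> t" for t
  proof -
    have "(\<lambda>n. CLINT \<omega>|M. iexp (t * Z n \<omega>)) \<longlonglongrightarrow> (CLINT \<omega>|M. iexp (t * W \<omega>))"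
    proof (rule integral_dominated_convergence[where w="\<lambda>_. 1"])
      show "AE \<omega> in M. (\<lambda>n. iexp (t * Z n \<omega>)) \<longlonglongrightarrow> iexp (t * W \<omega>)"
        using lim by eventually_elim (intro tendsto_intros)
    qed (use Z W in auto)
    moreover have "(CLINT \<omega>|M. iexp (t * Z n \<omega>)) = complex_of_real (exp (- (v n * t\<^sup>2) / 2))" for n
      using normal_law_distrD(4)[OF Z d v, of n t] Z unfolding char_def
      by (subst (asm) integral_distr) auto
    moreover have "(CLINT \<omega>|M. iexp (t * W \<omega>)) = \<phi> t"
      unfolding \<phi>_def char_def using W by (subst integral_distr) auto
    ultimately show ?thesis by simp
  qed
  have "isCont \<phi> 0" unfolding \<phi>_def by (rule D.isCont_char)
  moreover have "\<phi> 0 \<noteq> 0" unfolding \<phi>_def using D.char_zero by simp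
  ultimately have "eventually (\<lambda>t. \<phi> t \<noteq> 0) (at 0)"
    unfolding isCont_def by (rule tendsto_imp_eventually_ne)
  then obtain e where e: "e > 0" "\<And>t. t \<noteq> 0 \<Longrightarrow> dist t 0 < e \<Longrightarrow> \<phi> t \<noteq> 0"
    unfolding eventually_at by auto
  define t where "t = e / 2"
  have t: "t > 0" "\<phi> t \<noteq> 0" using e by (auto simp: t_def dist_real_def)
  define r where "r = Re (\<phi> t)"
  have r: "(\<lambda>n. exp (- (v n * t\<^sup>2) / 2)) \<longlonglongrightarrow> r"
    using tendsto_Re[OF conv[of t]] by (simp add: r_def)
  have "Im (\<phi> t) = 0"
    using tendsto_Im[OF conv[of t]] by (simp add: LIMSEQ_const_iff)
  with t have r0: "r \<noteq> 0" by (auto simp: r_def complex_eq_iff)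
  have "r \<ge> 0" by (rule LIMSEQ_le_const[OF r]) auto
  with r0 have r0: "r > 0" by simp
  \<comment> \<open>\<open>u\<close> solves exp (-u t^2 / 2) = r at this single t; for every other t
    the limit is then determined by the convergence of \<open>v\<close>.\<close>
  define u where "u = - 2 * ln r / t\<^sup>2"
  have "(\<lambda>n. - 2 * ln (exp (- (v n * t\<^sup>2) / 2)) / t\<^sup>2) \<longlonglongrightarrow> u"
    unfolding u_def using r0 t by (intro tendsto_intros r) auto
  then have vu: "v \<longlonglongrightarrow> u" using t by simp
  have u0: "u \<ge> 0" by (rule LIMSEQ_le_const[OF vu]) (use v in auto)
  have "char (distr M borel W) = char (normal_law 0 u)"
  proof
    fix t
    have "(\<lambda>n. complex_of_real (exp (- (v n * t\<^sup>2) / 2))) \<longlonglongrightarrow> complex_of_real (exp (- (u * t\<^sup>2) / 2))"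
      by (intro tendsto_intros vu) auto
    then show "char (distr M borel W) t = char (normal_law 0 u) t"
      using conv[of t] LIMSEQ_unique unfolding \<phi>_def char_normal_law[OF u0] by blast
  qed
  then have "distr M borel W = normal_law 0 u"
    by (rule Levy_uniqueness[OF D.real_distribution_axioms real_distribution_normal_law[OF u0]])
  with vu u0 show ?thesis by auto
qed

end

section \<open>Linear images and almost sure limits of Gaussian processes\<close>

lemma centered_gaussian_processD:
  assumes "centered_gaussian_process M T X"
  shows "t \<in> T \<Longrightarrow> X t \<in> borel_measurable M"
    and "finite J \<Longrightarrow> J \<subseteq> T \<Longrightarrow> \<exists>v\<ge>0. distr M borel (\<lambda>\<omega>. \<Sum>t\<in>J. c t * X t \<omega>) = normal_law 0 v"
  using assms unfolding centered_gaussian_process_def by blast+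

lemma centered_gaussian_process_linear:
  assumes X: "centered_gaussian_process M T X"
    and I: "\<And>p. p \<in> T' \<Longrightarrow> finite (I p)" and q: "\<And>p j. p \<in> T' \<Longrightarrow> j \<in> I p \<Longrightarrow> q p j \<in> T"
  shows "centered_gaussian_process M T' (\<lambda>p \<omega>. \<Sum>j\<in>I p. a p j * X (q p j) \<omega>)"
  unfolding centered_gaussian_process_def
proof (intro conjI ballI allI impI)
  fix p assume "p \<in> T'"
  then show "(\<lambda>\<omega>. \<Sum>j\<in>I p. a p j * X (q p j) \<omega>) \<in> borel_measurable M"
    using q centered_gaussian_processD(1)[OF X] by (intro borel_measurable_sum borel_measurable_times) auto
next
  fix J and c :: "_ \<Rightarrow> real" assume J: "finite J \<and> J \<subseteq> T'"
  define S where "S = Sigma J I"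
  define h where "h x = q (fst x) (snd x)" for x
  \<comment> \<open>\<open>q\<close> need not be injective, whereas Gaussianity is stated for sums
    over sets of indices; the coefficients of all pairs with the same target are therefore
    collected.\<close>
  define b where "b r = (\<Sum>x\<in>{x\<in>S. h x = r}. c (fst x) * a (fst x) (snd x))" for r
  have fI: "finite (I p)" if "p \<in> J" for p using J I that by blast
  have S: "finite S" using J fI unfolding S_def by blast
  have hS: "h ` S \<subseteq> T" using J q by (auto simp: S_def h_def)
  have "(\<Sum>p\<in>J. c p * (\<Sum>j\<in>I p. a p j * X (q p j) \<omega>)) = (\<Sum>r\<in>h ` S. b r * X r \<omega>)" for \<omega>
  proof -
    have "(\<Sum>p\<in>J. c p * (\<Sum>j\<in>I p. a p j * X (q p j) \<omega>)) = (\<Sum>p\<in>J. \<Sum>j\<in>I p. c p * a p j * X (q p j) \<omega>)"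
      by (simp add: sum_distrib_left mult.assoc)
    also have "\<dots> = (\<Sum>x\<in>S. c (fst x) * a (fst x) (snd x) * X (h x) \<omega>)"
      using J fI by (subst sum.Sigma) (auto simp: split_def S_def h_def)
    also have "\<dots> = (\<Sum>r\<in>h ` S. \<Sum>x\<in>{x\<in>S. h x = r}. c (fst x) * a (fst x) (snd x) * X (h x) \<omega>)"
      using S by (intro sum.group[symmetric]) auto
    also have "\<dots> = (\<Sum>r\<in>h ` S. b r * X r \<omega>)"
      unfolding b_def sum_distrib_right by (intro sum.cong refl) auto
    finally show ?thesis .
  qed
  moreover have "\<exists>v\<ge>0. distr M borel (\<lambda>\<omega>. \<Sum>r\<in>h ` S. b r * X r \<omega>) = normal_law 0 v"
    using S hS by (intro centered_gaussian_processD(2)[OF X]) auto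
  ultimately show "\<exists>v\<ge>0. distr M borel (\<lambda>\<omega>. \<Sum>p\<in>J. c p * (\<Sum>j\<in>I p. a p j * X (q p j) \<omega>)) = normal_law 0 v"
    by simp
qed

lemma centered_gaussian_process_subset:
  "centered_gaussian_process M T X \<Longrightarrow> T' \<subseteq> T \<Longrightarrow> centered_gaussian_process M T' X"
  unfolding centered_gaussian_process_def by blast

context prob_space
begin

text \<open>The case p = q is separate because a sum over the set {p, q} would then count
  \<open>X p\<close> only once.\<close>

lemma centered_gaussian_process_comb:
  assumes X: "centered_gaussian_process M T X" and p: "p \<in> T" "q \<in> T"
  shows "\<exists>v\<ge>0. distr M borel (\<lambda>\<omega>. X p \<omega> + X q \<omega>) = normal_law 0 v"
proof (cases "p = q")
  case True
  have "\<exists>v\<ge>0. distr M borel (\<lambda>\<omega>. \<Sum>t\<in>{p}. 2 * X t \<omega>) = normal_law 0 v"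
    by (rule centered_gaussian_processD(2)[OF X]) (use p in auto)
  then show ?thesis using True by simp
next
  case False
  have "\<exists>v\<ge>0. distr M borel (\<lambda>\<omega>. \<Sum>t\<in>{p, q}. 1 * X t \<omega>) = normal_law 0 v"
    by (rule centered_gaussian_processD(2)[OF X]) (use p in auto)
  then show ?thesis using False by simp
qed

lemma centered_gaussian_process_single:
  assumes X: "centered_gaussian_process M T X" and p: "p \<in> T"
  shows "\<exists>v\<ge>0. distr M borel (X p) = normal_law 0 v"
proof -
  have "\<exists>v\<ge>0. distr M borel (\<lambda>\<omega>. \<Sum>t\<in>{p}. 1 * X t \<omega>) = normal_law 0 v"
    by (rule centered_gaussian_processD(2)[OF X]) (use p in auto)
  then show ?thesis by simp
qed

text \<open>The definition speaks of laws of linear combinations only. Products are reached through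
  squares, whose integrability is a fact about one-dimensional normal laws.\<close>

lemma centered_gaussian_process_polarize:
  assumes X: "centered_gaussian_process M T X" and p: "p \<in> T" "q \<in> T"
  shows "expectation (\<lambda>\<omega>. X p \<omega> * X q \<omega>) =
    (expectation (\<lambda>\<omega>. (X p \<omega> + X q \<omega>)\<^sup>2) - expectation (\<lambda>\<omega>. (X p \<omega>)\<^sup>2) - expectation (\<lambda>\<omega>. (X q \<omega>)\<^sup>2)) / 2"
    "integrable M (\<lambda>\<omega>. X p \<omega> * X q \<omega>)"
proof -
  have m[measurable]: "X p \<in> borel_measurable M" "X q \<in> borel_measurable M"
    using X p unfolding centered_gaussian_process_def by auto
  obtain v where v: "v \<ge> 0" "distr M borel (\<lambda>\<omega>. X p \<omega> + X q \<omega>) = normal_law 0 v"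
    using centered_gaussian_process_comb[OF X p] by auto
  obtain v1 where v1: "v1 \<ge> 0" "distr M borel (X p) = normal_law 0 v1"
    using centered_gaussian_process_single[OF X p(1)] by auto
  obtain v2 where v2: "v2 \<ge> 0" "distr M borel (X q) = normal_law 0 v2"
    using centered_gaussian_process_single[OF X p(2)] by auto
  have i: "integrable M (\<lambda>\<omega>. (X p \<omega> + X q \<omega>)\<^sup>2)" "integrable M (\<lambda>\<omega>. (X p \<omega>)\<^sup>2)" "integrable M (\<lambda>\<omega>. (X q \<omega>)\<^sup>2)"
    using normal_law_distrD(1)[OF _ v(2,1)] normal_law_distrD(1)[OF _ v1(2,1)] normal_law_distrD(1)[OF _ v2(2,1)] by auto
  have eq: "X p \<omega> * X q \<omega> = ((X p \<omega> + X q \<omega>)\<^sup>2 - (X p \<omega>)\<^sup>2 - (X q \<omega>)\<^sup>2) / 2" for \<omega>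
    by (simp add: power2_sum)
  show "expectation (\<lambda>\<omega>. X p \<omega> * X q \<omega>) =
    (expectation (\<lambda>\<omega>. (X p \<omega> + X q \<omega>)\<^sup>2) - expectation (\<lambda>\<omega>. (X p \<omega>)\<^sup>2) - expectation (\<lambda>\<omega>. (X q \<omega>)\<^sup>2)) / 2"
    unfolding eq using i by simp
  show "integrable M (\<lambda>\<omega>. X p \<omega> * X q \<omega>)"
    unfolding eq using i by simp
qed

text \<open>Each linear combination converges almost surely, so the one-dimensional limit theorem
  applies to it. Covariances converge by polarization, because the variances of
  \<open>X n p\<close>, \<open>X n q\<close> and their sum do.\<close>

lemma AE_limit_centered_gaussian_process:
  fixes X :: "nat \<Rightarrow> 'i \<Rightarrow> 'a \<Rightarrow> real"
  assumes X: "\<And>n. centered_gaussian_process M T (X n)"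
    and Z: "\<And>p. p \<in> T \<Longrightarrow> Z p \<in> borel_measurable M"
    and lim: "\<And>p. p \<in> T \<Longrightarrow> AE \<omega> in M. (\<lambda>n. X n p \<omega>) \<longlonglongrightarrow> Z p \<omega>"
  shows "centered_gaussian_process M T Z"
    and "\<And>p q. p \<in> T \<Longrightarrow> q \<in> T \<Longrightarrow>
      (\<lambda>n. expectation (\<lambda>\<omega>. X n p \<omega> * X n q \<omega>)) \<longlonglongrightarrow> expectation (\<lambda>\<omega>. Z p \<omega> * Z q \<omega>)"
proof -
  have Xm: "X n p \<in> borel_measurable M" if "p \<in> T" for n p
    using X that unfolding centered_gaussian_process_def by auto
  show G: "centered_gaussian_process M T Z"
    unfolding centered_gaussian_process_def
  proof (intro conjI ballI allI impI Z)
    fix J and c :: "'i \<Rightarrow> real" assume J: "finite J \<and> J \<subseteq> T"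
    have "\<forall>n. \<exists>v\<ge>0. distr M borel (\<lambda>\<omega>. \<Sum>t\<in>J. c t * X n t \<omega>) = normal_law 0 v"
      using X J unfolding centered_gaussian_process_def by blast
    then obtain v where v: "\<And>n. v n \<ge> 0" "\<And>n. distr M borel (\<lambda>\<omega>. \<Sum>t\<in>J. c t * X n t \<omega>) = normal_law 0 (v n)"
      by metis
    have "AE \<omega> in M. \<forall>p\<in>J. (\<lambda>n. X n p \<omega>) \<longlonglongrightarrow> Z p \<omega>"
      using J lim by (intro AE_finite_allI) auto
    then have "AE \<omega> in M. (\<lambda>n. \<Sum>t\<in>J. c t * X n t \<omega>) \<longlonglongrightarrow> (\<Sum>t\<in>J. c t * Z t \<omega>)"
      by eventually_elim (intro tendsto_intros, auto)
    moreover have "(\<lambda>\<omega>. \<Sum>t\<in>J. c t * X n t \<omega>) \<in> borel_measurable M" for n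
      using J Xm by (intro borel_measurable_sum borel_measurable_times) auto
    moreover have "(\<lambda>\<omega>. \<Sum>t\<in>J. c t * Z t \<omega>) \<in> borel_measurable M"
      using J Z by (intro borel_measurable_sum borel_measurable_times) auto
    ultimately obtain u where "u \<ge> 0" "distr M borel (\<lambda>\<omega>. \<Sum>t\<in>J. c t * Z t \<omega>) = normal_law 0 u"
      using AE_limit_normal_law[of "\<lambda>n \<omega>. \<Sum>t\<in>J. c t * X n t \<omega>", OF _ _ v(2) v(1)] by blast
    then show "\<exists>u\<ge>0. distr M borel (\<lambda>\<omega>. \<Sum>t\<in>J. c t * Z t \<omega>) = normal_law 0 u" by auto
  qed
  have sq: "(\<lambda>n. expectation (\<lambda>\<omega>. (V n \<omega>)\<^sup>2)) \<longlonglongrightarrow> expectation (\<lambda>\<omega>. (W \<omega>)\<^sup>2)"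
    if V: "\<And>n. V n \<in> borel_measurable M" and W: "W \<in> borel_measurable M"
      and d: "\<And>n. \<exists>v\<ge>0. distr M borel (V n) = normal_law 0 v"
      and l: "AE \<omega> in M. (\<lambda>n. V n \<omega>) \<longlonglongrightarrow> W \<omega>" for V :: "nat \<Rightarrow> 'a \<Rightarrow> real" and W
  proof -
    obtain v where v: "\<And>n. v n \<ge> 0" "\<And>n. distr M borel (V n) = normal_law 0 (v n)" using d by metis
    obtain u where u: "u \<ge> 0" "distr M borel W = normal_law 0 u" "v \<longlonglongrightarrow> u"
      using AE_limit_normal_law[OF V W v(2) v(1) l] by auto
    show ?thesis
      using u(3) normal_law_distrD(2)[OF V v(2) v(1)] normal_law_distrD(2)[OF W u(2) u(1)] by simp
  qed
  fix p q assume p: "p \<in> T" and q: "q \<in> T"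
  note pol = centered_gaussian_process_polarize(1)[OF _ p q]
  show "(\<lambda>n. expectation (\<lambda>\<omega>. X n p \<omega> * X n q \<omega>)) \<longlonglongrightarrow> expectation (\<lambda>\<omega>. Z p \<omega> * Z q \<omega>)"
    unfolding pol[OF X] pol[OF G]
  proof (intro tendsto_intros sq)
    show "AE \<omega> in M. (\<lambda>n. X n p \<omega> + X n q \<omega>) \<longlonglongrightarrow> Z p \<omega> + Z q \<omega>"
      using lim[OF p] lim[OF q] by eventually_elim (intro tendsto_intros)
  qed (use Xm Z p q lim centered_gaussian_process_comb[OF X p q] centered_gaussian_process_single[OF X p]
        centered_gaussian_process_single[OF X q] in auto)
qed

end

section \<open>Gaussian integration by parts\<close>

text \<open>A class closed under sums, products and powers that contains all polynomials in jointly
  Gaussian variables. It reduces the integrability obligations of the moment computations to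
  \<open>all_moments_intros\<close>.\<close>

definition all_moments :: "'a measure \<Rightarrow> ('a \<Rightarrow> real) \<Rightarrow> bool" where
  "all_moments M F \<longleftrightarrow> F \<in> borel_measurable M \<and> (\<forall>k. integrable M (\<lambda>\<omega>. \<bar>F \<omega>\<bar> ^ k))"

lemma all_moments_measurable: "all_moments M F \<Longrightarrow> F \<in> borel_measurable M"
  by (simp add: all_moments_def)

lemma all_moments_integrable: "all_moments M F \<Longrightarrow> integrable M F"
  unfolding all_moments_def
  by (metis (no_types, lifting) Bochner_Integration.integrable_cong integrable_abs_iff power_one_right)

lemma all_moments_mult:
  assumes "all_moments M F" "all_moments M G"
  shows "all_moments M (\<lambda>\<omega>. F \<omega> * G \<omega>)"
  unfolding all_moments_def
proof (intro conjI allI)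
  have [measurable]: "F \<in> borel_measurable M" "G \<in> borel_measurable M"
    using assms by (auto simp: all_moments_def)
  show "(\<lambda>\<omega>. F \<omega> * G \<omega>) \<in> borel_measurable M" by measurable
  fix k
  have "integrable M (\<lambda>\<omega>. \<bar>F \<omega>\<bar> ^ (2 * k) + \<bar>G \<omega>\<bar> ^ (2 * k))"
    using assms unfolding all_moments_def by (intro Bochner_Integration.integrable_add) blast+
  then show "integrable M (\<lambda>\<omega>. \<bar>F \<omega> * G \<omega>\<bar> ^ k)"
  proof (rule Bochner_Integration.integrable_bound)
    have "x * y \<le> x\<^sup>2 + y\<^sup>2" if "x \<ge> 0" "y \<ge> 0" for x y :: real
    proof -
      have "2 * (x * y) \<le> x\<^sup>2 + y\<^sup>2" using sum_squares_bound[of x y] by simp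
      moreover have "0 \<le> x * y" using that by simp
      ultimately show ?thesis by linarith
    qed
    from this[of "\<bar>F \<omega>\<bar> ^ k" "\<bar>G \<omega>\<bar> ^ k" for \<omega>]
    have "\<bar>F \<omega> * G \<omega>\<bar> ^ k \<le> \<bar>F \<omega>\<bar> ^ (2 * k) + \<bar>G \<omega>\<bar> ^ (2 * k)" for \<omega>
      by (simp add: abs_mult power_mult_distrib power_even_eq)
    then show "AE \<omega> in M. norm (\<bar>F \<omega> * G \<omega>\<bar> ^ k) \<le> norm (\<bar>F \<omega>\<bar> ^ (2 * k) + \<bar>G \<omega>\<bar> ^ (2 * k))"
      by (intro AE_I2) (simp add: abs_of_nonneg)
  qed measurable
qed

lemma all_moments_add:
  assumes "all_moments M F" "all_moments M G"
  shows "all_moments M (\<lambda>\<omega>. F \<omega> + G \<omega>)"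
  unfolding all_moments_def
proof (intro conjI allI)
  have [measurable]: "F \<in> borel_measurable M" "G \<in> borel_measurable M"
    using assms by (auto simp: all_moments_def)
  show "(\<lambda>\<omega>. F \<omega> + G \<omega>) \<in> borel_measurable M" by measurable
  fix k
  have "integrable M (\<lambda>\<omega>. 2 ^ k * (\<bar>F \<omega>\<bar> ^ k + \<bar>G \<omega>\<bar> ^ k))"
    using assms unfolding all_moments_def by (intro integrable_mult_right Bochner_Integration.integrable_add) blast+
  then show "integrable M (\<lambda>\<omega>. \<bar>F \<omega> + G \<omega>\<bar> ^ k)"
  proof (rule Bochner_Integration.integrable_bound)
    have "\<bar>x + y\<bar> ^ k \<le> 2 ^ k * (\<bar>x\<bar> ^ k + \<bar>y\<bar> ^ k)" for x y :: real
    proof -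
      have "\<bar>x + y\<bar> ^ k \<le> (2 * max \<bar>x\<bar> \<bar>y\<bar>) ^ k" by (intro power_mono) auto
      also have "\<dots> = 2 ^ k * (max \<bar>x\<bar> \<bar>y\<bar>) ^ k" by (simp add: power_mult_distrib)
      also have "\<dots> \<le> 2 ^ k * (\<bar>x\<bar> ^ k + \<bar>y\<bar> ^ k)" by (intro mult_left_mono) (auto simp: max_def)
      finally show ?thesis .
    qed
    then show "AE \<omega> in M. norm (\<bar>F \<omega> + G \<omega>\<bar> ^ k) \<le> norm (2 ^ k * (\<bar>F \<omega>\<bar> ^ k + \<bar>G \<omega>\<bar> ^ k))"
      by (intro AE_I2) (simp add: abs_of_nonneg)
  qed measurable
qed

context prob_space
begin

lemma all_moments_const: "all_moments M (\<lambda>_. c)"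
  by (simp add: all_moments_def)

lemma all_moments_cmult: "all_moments M F \<Longrightarrow> all_moments M (\<lambda>\<omega>. c * F \<omega>)"
  by (rule all_moments_mult[OF all_moments_const])

lemma all_moments_sum: "(\<And>i. i \<in> I \<Longrightarrow> all_moments M (F i)) \<Longrightarrow> all_moments M (\<lambda>\<omega>. \<Sum>i\<in>I. F i \<omega>)"
  by (induction I rule: infinite_finite_induct) (auto intro: all_moments_const all_moments_add)

lemma all_moments_power: "all_moments M F \<Longrightarrow> all_moments M (\<lambda>\<omega>. F \<omega> ^ k)"
  by (induction k) (auto intro: all_moments_const all_moments_mult)

lemma all_moments_diff: "all_moments M F \<Longrightarrow> all_moments M G \<Longrightarrow> all_moments M (\<lambda>\<omega>. F \<omega> - G \<omega>)"
  using all_moments_add[OF _ all_moments_cmult[of G "-1"], of F] by simp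

lemmas all_moments_intros = all_moments_const all_moments_cmult all_moments_sum all_moments_power
  all_moments_add all_moments_mult all_moments_diff

lemma expectation_double_sum:
  assumes F: "\<And>p q. p \<in> A \<Longrightarrow> q \<in> B \<Longrightarrow> all_moments M (F p q)"
  shows "expectation (\<lambda>\<omega>. \<Sum>p\<in>A. \<Sum>q\<in>B. a p q * F p q \<omega>) = (\<Sum>p\<in>A. \<Sum>q\<in>B. a p q * expectation (F p q))"
proof -
  have "expectation (\<lambda>\<omega>. \<Sum>p\<in>A. \<Sum>q\<in>B. a p q * F p q \<omega>) = (\<Sum>p\<in>A. expectation (\<lambda>\<omega>. \<Sum>q\<in>B. a p q * F p q \<omega>))"
    by (intro Bochner_Integration.integral_sum all_moments_integrable all_moments_intros F)
  also have "\<dots> = (\<Sum>p\<in>A. \<Sum>q\<in>B. expectation (\<lambda>\<omega>. a p q * F p q \<omega>))"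
    by (intro sum.cong refl Bochner_Integration.integral_sum all_moments_integrable all_moments_intros F)
  finally show ?thesis by simp
qed

text \<open>The expectation is a polynomial in h, so no limit has to be interchanged with it: one
  factor A + h B is split off, and the induction runs over all weights G at once.\<close>

lemma has_real_derivative_expectation_power:
  assumes "all_moments M G" "all_moments M A" "all_moments M B"
  shows "((\<lambda>h. expectation (\<lambda>\<omega>. G \<omega> * (A \<omega> + h * B \<omega>) ^ m)) has_real_derivative
    (real m * expectation (\<lambda>\<omega>. G \<omega> * B \<omega> * A \<omega> ^ (m - 1)))) (at 0)"
  using assms(1)
proof (induction m arbitrary: G)
  case 0
  then show ?case by simp
next
  case (Suc m)
  note am = Suc.prems assms(2,3)
  have eq: "expectation (\<lambda>\<omega>. G \<omega> * (A \<omega> + h * B \<omega>) ^ Suc m) =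
    expectation (\<lambda>\<omega>. (G \<omega> * A \<omega>) * (A \<omega> + h * B \<omega>) ^ m) + h * expectation (\<lambda>\<omega>. (G \<omega> * B \<omega>) * (A \<omega> + h * B \<omega>) ^ m)" for h
  proof -
    have "G \<omega> * (A \<omega> + h * B \<omega>) ^ Suc m = (G \<omega> * A \<omega>) * (A \<omega> + h * B \<omega>) ^ m + h * ((G \<omega> * B \<omega>) * (A \<omega> + h * B \<omega>) ^ m)" for \<omega>
      by (simp add: algebra_simps)
    moreover have "integrable M (\<lambda>\<omega>. (G \<omega> * A \<omega>) * (A \<omega> + h * B \<omega>) ^ m)"
      "integrable M (\<lambda>\<omega>. h * ((G \<omega> * B \<omega>) * (A \<omega> + h * B \<omega>) ^ m))"
      by (intro all_moments_integrable all_moments_intros am)+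
    ultimately show ?thesis by simp
  qed
  have 1: "((\<lambda>h. expectation (\<lambda>\<omega>. (G \<omega> * A \<omega>) * (A \<omega> + h * B \<omega>) ^ m)) has_real_derivative
    (real m * expectation (\<lambda>\<omega>. (G \<omega> * A \<omega>) * B \<omega> * A \<omega> ^ (m - 1)))) (at 0)"
    by (intro Suc.IH all_moments_intros am)
  have 2: "((\<lambda>h. expectation (\<lambda>\<omega>. (G \<omega> * B \<omega>) * (A \<omega> + h * B \<omega>) ^ m)) has_real_derivative
    (real m * expectation (\<lambda>\<omega>. (G \<omega> * B \<omega>) * B \<omega> * A \<omega> ^ (m - 1)))) (at 0)"
    by (intro Suc.IH all_moments_intros am)
  have 3: "real m * expectation (\<lambda>\<omega>. (G \<omega> * A \<omega>) * B \<omega> * A \<omega> ^ (m - 1)) + expectation (\<lambda>\<omega>. G \<omega> * B \<omega> * A \<omega> ^ m)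
      = real (Suc m) * expectation (\<lambda>\<omega>. G \<omega> * B \<omega> * A \<omega> ^ m)"
  proof (cases m)
    case (Suc k)
    have "(\<lambda>\<omega>. (G \<omega> * A \<omega>) * B \<omega> * A \<omega> ^ (m - 1)) = (\<lambda>\<omega>. G \<omega> * B \<omega> * A \<omega> ^ m)"
      by (simp add: Suc fun_eq_iff)
    then show ?thesis by (simp add: algebra_simps)
  qed simp
  show ?case
    unfolding eq using 3
    by (auto intro!: derivative_eq_intros 1 2)
qed

end

section \<open>Linear forms of a Gaussian vector and Stein's identity\<close>

locale gaussian_vector = prob_space M for M :: "'a measure" +
  fixes P :: "'i set" and X :: "'i \<Rightarrow> 'a \<Rightarrow> real"
  assumes finite_P: "finite P" and gaussian: "centered_gaussian_process M P X"
begin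

definition C :: "'i \<Rightarrow> 'i \<Rightarrow> real" where
  "C p q = expectation (\<lambda>\<omega>. X p \<omega> * X q \<omega>)"

definition L :: "('i \<Rightarrow> real) \<Rightarrow> 'a \<Rightarrow> real" where
  "L c \<omega> = (\<Sum>p\<in>P. c p * X p \<omega>)"

lemma C_commute: "C p q = C q p"
  by (simp add: C_def mult.commute)

lemma L_normal:
  obtains v where "v \<ge> 0" "distr M borel (L c) = normal_law 0 v"
  using centered_gaussian_processD(2)[OF gaussian finite_P order_refl, of c] unfolding L_def by blast

lemma L_measurable: "L c \<in> borel_measurable M"
  unfolding L_def using centered_gaussian_processD(1)[OF gaussian] by (intro borel_measurable_sum borel_measurable_times) auto

lemma all_moments_L: "all_moments M (L c)"
proof -
  obtain v where v: "v \<ge> 0" "distr M borel (L c) = normal_law 0 v" by (rule L_normal)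
  have "integrable M (\<lambda>\<omega>. \<bar>L c \<omega>\<bar> ^ k)" for k
    using integrable_abs[OF normal_law_distrD(1)[OF L_measurable v(2,1), of k]] by (simp add: power_abs)
  then show ?thesis by (simp add: all_moments_def L_measurable)
qed

lemma X_eq_L: "p \<in> P \<Longrightarrow> X p \<omega> = L (\<lambda>q. of_bool (q = p)) \<omega>"
  by (simp add: L_def finite_P of_bool_def if_distrib[of "\<lambda>x. x * _"] cong: if_cong)

lemma all_moments_X: "p \<in> P \<Longrightarrow> all_moments M (X p)"
  using all_moments_L[of "\<lambda>q. of_bool (q = p)"] ext[of "X p" "L (\<lambda>q. of_bool (q = p))", OF X_eq_L] by simp

text \<open>Moving the coefficients along a coordinate direction stays within the linear forms, so
  every identity valid for all \<open>L c\<close> may be differentiated in h.\<close>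

lemma L_add: "p \<in> P \<Longrightarrow> L (\<lambda>q. c q + h * of_bool (q = p)) \<omega> = L c \<omega> + h * X p \<omega>"
  unfolding X_eq_L by (simp add: L_def sum.distrib distrib_right sum_distrib_left mult.assoc)

lemma L_moment_rec: "expectation (\<lambda>\<omega>. L c \<omega> ^ (k + 2)) =
  real (k + 1) * expectation (\<lambda>\<omega>. (L c \<omega>)\<^sup>2) * expectation (\<lambda>\<omega>. L c \<omega> ^ k)"
proof -
  obtain v where v: "v \<ge> 0" "distr M borel (L c) = normal_law 0 v" by (rule L_normal)
  show ?thesis
    using normal_law_distrD(2,3)[OF L_measurable v(2,1)] by simp
qed

lemma L_mean: "expectation (L c) = 0"
proof -
  obtain v where v: "v \<ge> 0" "distr M borel (L c) = normal_law 0 v" by (rule L_normal)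
  have "expectation (L c) = (LINT x|normal_law 0 v. x ^ 1)"
    unfolding v(2)[symmetric] using L_measurable by (subst integral_distr) auto
  then show ?thesis using normal_law_odd_moment[OF v(1), of 1] by simp
qed

lemma X_mean: "p \<in> P \<Longrightarrow> expectation (X p) = 0"
  using L_mean[of "\<lambda>q. of_bool (q = p)"] ext[of "X p" "L (\<lambda>q. of_bool (q = p))", OF X_eq_L] by simp

definition CL :: "('i \<Rightarrow> real) \<Rightarrow> 'i \<Rightarrow> real" where
  "CL c p = (\<Sum>q\<in>P. C p q * c q)"

lemma expectation_X_L: "p \<in> P \<Longrightarrow> expectation (\<lambda>\<omega>. X p \<omega> * L c \<omega>) = CL c p"
proof -
  assume p: "p \<in> P"
  have "expectation (\<lambda>\<omega>. X p \<omega> * L c \<omega>) = expectation (\<lambda>\<omega>. \<Sum>q\<in>P. c q * (X p \<omega> * X q \<omega>))"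
    by (simp add: L_def sum_distrib_left mult_ac)
  also have "\<dots> = (\<Sum>q\<in>P. expectation (\<lambda>\<omega>. c q * (X p \<omega> * X q \<omega>)))"
    by (intro Bochner_Integration.integral_sum all_moments_integrable all_moments_intros all_moments_X p)
  finally show ?thesis by (simp add: CL_def C_def mult.commute)
qed

lemma CL_add: "r \<in> P \<Longrightarrow> CL (\<lambda>q. c q + h * of_bool (q = r)) p = CL c p + h * C p r"
proof -
  assume r: "r \<in> P"
  have "(\<Sum>q\<in>P. C p q * (h * of_bool (q = r))) = (\<Sum>q\<in>P. if q = r then C p q * h else 0)"
    by (intro sum.cong) auto
  also have "\<dots> = h * C p r" using r finite_P by simp
  finally show ?thesis by (simp add: CL_def sum.distrib distrib_left)
qed

text \<open>The recursion \<open>L_moment_rec\<close> holds along the whole line through c in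
  direction p. Its derivative at h = 0 contains the wanted expectation with exponent k + 1 and
  another one with exponent k - 1, which strong induction removes.\<close>

lemma expectation_X_L_power:
  assumes p: "p \<in> P"
  shows "expectation (\<lambda>\<omega>. X p \<omega> * L c \<omega> ^ m) = real m * CL c p * expectation (\<lambda>\<omega>. L c \<omega> ^ (m - 1))"
proof (induction m rule: less_induct)
  case (less m)
  show ?case
  proof (cases m)
    case 0
    then show ?thesis using X_mean[OF p] by simp
  next
    case (Suc k)
    note am = all_moments_X[OF p] all_moments_L[of c] all_moments_const
    let ?E = "\<lambda>m h. expectation (\<lambda>\<omega>. 1 * (L c \<omega> + h * X p \<omega>) ^ m)"
    have der: "(?E m has_real_derivative (real m * expectation (\<lambda>\<omega>. 1 * X p \<omega> * L c \<omega> ^ (m - 1)))) (at 0)" for m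
      by (intro has_real_derivative_expectation_power am)
    have eq: "?E (k + 2) h = real (k + 1) * ?E 2 h * ?E k h" for h
      using L_moment_rec[of "\<lambda>q. c q + h * of_bool (q = p)" k] L_add[OF p] by simp
    have "((\<lambda>h. real (k + 1) * ?E 2 h * ?E k h) has_real_derivative
      (real (k + 1) * (2 * expectation (\<lambda>\<omega>. X p \<omega> * L c \<omega>)) * expectation (\<lambda>\<omega>. L c \<omega> ^ k) +
       real (k + 1) * expectation (\<lambda>\<omega>. (L c \<omega>)\<^sup>2) * (real k * expectation (\<lambda>\<omega>. X p \<omega> * L c \<omega> ^ (k - 1))))) (at 0)"
      by (rule derivative_eq_intros refl der)+ simp
    moreover have "((\<lambda>h. real (k + 1) * ?E 2 h * ?E k h) has_real_derivative
        (real (k + 2) * expectation (\<lambda>\<omega>. X p \<omega> * L c \<omega> ^ (k + 1)))) (at 0)"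
      using der[of "k + 2"] unfolding eq by simp
    ultimately have e: "real (k + 2) * expectation (\<lambda>\<omega>. X p \<omega> * L c \<omega> ^ (k + 1)) =
      real (k + 1) * (2 * expectation (\<lambda>\<omega>. X p \<omega> * L c \<omega>)) * expectation (\<lambda>\<omega>. L c \<omega> ^ k) +
       real (k + 1) * expectation (\<lambda>\<omega>. (L c \<omega>)\<^sup>2) * (real k * expectation (\<lambda>\<omega>. X p \<omega> * L c \<omega> ^ (k - 1)))"
      using DERIV_unique by blast
    \<comment> \<open>The remaining term becomes a multiple of the leading one: the coefficients 2
      (k + 1) and k (k + 1) add up to (k + 1) (k + 2), and the factor k + 2 cancels.\<close>
    have "expectation (\<lambda>\<omega>. (L c \<omega>)\<^sup>2) * (real k * expectation (\<lambda>\<omega>. X p \<omega> * L c \<omega> ^ (k - 1)))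
      = real k * CL c p * expectation (\<lambda>\<omega>. L c \<omega> ^ k)"
    proof (cases "k \<ge> 2")
      case True
      then obtain j where j: "k = j + 2" by (metis add.commute le_Suc_ex)
      have "expectation (\<lambda>\<omega>. X p \<omega> * L c \<omega> ^ (k - 1)) = real (k - 1) * CL c p * expectation (\<lambda>\<omega>. L c \<omega> ^ j)"
        using less.IH[of "k - 1"] by (simp add: Suc j)
      moreover have "expectation (\<lambda>\<omega>. L c \<omega> ^ k) = real (k - 1) * expectation (\<lambda>\<omega>. (L c \<omega>)\<^sup>2) * expectation (\<lambda>\<omega>. L c \<omega> ^ j)"
        using L_moment_rec[of c j] by (simp add: j)
      ultimately show ?thesis by simp
    next
      case False
      then consider "k = 0" | "k = 1" by linarith
      then show ?thesis using X_mean[OF p] L_mean[of c] by cases auto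
    qed
    then have "real (k + 2) * expectation (\<lambda>\<omega>. X p \<omega> * L c \<omega> ^ (k + 1)) =
       real (k + 2) * (real (k + 1) * CL c p * expectation (\<lambda>\<omega>. L c \<omega> ^ k))"
      unfolding e expectation_X_L[OF p] by (simp only: mult.assoc) (simp add: distrib_right algebra_simps del: mult_cancel_left)
    then have "expectation (\<lambda>\<omega>. X p \<omega> * L c \<omega> ^ (k + 1)) = real (k + 1) * CL c p * expectation (\<lambda>\<omega>. L c \<omega> ^ k)"
      by (subst (asm) mult_left_cancel) auto
    then show ?thesis by (simp add: Suc)
  qed
qed

text \<open>Gaussian integration by parts for \<open>F\<close> with gradient \<open>D\<close>. Carrying the powers of an arbitrary
  linear form along makes the property stable under multiplication by a coordinate.\<close>

definition ibp :: "('a \<Rightarrow> real) \<Rightarrow> ('i \<Rightarrow> 'a \<Rightarrow> real) \<Rightarrow> bool" where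
  "ibp F D \<longleftrightarrow> all_moments M F \<and> (\<forall>q\<in>P. all_moments M (D q)) \<and>
    (\<forall>p\<in>P. \<forall>c m. expectation (\<lambda>\<omega>. X p \<omega> * F \<omega> * L c \<omega> ^ m) =
      real m * CL c p * expectation (\<lambda>\<omega>. F \<omega> * L c \<omega> ^ (m - 1)) +
      (\<Sum>q\<in>P. C p q * expectation (\<lambda>\<omega>. D q \<omega> * L c \<omega> ^ m)))"

lemma ibp_one: "ibp (\<lambda>_. 1) (\<lambda>_ _. 0)"
  unfolding ibp_def using expectation_X_L_power by (auto intro: all_moments_intros)

lemma ibp_cong: "ibp F D \<Longrightarrow> (\<And>\<omega>. F \<omega> = F' \<omega>) \<Longrightarrow> (\<And>q \<omega>. q \<in> P \<Longrightarrow> D q \<omega> = D' q \<omega>) \<Longrightarrow> ibp F' D'"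
proof -
  assume "ibp F D" "\<And>\<omega>. F \<omega> = F' \<omega>" and D: "\<And>q \<omega>. q \<in> P \<Longrightarrow> D q \<omega> = D' q \<omega>"
  moreover have "D q = D' q" if "q \<in> P" for q using D that by auto
  moreover have "F = F'" using calculation by auto
  ultimately show ?thesis unfolding ibp_def by simp
qed

lemma ibp_lin:
  assumes F: "\<And>k. k \<in> K \<Longrightarrow> ibp (F k) (D k)" and K: "finite K"
  shows "ibp (\<lambda>\<omega>. \<Sum>k\<in>K. a k * F k \<omega>) (\<lambda>q \<omega>. \<Sum>k\<in>K. a k * D k q \<omega>)"
  unfolding ibp_def
proof (intro conjI ballI allI)
  have aF: "all_moments M (F k)" if "k \<in> K" for k using F[OF that] by (simp add: ibp_def)
  have aD: "all_moments M (D k q)" if "k \<in> K" "q \<in> P" for k q using F that by (simp add: ibp_def)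
  show "all_moments M (\<lambda>\<omega>. \<Sum>k\<in>K. a k * F k \<omega>)" by (intro all_moments_intros aF)
  show "all_moments M (\<lambda>\<omega>. \<Sum>k\<in>K. a k * D k q \<omega>)" if "q \<in> P" for q
    by (intro all_moments_intros aD that)
  fix p c m assume p: "p \<in> P"
  note am = all_moments_integrable all_moments_X[OF p] all_moments_L
  have e: "expectation (\<lambda>\<omega>. (\<Sum>k\<in>K. a k * G k \<omega>) * H \<omega>) = (\<Sum>k\<in>K. a k * expectation (\<lambda>\<omega>. G k \<omega> * H \<omega>))"
    if "\<And>k. k \<in> K \<Longrightarrow> all_moments M (G k)" "all_moments M H" for G H
  proof -
    have "expectation (\<lambda>\<omega>. (\<Sum>k\<in>K. a k * G k \<omega>) * H \<omega>) = expectation (\<lambda>\<omega>. \<Sum>k\<in>K. a k * (G k \<omega> * H \<omega>))"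
      by (simp add: sum_distrib_right mult.assoc)
    also have "\<dots> = (\<Sum>k\<in>K. expectation (\<lambda>\<omega>. a k * (G k \<omega> * H \<omega>)))"
      by (intro Bochner_Integration.integral_sum all_moments_integrable all_moments_intros that)
    finally show ?thesis by simp
  qed
  have "expectation (\<lambda>\<omega>. X p \<omega> * (\<Sum>k\<in>K. a k * F k \<omega>) * L c \<omega> ^ m) =
    expectation (\<lambda>\<omega>. (\<Sum>k\<in>K. a k * F k \<omega>) * (X p \<omega> * L c \<omega> ^ m))"
    by (simp add: mult_ac)
  also have "\<dots> = (\<Sum>k\<in>K. a k * expectation (\<lambda>\<omega>. F k \<omega> * (X p \<omega> * L c \<omega> ^ m)))"
    by (intro e aF all_moments_intros am)
  also have "\<dots> = (\<Sum>k\<in>K. a k * (real m * CL c p * expectation (\<lambda>\<omega>. F k \<omega> * L c \<omega> ^ (m - 1)) +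
      (\<Sum>q\<in>P. C p q * expectation (\<lambda>\<omega>. D k q \<omega> * L c \<omega> ^ m))))"
  proof (intro sum.cong refl arg_cong2[where f="(*)"])
    fix k assume "k \<in> K"
    then have "expectation (\<lambda>\<omega>. X p \<omega> * F k \<omega> * L c \<omega> ^ m) = real m * CL c p * expectation (\<lambda>\<omega>. F k \<omega> * L c \<omega> ^ (m - 1)) +
      (\<Sum>q\<in>P. C p q * expectation (\<lambda>\<omega>. D k q \<omega> * L c \<omega> ^ m))"
      using F p unfolding ibp_def by blast
    then show "expectation (\<lambda>\<omega>. F k \<omega> * (X p \<omega> * L c \<omega> ^ m)) = real m * CL c p * expectation (\<lambda>\<omega>. F k \<omega> * L c \<omega> ^ (m - 1)) +
      (\<Sum>q\<in>P. C p q * expectation (\<lambda>\<omega>. D k q \<omega> * L c \<omega> ^ m))"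
      by (simp add: mult_ac)
  qed
  also have "\<dots> = real m * CL c p * (\<Sum>k\<in>K. a k * expectation (\<lambda>\<omega>. F k \<omega> * L c \<omega> ^ (m - 1))) +
      (\<Sum>q\<in>P. C p q * (\<Sum>k\<in>K. a k * expectation (\<lambda>\<omega>. D k q \<omega> * L c \<omega> ^ m)))"
    by (simp add: sum.distrib distrib_left sum_distrib_left sum.swap[of _ P K] mult_ac)
  also have "(\<Sum>k\<in>K. a k * expectation (\<lambda>\<omega>. F k \<omega> * L c \<omega> ^ (m - 1))) = expectation (\<lambda>\<omega>. (\<Sum>k\<in>K. a k * F k \<omega>) * L c \<omega> ^ (m - 1))"
    by (intro e[symmetric] aF all_moments_intros am)
  also have "(\<Sum>q\<in>P. C p q * (\<Sum>k\<in>K. a k * expectation (\<lambda>\<omega>. D k q \<omega> * L c \<omega> ^ m))) =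
    (\<Sum>q\<in>P. C p q * expectation (\<lambda>\<omega>. (\<Sum>k\<in>K. a k * D k q \<omega>) * L c \<omega> ^ m))"
    by (intro sum.cong refl arg_cong2[where f="(*)"] e[symmetric] aD all_moments_intros am)
  finally show "expectation (\<lambda>\<omega>. X p \<omega> * (\<Sum>k\<in>K. a k * F k \<omega>) * L c \<omega> ^ m) =
       real m * CL c p * expectation (\<lambda>\<omega>. (\<Sum>k\<in>K. a k * F k \<omega>) * L c \<omega> ^ (m - 1)) +
       (\<Sum>q\<in>P. C p q * expectation (\<lambda>\<omega>. (\<Sum>k\<in>K. a k * D k q \<omega>) * L c \<omega> ^ m))" .
qed

lemma ibp_add: "ibp F D \<Longrightarrow> ibp G E \<Longrightarrow> ibp (\<lambda>\<omega>. a * F \<omega> + b * G \<omega>) (\<lambda>q \<omega>. a * D q \<omega> + b * E q \<omega>)"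
  using ibp_lin[of "UNIV :: bool set" "\<lambda>k. if k then F else G" "\<lambda>k. if k then D else E" "\<lambda>k. if k then a else b"]
  by (simp add: UNIV_bool add.commute)

text \<open>The identity for F with exponent m + 1 is differentiated at h = 0 along c shifted in
  direction r. The derivative of the power brings down m + 1 and a factor \<open>X r\<close>, the
  derivative of \<open>CL\<close> brings the Kronecker term of the new gradient, and dividing by m +
  1 leaves the identity for X r * F with exponent m.\<close>

lemma ibp_X:
  assumes F: "ibp F D" and r: "r \<in> P"
  shows "ibp (\<lambda>\<omega>. X r \<omega> * F \<omega>) (\<lambda>q \<omega>. of_bool (q = r) * F \<omega> + X r \<omega> * D q \<omega>)"
  unfolding ibp_def
proof (intro conjI ballI allI)
  have aF: "all_moments M F" using F by (simp add: ibp_def)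
  have aD: "all_moments M (D q)" if "q \<in> P" for q using F that by (simp add: ibp_def)
  note ar = all_moments_X[OF r]
  show "all_moments M (\<lambda>\<omega>. X r \<omega> * F \<omega>)" by (intro all_moments_intros aF ar)
  show "all_moments M (\<lambda>\<omega>. of_bool (q = r) * F \<omega> + X r \<omega> * D q \<omega>)" if "q \<in> P" for q
    by (intro all_moments_intros aD aF ar that)
  fix p c m assume p: "p \<in> P"
  note am = aF ar all_moments_X[OF p] all_moments_L[of c] all_moments_intros
  let ?L = "\<lambda>h \<omega>. L c \<omega> + h * X r \<omega>"
  have eq: "expectation (\<lambda>\<omega>. X p \<omega> * F \<omega> * ?L h \<omega> ^ Suc m) =
      real (Suc m) * (CL c p + h * C p r) * expectation (\<lambda>\<omega>. F \<omega> * ?L h \<omega> ^ m) +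
      (\<Sum>q\<in>P. C p q * expectation (\<lambda>\<omega>. D q \<omega> * ?L h \<omega> ^ Suc m))" for h
  proof -
    have "expectation (\<lambda>\<omega>. X p \<omega> * F \<omega> * L c' \<omega> ^ Suc m) =
      real (Suc m) * CL c' p * expectation (\<lambda>\<omega>. F \<omega> * L c' \<omega> ^ m) +
      (\<Sum>q\<in>P. C p q * expectation (\<lambda>\<omega>. D q \<omega> * L c' \<omega> ^ Suc m))" for c'
    proof -
      have "expectation (\<lambda>\<omega>. X p \<omega> * F \<omega> * L c' \<omega> ^ Suc m) =
        real (Suc m) * CL c' p * expectation (\<lambda>\<omega>. F \<omega> * L c' \<omega> ^ (Suc m - 1)) +
        (\<Sum>q\<in>P. C p q * expectation (\<lambda>\<omega>. D q \<omega> * L c' \<omega> ^ Suc m))"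
        using F p unfolding ibp_def by blast
      then show ?thesis by (simp only: diff_Suc_1)
    qed
    from this[of "\<lambda>q. c q + h * of_bool (q = r)"] show ?thesis
      unfolding L_add[OF r] CL_add[OF r] .
  qed
  have "((\<lambda>h. expectation (\<lambda>\<omega>. X p \<omega> * F \<omega> * ?L h \<omega> ^ Suc m)) has_real_derivative
      real (Suc m) * expectation (\<lambda>\<omega>. (X p \<omega> * F \<omega>) * X r \<omega> * L c \<omega> ^ (Suc m - 1))) (at 0)"
    by (intro has_real_derivative_expectation_power am)
  moreover have "((\<lambda>h. real (Suc m) * (CL c p + h * C p r) * expectation (\<lambda>\<omega>. F \<omega> * ?L h \<omega> ^ m) +
      (\<Sum>q\<in>P. C p q * expectation (\<lambda>\<omega>. D q \<omega> * ?L h \<omega> ^ Suc m))) has_real_derivative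
     real (Suc m) * C p r * expectation (\<lambda>\<omega>. F \<omega> * L c \<omega> ^ m) +
     real (Suc m) * CL c p * (real m * expectation (\<lambda>\<omega>. F \<omega> * X r \<omega> * L c \<omega> ^ (m - 1))) +
     (\<Sum>q\<in>P. C p q * (real (Suc m) * expectation (\<lambda>\<omega>. D q \<omega> * X r \<omega> * L c \<omega> ^ (Suc m - 1))))) (at 0)"
  proof (rule DERIV_add)
    have "((\<lambda>h. expectation (\<lambda>\<omega>. F \<omega> * ?L h \<omega> ^ m)) has_real_derivative
      real m * expectation (\<lambda>\<omega>. F \<omega> * X r \<omega> * L c \<omega> ^ (m - 1))) (at 0)"
      by (intro has_real_derivative_expectation_power am)
    then show "((\<lambda>h. real (Suc m) * (CL c p + h * C p r) * expectation (\<lambda>\<omega>. F \<omega> * ?L h \<omega> ^ m)) has_real_derivative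
     real (Suc m) * C p r * expectation (\<lambda>\<omega>. F \<omega> * L c \<omega> ^ m) +
     real (Suc m) * CL c p * (real m * expectation (\<lambda>\<omega>. F \<omega> * X r \<omega> * L c \<omega> ^ (m - 1)))) (at 0)"
      by (auto intro!: derivative_eq_intros simp: algebra_simps)
    show "((\<lambda>h. \<Sum>q\<in>P. C p q * expectation (\<lambda>\<omega>. D q \<omega> * ?L h \<omega> ^ Suc m)) has_real_derivative
      (\<Sum>q\<in>P. C p q * (real (Suc m) * expectation (\<lambda>\<omega>. D q \<omega> * X r \<omega> * L c \<omega> ^ (Suc m - 1))))) (at 0)"
      by (intro DERIV_sum DERIV_cmult has_real_derivative_expectation_power aD am)
  qed
  ultimately have "real (Suc m) * expectation (\<lambda>\<omega>. (X p \<omega> * F \<omega>) * X r \<omega> * L c \<omega> ^ (Suc m - 1)) =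
     real (Suc m) * C p r * expectation (\<lambda>\<omega>. F \<omega> * L c \<omega> ^ m) +
     real (Suc m) * CL c p * (real m * expectation (\<lambda>\<omega>. F \<omega> * X r \<omega> * L c \<omega> ^ (m - 1))) +
     (\<Sum>q\<in>P. C p q * (real (Suc m) * expectation (\<lambda>\<omega>. D q \<omega> * X r \<omega> * L c \<omega> ^ (Suc m - 1))))"
    unfolding eq by (rule DERIV_unique)
  also have "\<dots> = real (Suc m) * (C p r * expectation (\<lambda>\<omega>. F \<omega> * L c \<omega> ^ m) +
     CL c p * (real m * expectation (\<lambda>\<omega>. F \<omega> * X r \<omega> * L c \<omega> ^ (m - 1))) +
     (\<Sum>q\<in>P. C p q * expectation (\<lambda>\<omega>. D q \<omega> * X r \<omega> * L c \<omega> ^ m)))"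
    by (simp add: distrib_left sum_distrib_left mult_ac)
  finally have *: "expectation (\<lambda>\<omega>. (X p \<omega> * F \<omega>) * X r \<omega> * L c \<omega> ^ m) = C p r * expectation (\<lambda>\<omega>. F \<omega> * L c \<omega> ^ m) +
     CL c p * (real m * expectation (\<lambda>\<omega>. F \<omega> * X r \<omega> * L c \<omega> ^ (m - 1))) +
     (\<Sum>q\<in>P. C p q * expectation (\<lambda>\<omega>. D q \<omega> * X r \<omega> * L c \<omega> ^ m))"
    by (subst (asm) mult_left_cancel) auto
  have "(\<Sum>q\<in>P. C p q * expectation (\<lambda>\<omega>. (of_bool (q = r) * F \<omega> + X r \<omega> * D q \<omega>) * L c \<omega> ^ m)) =
    (\<Sum>q\<in>P. C p q * (of_bool (q = r) * expectation (\<lambda>\<omega>. F \<omega> * L c \<omega> ^ m) + expectation (\<lambda>\<omega>. X r \<omega> * D q \<omega> * L c \<omega> ^ m)))"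
  proof (intro sum.cong refl arg_cong2[where f="(*)"])
    fix q assume q: "q \<in> P"
    have "expectation (\<lambda>\<omega>. (of_bool (q = r) * F \<omega> + X r \<omega> * D q \<omega>) * L c \<omega> ^ m) =
      expectation (\<lambda>\<omega>. of_bool (q = r) * (F \<omega> * L c \<omega> ^ m) + X r \<omega> * D q \<omega> * L c \<omega> ^ m)"
      by (simp add: distrib_right mult.assoc)
    also have "\<dots> = expectation (\<lambda>\<omega>. of_bool (q = r) * (F \<omega> * L c \<omega> ^ m)) + expectation (\<lambda>\<omega>. X r \<omega> * D q \<omega> * L c \<omega> ^ m)"
      by (intro Bochner_Integration.integral_add all_moments_integrable am aD q)
    finally show "expectation (\<lambda>\<omega>. (of_bool (q = r) * F \<omega> + X r \<omega> * D q \<omega>) * L c \<omega> ^ m) =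
      of_bool (q = r) * expectation (\<lambda>\<omega>. F \<omega> * L c \<omega> ^ m) + expectation (\<lambda>\<omega>. X r \<omega> * D q \<omega> * L c \<omega> ^ m)" by simp
  qed
  also have "\<dots> = (\<Sum>q\<in>P. if q = r then C p q * expectation (\<lambda>\<omega>. F \<omega> * L c \<omega> ^ m) else 0) +
     (\<Sum>q\<in>P. C p q * expectation (\<lambda>\<omega>. X r \<omega> * D q \<omega> * L c \<omega> ^ m))"
    by (simp add: distrib_left sum.distrib of_bool_def if_distrib[of "\<lambda>x. x * _"] if_distrib[of "\<lambda>x. _ * x"] cong: if_cong)
  also have "(\<Sum>q\<in>P. if q = r then C p q * expectation (\<lambda>\<omega>. F \<omega> * L c \<omega> ^ m) else 0) = C p r * expectation (\<lambda>\<omega>. F \<omega> * L c \<omega> ^ m)"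
    using r finite_P by simp
  finally show "expectation (\<lambda>\<omega>. X p \<omega> * (X r \<omega> * F \<omega>) * L c \<omega> ^ m) =
       real m * CL c p * expectation (\<lambda>\<omega>. X r \<omega> * F \<omega> * L c \<omega> ^ (m - 1)) +
       (\<Sum>q\<in>P. C p q * expectation (\<lambda>\<omega>. (of_bool (q = r) * F \<omega> + X r \<omega> * D q \<omega>) * L c \<omega> ^ m))"
    using * by (simp add: mult_ac)
qed

lemma ibpD:
  assumes "ibp F D" "p \<in> P"
  shows "expectation (\<lambda>\<omega>. X p \<omega> * F \<omega>) = (\<Sum>q\<in>P. C p q * expectation (D q))"
proof -
  have "expectation (\<lambda>\<omega>. X p \<omega> * F \<omega> * L (\<lambda>_. 0) \<omega> ^ 0) =
      real 0 * CL (\<lambda>_. 0) p * expectation (\<lambda>\<omega>. F \<omega> * L (\<lambda>_. 0) \<omega> ^ (0 - 1)) +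
      (\<Sum>q\<in>P. C p q * expectation (\<lambda>\<omega>. D q \<omega> * L (\<lambda>_. 0) \<omega> ^ 0))"
    using assms unfolding ibp_def by blast
  then show ?thesis by simp
qed

lemma ibp_moments: "ibp F D \<Longrightarrow> all_moments M F" "ibp F D \<Longrightarrow> q \<in> P \<Longrightarrow> all_moments M (D q)"
  by (simp_all add: ibp_def)

lemma ibp_X_D:
  assumes F: "ibp F D" and p: "p \<in> P" and r: "r \<in> P"
  shows "expectation (\<lambda>\<omega>. X p \<omega> * (X r \<omega> * F \<omega>)) = C p r * expectation F + (\<Sum>q\<in>P. C p q * expectation (\<lambda>\<omega>. X r \<omega> * D q \<omega>))"
proof -
  have "expectation (\<lambda>\<omega>. X p \<omega> * (X r \<omega> * F \<omega>)) = (\<Sum>q\<in>P. C p q * expectation (\<lambda>\<omega>. of_bool (q = r) * F \<omega> + X r \<omega> * D q \<omega>))"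
    by (rule ibpD[OF ibp_X[OF F r] p])
  also have "\<dots> = (\<Sum>q\<in>P. C p q * (of_bool (q = r) * expectation F + expectation (\<lambda>\<omega>. X r \<omega> * D q \<omega>)))"
  proof (intro sum.cong refl arg_cong2[where f="(*)"])
    fix q assume q: "q \<in> P"
    have "expectation (\<lambda>\<omega>. of_bool (q = r) * F \<omega> + X r \<omega> * D q \<omega>) = expectation (\<lambda>\<omega>. of_bool (q = r) * F \<omega>) + expectation (\<lambda>\<omega>. X r \<omega> * D q \<omega>)"
      by (intro Bochner_Integration.integral_add all_moments_integrable all_moments_intros ibp_moments[OF F] all_moments_X r q)
    then show "expectation (\<lambda>\<omega>. of_bool (q = r) * F \<omega> + X r \<omega> * D q \<omega>) = of_bool (q = r) * expectation F + expectation (\<lambda>\<omega>. X r \<omega> * D q \<omega>)" by simp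
  qed
  also have "\<dots> = (\<Sum>q\<in>P. if q = r then C p q * expectation F else 0) + (\<Sum>q\<in>P. C p q * expectation (\<lambda>\<omega>. X r \<omega> * D q \<omega>))"
    by (simp add: distrib_left sum.distrib of_bool_def if_distrib[of "\<lambda>x. x * _"] if_distrib[of "\<lambda>x. _ * x"] cong: if_cong)
  finally show ?thesis using r finite_P by simp
qed

text \<open>Obtained from integration by parts for \<open>X r * X s\<close>. The four indices may
  coincide, as happens when lagged products overlap.\<close>

lemma isserlis4:
  assumes "p \<in> P" "q \<in> P" "r \<in> P" "s \<in> P"
  shows "expectation (\<lambda>\<omega>. X p \<omega> * X q \<omega> * (X r \<omega> * X s \<omega>)) = C p q * C r s + C p r * C q s + C p s * C q r"
proof -
  have i1: "ibp (X s) (\<lambda>q _. of_bool (q = s))"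
    by (rule ibp_cong[OF ibp_X[OF ibp_one assms(4)]]) auto
  have i2: "ibp (\<lambda>\<omega>. X r \<omega> * X s \<omega>) (\<lambda>q \<omega>. of_bool (q = r) * X s \<omega> + X r \<omega> * of_bool (q = s))"
    by (rule ibp_X[OF i1 assms(3)])
  have "expectation (\<lambda>\<omega>. X p \<omega> * (X q \<omega> * (X r \<omega> * X s \<omega>))) =
    C p q * C r s + (\<Sum>k\<in>P. C p k * expectation (\<lambda>\<omega>. X q \<omega> * (of_bool (k = r) * X s \<omega> + X r \<omega> * of_bool (k = s))))"
    unfolding ibp_X_D[OF i2 assms(1,2)] C_def[of r s] ..
  also have "(\<Sum>k\<in>P. C p k * expectation (\<lambda>\<omega>. X q \<omega> * (of_bool (k = r) * X s \<omega> + X r \<omega> * of_bool (k = s)))) =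
    (\<Sum>k\<in>P. (if k = r then C p k * C q s else 0) + (if k = s then C p k * C q r else 0))"
  proof (rule sum.cong[OF refl])
    fix k assume "k \<in> P"
    have "expectation (\<lambda>\<omega>. X q \<omega> * (of_bool (k = r) * X s \<omega> + X r \<omega> * of_bool (k = s))) =
      expectation (\<lambda>\<omega>. of_bool (k = r) * (X q \<omega> * X s \<omega>) + of_bool (k = s) * (X q \<omega> * X r \<omega>))"
      by (simp add: algebra_simps)
    also have "\<dots> = expectation (\<lambda>\<omega>. of_bool (k = r) * (X q \<omega> * X s \<omega>)) + expectation (\<lambda>\<omega>. of_bool (k = s) * (X q \<omega> * X r \<omega>))"
      by (intro Bochner_Integration.integral_add all_moments_integrable all_moments_intros all_moments_X assms)
    finally show "C p k * expectation (\<lambda>\<omega>. X q \<omega> * (of_bool (k = r) * X s \<omega> + X r \<omega> * of_bool (k = s))) =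
      (if k = r then C p k * C q s else 0) + (if k = s then C p k * C q r else 0)"
      by (auto simp: C_def distrib_left)
  qed
  also have "\<dots> = C p r * C q s + C p s * C q r"
    using assms finite_P by (simp add: sum.distrib)
  finally show ?thesis by (simp add: mult.assoc)
qed

end

section \<open>Quadratic forms of Gaussian vectors\<close>

text \<open>Log-convexity makes the successive ratios nondecreasing. One ratio q > r would force
  growth at least like q^k from there on, which beats K r^k however large the constant K is.\<close>

lemma log_convex_geometric_bound:
  fixes x :: "nat \<Rightarrow> real"
  assumes nn: "\<And>i. x i \<ge> 0" and conv: "\<And>i. (x (Suc i))\<^sup>2 \<le> x i * x (Suc (Suc i))"
    and bound: "\<And>i. x i \<le> K * r ^ i" and r: "r > 0"
  shows "x (Suc i) \<le> r * x i"
proof (rule ccontr)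
  assume neg: "\<not> x (Suc i) \<le> r * x i"
  have pos: "x i > 0"
  proof (rule ccontr)
    assume "\<not> x i > 0"
    then have "x i = 0" using nn[of i] by linarith
    with conv[of i] have "x (Suc i) = 0" by simp
    with neg \<open>x i = 0\<close> show False by simp
  qed
  define q where "q = x (Suc i) / x i"
  have q: "q > r" using neg pos by (simp add: q_def field_simps)
  have q0: "q > 0" using q r by simp
  have step: "x (i + k) > 0 \<and> x (Suc (i + k)) \<ge> q * x (i + k)" for k
  proof (induction k)
    case 0
    then show ?case using pos by (simp add: q_def)
  next
    case (Suc k)
    have p: "x (i + k) > 0" and le: "x (Suc (i + k)) \<ge> q * x (i + k)" using Suc.IH by auto
    have p1: "x (Suc (i + k)) > 0"
      using le p q0 by (meson less_le_trans mult_pos_pos)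
    have "q * x (i + k) * x (Suc (i + k)) \<le> x (Suc (i + k)) * x (Suc (i + k))"
      using le p1 by (intro mult_right_mono) auto
    also have "\<dots> \<le> x (i + k) * x (Suc (Suc (i + k)))"
      using conv[of "i + k"] by (simp add: power2_eq_square)
    finally have "x (i + k) * (q * x (Suc (i + k))) \<le> x (i + k) * x (Suc (Suc (i + k)))" by (simp add: mult_ac)
    then have "q * x (Suc (i + k)) \<le> x (Suc (Suc (i + k)))"
      using p by (simp add: mult_le_cancel_left_pos)
    then show ?case using p1 by simp
  qed
  have low: "x (i + k) \<ge> q ^ k * x i" for k
  proof (induction k)
    case (Suc k)
    have "q ^ Suc k * x i \<le> q * x (i + k)" using Suc.IH q0 by (simp add: mult.assoc)
    also have "\<dots> \<le> x (i + Suc k)" using step[of k] by simp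
    finally show ?case .
  qed simp
  have "(q / r) ^ k \<le> K * r ^ i / x i" for k
  proof -
    have "q ^ k * x i \<le> K * r ^ (i + k)" using low[of k] bound[of "i + k"] by linarith
    then show ?thesis using pos r by (simp add: field_simps power_add power_divide)
  qed
  moreover have "\<exists>k. K * r ^ i / x i < (q / r) ^ k"
    using q r by (intro real_arch_pow) simp
  ultimately show False using not_less by blast
qed

section \<open>Traces of the powers of A C and their decay\<close>

locale gaussian_quadratic = gaussian_vector M P X for M :: "'a measure" and P :: "'i set" and X +
  fixes A :: "'i \<Rightarrow> 'i \<Rightarrow> real"
  assumes A_commute: "A p q = A q p"
begin

text \<open>Matrices are plain functions. Only the summation is restricted to \<open>P\<close>, so
  associativity holds as an equality of functions and can be used for rewriting.\<close>

definition mm :: "('i \<Rightarrow> 'i \<Rightarrow> real) \<Rightarrow> ('i \<Rightarrow> 'i \<Rightarrow> real) \<Rightarrow> 'i \<Rightarrow> 'i \<Rightarrow> real" where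
  "mm F G p q = (\<Sum>r\<in>P. F p r * G r q)"

definition tr :: "('i \<Rightarrow> 'i \<Rightarrow> real) \<Rightarrow> real" where
  "tr F = (\<Sum>p\<in>P. F p p)"

lemma mm_assoc: "mm (mm F G) K = mm F (mm G K)"
  by (auto simp: mm_def fun_eq_iff sum_distrib_left sum_distrib_right mult.assoc intro: sum.swap)

lemma tr_mm_commute: "tr (mm F G) = tr (mm G F)"
  unfolding tr_def mm_def by (subst sum.swap) (simp add: mult.commute)

text \<open>Indices are shifted: \<open>pow j\<close> is \<open>A (C A)\<^sup>j\<close> and \<open>T j\<close> is the trace of the \<open>(j + 1)\<close>-st power of \<open>A C\<close>.\<close>

primrec pow :: "nat \<Rightarrow> 'i \<Rightarrow> 'i \<Rightarrow> real" where
  "pow 0 = A"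
| "pow (Suc j) = mm (mm (pow j) C) A"

definition T :: "nat \<Rightarrow> real" where
  "T j = tr (mm (pow j) C)"

lemma pow_rotate: "mm (mm (pow j) C) A = mm (mm A C) (pow j)"
  by (induction j) (simp_all add: mm_assoc)

lemma mm_transpose: "mm F G p q = mm (\<lambda>p q. G q p) (\<lambda>p q. F q p) q p"
  by (simp add: mm_def mult.commute)

lemma pow_commute: "pow j p q = pow j q p"
proof (induction j arbitrary: p q)
  case (Suc j)
  have t: "(\<lambda>p q. pow j q p) = pow j" "(\<lambda>p q. C q p) = C" "(\<lambda>p q. A q p) = A"
    using Suc.IH C_commute A_commute by (auto simp: fun_eq_iff)
  have "(\<lambda>p q. mm (pow j) C q p) = mm C (pow j)"
    by (subst mm_transpose) (simp add: t)
  then have "mm (mm (pow j) C) A p q = mm A (mm C (pow j)) q p"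
    by (subst mm_transpose) (simp add: t)
  also have "\<dots> = mm (mm (pow j) C) A q p"
    unfolding pow_rotate by (simp add: mm_assoc)
  finally show ?case by simp
qed (simp add: A_commute)

lemma pow_mult: "mm (mm (pow i) C) (pow j) = pow (Suc (i + j))"
proof (induction j)
  case (Suc j)
  have "mm (mm (pow i) C) (pow (Suc j)) = mm (mm (mm (mm (pow i) C) (pow j)) C) A"
    by (simp add: mm_assoc)
  also have "\<dots> = pow (Suc (i + Suc j))" unfolding Suc.IH by simp
  finally show ?case .
qed simp

text \<open>The Frobenius inner product of S F S and S G S, where S is the square root of C, written
  without S.\<close>

definition ip :: "('i \<Rightarrow> 'i \<Rightarrow> real) \<Rightarrow> ('i \<Rightarrow> 'i \<Rightarrow> real) \<Rightarrow> real" where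
  "ip F G = tr (mm (mm F C) (mm G C))"

lemma T_eq_ip: "T (Suc (i + j)) = ip (pow i) (pow j)"
  unfolding T_def ip_def pow_mult[symmetric] by (simp add: mm_assoc)

lemma ip_commute: "ip F G = ip G F"
  unfolding ip_def by (rule tr_mm_commute)

lemma ip_add: "ip (\<lambda>p q. F p q + x * G p q) K = ip F K + x * ip G K"
  by (simp add: ip_def mm_def tr_def sum.distrib distrib_right sum_distrib_left sum_distrib_right mult.assoc)

lemma C_psd: "(\<Sum>p\<in>P. \<Sum>q\<in>P. C p q * (y p * y q)) \<ge> 0"
proof -
  have "expectation (\<lambda>\<omega>. (L y \<omega>)\<^sup>2) = expectation (\<lambda>\<omega>. \<Sum>p\<in>P. \<Sum>q\<in>P. (y p * y q) * (X p \<omega> * X q \<omega>))"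
    by (simp add: L_def power2_eq_square sum_product mult_ac)
  also have "\<dots> = (\<Sum>p\<in>P. \<Sum>q\<in>P. (y p * y q) * expectation (\<lambda>\<omega>. X p \<omega> * X q \<omega>))"
    by (intro expectation_double_sum all_moments_intros all_moments_X)
  also have "\<dots> = (\<Sum>p\<in>P. \<Sum>q\<in>P. C p q * (y p * y q))" by (simp add: C_def mult.commute)
  finally have "expectation (\<lambda>\<omega>. (L y \<omega>)\<^sup>2) = (\<Sum>p\<in>P. \<Sum>q\<in>P. C p q * (y p * y q))" .
  moreover have "0 \<le> expectation (\<lambda>\<omega>. (L y \<omega>)\<^sup>2)" by simp
  ultimately show ?thesis by simp
qed

text \<open>For symmetric F this is the trace of C times F C F. The second factor is the covariance
  matrix of the vector F X, so the trace is the expectation of the nonnegative quadratic form of C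
  evaluated at F X.\<close>

lemma ip_self_nonneg:
  assumes F: "\<And>p q. F p q = F q p"
  shows "ip F F \<ge> 0"
proof -
  define Y where "Y \<omega> p = (\<Sum>q\<in>P. F p q * X q \<omega>)" for \<omega> p
  have "ip F F = (\<Sum>p\<in>P. \<Sum>s\<in>P. C p s * (\<Sum>q\<in>P. \<Sum>r\<in>P. F p q * F s r * C q r))"
  proof -
    have "ip F F = (\<Sum>p\<in>P. \<Sum>r\<in>P. (\<Sum>q\<in>P. F p q * C q r) * (\<Sum>s\<in>P. F r s * C s p))"
      by (simp add: ip_def tr_def mm_def)
    also have "\<dots> = (\<Sum>p\<in>P. \<Sum>r\<in>P. \<Sum>q\<in>P. \<Sum>s\<in>P. C p s * (F p q * F s r * C q r))"
    proof -
      have t: "F p q * C q r * (F r s * C s p) = C p s * (F p q * F s r * C q r)" for p q r s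
        using F[of r s] C_commute[of s p] by simp
      show ?thesis by (simp only: sum_product t)
    qed
    also have "\<dots> = (\<Sum>p\<in>P. \<Sum>s\<in>P. \<Sum>q\<in>P. \<Sum>r\<in>P. C p s * (F p q * F s r * C q r))"
    proof (rule sum.cong[OF refl])
      fix p
      have "(\<Sum>r\<in>P. \<Sum>q\<in>P. \<Sum>s\<in>P. C p s * (F p q * F s r * C q r)) = (\<Sum>r\<in>P. \<Sum>s\<in>P. \<Sum>q\<in>P. C p s * (F p q * F s r * C q r))"
        by (intro sum.cong refl sum.swap)
      also have "\<dots> = (\<Sum>s\<in>P. \<Sum>r\<in>P. \<Sum>q\<in>P. C p s * (F p q * F s r * C q r))" by (rule sum.swap)
      also have "\<dots> = (\<Sum>s\<in>P. \<Sum>q\<in>P. \<Sum>r\<in>P. C p s * (F p q * F s r * C q r))"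
        by (intro sum.cong refl sum.swap)
      finally show "(\<Sum>r\<in>P. \<Sum>q\<in>P. \<Sum>s\<in>P. C p s * (F p q * F s r * C q r)) = (\<Sum>s\<in>P. \<Sum>q\<in>P. \<Sum>r\<in>P. C p s * (F p q * F s r * C q r))" .
    qed
    finally show ?thesis by (simp add: sum_distrib_left)
  qed
  also have "\<dots> = (\<Sum>p\<in>P. \<Sum>s\<in>P. C p s * expectation (\<lambda>\<omega>. Y \<omega> p * Y \<omega> s))"
  proof (intro sum.cong refl arg_cong2[where f="(*)"])
    fix p s assume "p \<in> P" "s \<in> P"
    have "expectation (\<lambda>\<omega>. Y \<omega> p * Y \<omega> s) = expectation (\<lambda>\<omega>. \<Sum>q\<in>P. \<Sum>r\<in>P. (F p q * F s r) * (X q \<omega> * X r \<omega>))"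
      by (simp add: Y_def sum_product mult_ac)
    also have "\<dots> = (\<Sum>q\<in>P. \<Sum>r\<in>P. (F p q * F s r) * expectation (\<lambda>\<omega>. X q \<omega> * X r \<omega>))"
      by (intro expectation_double_sum all_moments_intros all_moments_X)
    finally show "(\<Sum>q\<in>P. \<Sum>r\<in>P. F p q * F s r * C q r) = expectation (\<lambda>\<omega>. Y \<omega> p * Y \<omega> s)"
      by (simp add: C_def)
  qed
  also have "\<dots> = expectation (\<lambda>\<omega>. \<Sum>p\<in>P. \<Sum>s\<in>P. C p s * (Y \<omega> p * Y \<omega> s))"
    unfolding Y_def by (intro expectation_double_sum[symmetric] all_moments_intros all_moments_X)
  also have "\<dots> \<ge> 0" by (intro integral_nonneg_AE AE_I2 C_psd)
  finally show ?thesis .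
qed

lemma ip_cauchy_schwarz:
  assumes F: "\<And>p q. F p q = F q p" and G: "\<And>p q. G p q = G q p"
  shows "(ip F G)\<^sup>2 \<le> ip F F * ip G G"
proof -
  have "0 \<le> ip F F + 2 * x * ip F G + x\<^sup>2 * ip G G" for x
  proof -
    let ?K = "\<lambda>p q. F p q + x * G p q"
    have "ip ?K ?K = ip F ?K + x * ip G ?K" by (rule ip_add)
    also have "\<dots> = ip F F + 2 * x * ip F G + x\<^sup>2 * ip G G"
      unfolding ip_commute[of F ?K] ip_commute[of G ?K] ip_add ip_commute[of G F]
      by (simp add: algebra_simps power2_eq_square)
    finally show ?thesis using ip_self_nonneg[of ?K] F G by metis
  qed
  note q = this
  show ?thesis
  proof (cases "ip G G = 0")
    case True
    have "ip F G = 0"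
    proof (rule ccontr)
      assume n: "ip F G \<noteq> 0"
      \<comment> \<open>In the degenerate case the nonnegative polynomial in x is affine; at this x
        it would take the value -1.\<close>
      have "0 \<le> ip F F + 2 * (- (ip F F + 1) / (2 * ip F G)) * ip F G"
        using q[of "- (ip F F + 1) / (2 * ip F G)"] True by simp
      then show False using n by (simp add: field_simps)
    qed
    then show ?thesis using True by simp
  next
    case False
    then have pos: "ip G G > 0" using ip_self_nonneg[of G] G by (metis less_eq_real_def)
    have "0 \<le> ip F F + 2 * (- ip F G / ip G G) * ip F G + (- ip F G / ip G G)\<^sup>2 * ip G G" by (rule q)
    also have "\<dots> = ip F F - (ip F G)\<^sup>2 / ip G G"
      using False by (simp add: field_simps power2_eq_square)
    finally show ?thesis using pos by (simp add: field_simps)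
  qed
qed

text \<open>The trace of the power i + j + 2 of A C is the inner product of \<open>pow i\<close> and
  \<open>pow j\<close>, so this is the Cauchy-Schwarz inequality.\<close>

lemma T_log_convex: "(T (Suc (i + j)))\<^sup>2 \<le> T (Suc (i + i)) * T (Suc (j + j))"
  unfolding T_eq_ip by (intro ip_cauchy_schwarz pow_commute)

lemma T_odd_nonneg: "T (Suc (i + i)) \<ge> 0"
  unfolding T_eq_ip by (intro ip_self_nonneg pow_commute)

text \<open>The row sums weighted by \<open>w\<close> control an operator norm, that of the weighted
  supremum norm. Hence r^(j + 1) bounds the corresponding power of A C and with it each diagonal
  entry.\<close>

lemma T_weight_bound:
  assumes w: "\<And>p. p \<in> P \<Longrightarrow> w p > 0" and r: "r \<ge> 0"
    and row: "\<And>p. p \<in> P \<Longrightarrow> (\<Sum>q\<in>P. \<bar>mm A C p q\<bar> * w q) \<le> r * w p"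
  shows "\<bar>T j\<bar> \<le> real (card P) * r ^ Suc j"
proof -
  have rows: "(\<Sum>q\<in>P. \<bar>mm (pow j) C p q\<bar> * w q) \<le> r ^ Suc j * w p" if p: "p \<in> P" for p
    using p
  proof (induction j arbitrary: p)
    case 0
    then show ?case using row by simp
  next
    case (Suc j)
    have eq: "mm (pow (Suc j)) C = mm (mm (pow j) C) (mm A C)" by (simp add: mm_assoc)
    have "(\<Sum>q\<in>P. \<bar>mm (pow (Suc j)) C p q\<bar> * w q) \<le> (\<Sum>q\<in>P. (\<Sum>s\<in>P. \<bar>mm (pow j) C p s\<bar> * \<bar>mm A C s q\<bar>) * w q)"
    proof (intro sum_mono mult_right_mono)
      fix q assume "q \<in> P"
      then show "0 \<le> w q" using w by (simp add: less_imp_le)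
      show "\<bar>mm (pow (Suc j)) C p q\<bar> \<le> (\<Sum>s\<in>P. \<bar>mm (pow j) C p s\<bar> * \<bar>mm A C s q\<bar>)"
        unfolding eq mm_def[of "mm (pow j) C"] abs_mult[symmetric] by (rule sum_abs)
    qed
    also have "\<dots> = (\<Sum>s\<in>P. \<bar>mm (pow j) C p s\<bar> * (\<Sum>q\<in>P. \<bar>mm A C s q\<bar> * w q))"
      by (simp add: sum_distrib_left sum_distrib_right mult.assoc) (rule sum.swap)
    also have "\<dots> \<le> (\<Sum>s\<in>P. \<bar>mm (pow j) C p s\<bar> * (r * w s))"
      by (intro sum_mono mult_left_mono row) auto
    also have "\<dots> = r * (\<Sum>s\<in>P. \<bar>mm (pow j) C p s\<bar> * w s)"
      by (simp add: sum_distrib_left mult_ac)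
    also have "\<dots> \<le> r * (r ^ Suc j * w p)" using Suc r by (intro mult_left_mono) auto
    finally show ?case by (simp add: mult_ac)
  qed
  have "\<bar>mm (pow j) C p p\<bar> \<le> r ^ Suc j" if p: "p \<in> P" for p
  proof -
    have "\<bar>mm (pow j) C p p\<bar> * w p \<le> (\<Sum>q\<in>P. \<bar>mm (pow j) C p q\<bar> * w q)"
      using p w finite_P by (intro member_le_sum) (auto simp: less_imp_le)
    also note rows[OF p]
    finally show ?thesis using w[OF p] by simp
  qed
  then have "(\<Sum>p\<in>P. \<bar>mm (pow j) C p p\<bar>) \<le> (\<Sum>p\<in>P. r ^ Suc j)" by (intro sum_mono)
  moreover have "\<bar>T j\<bar> \<le> (\<Sum>p\<in>P. \<bar>mm (pow j) C p p\<bar>)" unfolding T_def tr_def by (rule sum_abs)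
  ultimately show ?thesis by simp
qed

text \<open>Row sums bound the traces only up to the factor \<open>card P\<close>; log-convexity of the even-order traces
  turns the resulting exponential growth rate into a bound on consecutive ratios and so removes the factor.\<close>

lemma T_decay:
  assumes w: "\<And>p. p \<in> P \<Longrightarrow> w p > 0" and r: "r > 0"
    and row: "\<And>p. p \<in> P \<Longrightarrow> (\<Sum>q\<in>P. \<bar>mm A C p q\<bar> * w q) \<le> r * w p"
  shows "\<bar>T (Suc j)\<bar> \<le> r ^ j * T 1"
proof -
  \<comment> \<open>\<open>x i\<close> is the trace of the power 2 i + 2, an even one; a step in i
    advances the power by two and should cost r^2.\<close>
  define x where "x i = T (Suc (i + i))" for i
  have x0: "x i \<ge> 0" for i unfolding x_def by (rule T_odd_nonneg)
  have "(x (Suc i))\<^sup>2 \<le> x i * x (Suc (Suc i))" for i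
    using T_log_convex[of i "Suc (Suc i)"] by (simp add: x_def)
  moreover have "x i \<le> real (card P) * r\<^sup>2 * (r\<^sup>2) ^ i" for i
  proof -
    have "x i \<le> real (card P) * r ^ Suc (Suc (i + i))"
      using T_weight_bound[of w r "Suc (i + i)", OF w _ row] r unfolding x_def by auto
    also have "r ^ Suc (Suc (i + i)) = r\<^sup>2 * (r\<^sup>2) ^ i"
      by (simp add: power_mult[symmetric] mult_2 power_add power2_eq_square mult_ac power_mult_distrib)
    finally show ?thesis by (simp add: mult.assoc)
  qed
  ultimately have step: "x (Suc i) \<le> r\<^sup>2 * x i" for i
    using r by (intro log_convex_geometric_bound[of x "real (card P) * r\<^sup>2"] x0) auto
  have x_le: "x i \<le> r ^ (2 * i) * x 0" for i
  proof (induction i)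
    case (Suc i)
    have "x (Suc i) \<le> r\<^sup>2 * x i" by (rule step)
    also have "\<dots> \<le> r\<^sup>2 * (r ^ (2 * i) * x 0)" using Suc by (intro mult_left_mono) auto
    finally show ?case by (simp add: power2_eq_square mult_ac)
  qed simp
  have T1: "T 1 = x 0" by (simp add: x_def)
  show ?thesis
  proof (cases "even j")
    case True
    then obtain i where "j = 2 * i" by (elim evenE)
    then show ?thesis using x_le[of i] x0[of i] T1 by (simp add: x_def mult_2)
  next
    case False
    then obtain i where i: "j = 2 * i + 1" by (elim oddE)
    \<comment> \<open>Traces of odd powers may be negative; their absolute value is at most the
      geometric mean of the two neighbouring even ones.\<close>
    have "(T (Suc j))\<^sup>2 \<le> x i * x (Suc i)"
      using T_log_convex[of i "Suc i"] by (simp add: x_def i mult_2)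
    also have "\<dots> \<le> (r ^ (2 * i) * x 0) * (r ^ (2 * Suc i) * x 0)"
      using x_le[of i] x_le[of "Suc i"] x0 by (intro mult_mono) (auto intro: mult_nonneg_nonneg simp: r less_imp_le)
    also have "\<dots> = (r ^ j * T 1)\<^sup>2"
    proof -
      have "r ^ (2 * i) * r ^ (2 * Suc i) = (r ^ j)\<^sup>2"
        by (simp add: i power_mult[symmetric] power_add[symmetric] del: power_Suc)
      then show ?thesis unfolding T1 by (simp add: power2_eq_square mult_ac)
    qed
    finally have "(T (Suc j))\<^sup>2 \<le> (r ^ j * T 1)\<^sup>2" .
    then show ?thesis
      using x0[of 0] r T1 by (metis abs_le_square_iff abs_of_nonneg mult_nonneg_nonneg zero_le_power less_imp_le)
  qed
qed

section \<open>Moment recursions for the quadratic form, centred by its mean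
  \<open>T 0\<close>\<close>

definition Q :: "'a \<Rightarrow> real" where
  "Q \<omega> = (\<Sum>p\<in>P. \<Sum>q\<in>P. A p q * (X p \<omega> * X q \<omega>)) - T 0"

text \<open>Half the gradient of \<open>Q\<close>, since A is symmetric.\<close>

definition AX :: "'i \<Rightarrow> 'a \<Rightarrow> real" where
  "AX q \<omega> = (\<Sum>r\<in>P. A q r * X r \<omega>)"

lemma all_moments_Q: "all_moments M Q"
  unfolding Q_def by (intro all_moments_intros all_moments_X)

text \<open>By linearity and two uses of \<open>ibp_X\<close>. Differentiating the first and the
  second factor of the double sum gives the same vector by symmetry of A, whence the factor
  2.\<close>

lemma ibp_Q:
  assumes F: "ibp F D"
  shows "ibp (\<lambda>\<omega>. Q \<omega> * F \<omega>) (\<lambda>q \<omega>. Q \<omega> * D q \<omega> + 2 * AX q \<omega> * F \<omega>)"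
proof -
  let ?D = "\<lambda>p r q \<omega>. of_bool (q = p) * (X r \<omega> * F \<omega>) + X p \<omega> * (of_bool (q = r) * F \<omega> + X r \<omega> * D q \<omega>)"
  have "ibp (\<lambda>\<omega>. X p \<omega> * (X r \<omega> * F \<omega>)) (?D p r)" if "p \<in> P" "r \<in> P" for p r
    by (rule ibp_X[OF ibp_X[OF F that(2)] that(1)])
  then have "ibp (\<lambda>\<omega>. \<Sum>k\<in>P\<times>P. A (fst k) (snd k) * (X (fst k) \<omega> * (X (snd k) \<omega> * F \<omega>)))
    (\<lambda>q \<omega>. \<Sum>k\<in>P\<times>P. A (fst k) (snd k) * ?D (fst k) (snd k) q \<omega>)"
    using finite_P by (intro ibp_lin) auto
  from ibp_add[OF this F, of 1 "- T 0"] show ?thesis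
  proof (rule ibp_cong)
    fix \<omega>
    have *: "(\<Sum>k\<in>P\<times>P. A (fst k) (snd k) * (X (fst k) \<omega> * (X (snd k) \<omega> * Z))) = (\<Sum>p\<in>P. \<Sum>q\<in>P. A p q * (X p \<omega> * X q \<omega>)) * Z" for Z
      by (simp add: sum.cartesian_product split_def sum_distrib_right mult.assoc)
    show "1 * (\<Sum>k\<in>P\<times>P. A (fst k) (snd k) * (X (fst k) \<omega> * (X (snd k) \<omega> * F \<omega>))) + - T 0 * F \<omega> = Q \<omega> * F \<omega>"
      unfolding * by (simp add: Q_def algebra_simps)
    fix q assume q: "q \<in> P"
    have "(\<Sum>k\<in>P\<times>P. A (fst k) (snd k) * ?D (fst k) (snd k) q \<omega>) =
      (\<Sum>p\<in>P. \<Sum>r\<in>P. of_bool (q = p) * (A p r * (X r \<omega> * F \<omega>))) +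
      (\<Sum>p\<in>P. \<Sum>r\<in>P. of_bool (q = r) * (A p r * (X p \<omega> * F \<omega>))) +
      (\<Sum>k\<in>P\<times>P. A (fst k) (snd k) * (X (fst k) \<omega> * (X (snd k) \<omega> * D q \<omega>)))"
      by (simp add: sum.cartesian_product split_def distrib_left sum.distrib mult_ac)
    also have "(\<Sum>p\<in>P. \<Sum>r\<in>P. of_bool (q = p) * (A p r * (X r \<omega> * F \<omega>))) = AX q \<omega> * F \<omega>"
    proof -
      have "(\<Sum>p\<in>P. \<Sum>r\<in>P. of_bool (q = p) * (A p r * (X r \<omega> * F \<omega>))) = (\<Sum>p\<in>P. if q = p then AX p \<omega> * F \<omega> else 0)"
        by (intro sum.cong) (auto simp: AX_def sum_distrib_left mult_ac)
      then show ?thesis using q finite_P by simp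
    qed
    also have "(\<Sum>p\<in>P. \<Sum>r\<in>P. of_bool (q = r) * (A p r * (X p \<omega> * F \<omega>))) = AX q \<omega> * F \<omega>"
    proof -
      have "(\<Sum>p\<in>P. \<Sum>r\<in>P. of_bool (q = r) * (A p r * (X p \<omega> * F \<omega>))) = (\<Sum>r\<in>P. if q = r then AX r \<omega> * F \<omega> else 0)"
        by (subst sum.swap, intro sum.cong) (auto simp: AX_def sum_distrib_left A_commute mult_ac)
      then show ?thesis using q finite_P by simp
    qed
    finally show "1 * (\<Sum>k\<in>P\<times>P. A (fst k) (snd k) * ?D (fst k) (snd k) q \<omega>) + - T 0 * D q \<omega> = Q \<omega> * D q \<omega> + 2 * AX q \<omega> * F \<omega>"
      unfolding * by (simp add: Q_def algebra_simps)
  qed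
qed

lemma ibp_Q_power: "ibp (\<lambda>\<omega>. Q \<omega> ^ k) (\<lambda>q \<omega>. (2 * real k) * (AX q \<omega> * Q \<omega> ^ (k - 1)))"
proof (induction k)
  case 0
  show ?case using ibp_one by (rule ibp_cong) auto
next
  case (Suc k)
  show ?case
  proof (rule ibp_cong[OF ibp_Q[OF Suc]])
    show "Q \<omega> * (2 * real k * (AX q \<omega> * Q \<omega> ^ (k - 1))) + 2 * AX q \<omega> * Q \<omega> ^ k = 2 * real (Suc k) * (AX q \<omega> * Q \<omega> ^ (Suc k - 1))" for q \<omega>
      by (cases k) (simp_all add: algebra_simps)
  qed simp
qed

definition m :: "nat \<Rightarrow> real" where
  "m k = expectation (\<lambda>\<omega>. Q \<omega> ^ k)"

text \<open>Moments of \<open>Q\<close> do not satisfy a closed recursion by themselves; together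
  with these mixed moments, which insert the quadratic form of A (C A)^j, they do.\<close>

definition u :: "nat \<Rightarrow> nat \<Rightarrow> real" where
  "u j k = expectation (\<lambda>\<omega>. (\<Sum>p\<in>P. \<Sum>q\<in>P. pow j p q * (X p \<omega> * X q \<omega>)) * Q \<omega> ^ k)"

lemma u_expand: "u j k = (\<Sum>p\<in>P. \<Sum>q\<in>P. pow j p q * expectation (\<lambda>\<omega>. X p \<omega> * (X q \<omega> * Q \<omega> ^ k)))"
proof -
  have "u j k = expectation (\<lambda>\<omega>. \<Sum>p\<in>P. \<Sum>q\<in>P. pow j p q * (X p \<omega> * (X q \<omega> * Q \<omega> ^ k)))"
    unfolding u_def by (simp add: sum_distrib_right mult.assoc)
  also have "\<dots> = (\<Sum>p\<in>P. \<Sum>q\<in>P. pow j p q * expectation (\<lambda>\<omega>. X p \<omega> * (X q \<omega> * Q \<omega> ^ k)))"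
    by (intro expectation_double_sum all_moments_intros all_moments_X all_moments_Q)
  finally show ?thesis .
qed

text \<open>Integration by parts is applied to \<open>X p\<close> against
  \<open>X q * Q ^ k\<close>. Differentiating \<open>X q\<close> contracts \<open>pow j\<close> with
  C to the trace \<open>T j\<close>; differentiating \<open>Q ^ k\<close> lowers k and attaches C A
  to \<open>pow j\<close>, which gives the form of index j + 1.\<close>

lemma u_rec: "u j k = T j * m k + 2 * real k * u (Suc j) (k - 1)"
proof -
  define e where "e q s = expectation (\<lambda>\<omega>. X q \<omega> * (X s \<omega> * Q \<omega> ^ (k - 1)))" for q s
  have 1: "expectation (\<lambda>\<omega>. X p \<omega> * (X q \<omega> * Q \<omega> ^ k)) = C p q * m k + 2 * real k * (\<Sum>r\<in>P. \<Sum>s\<in>P. C p r * (A r s * e q s))"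
    if "p \<in> P" "q \<in> P" for p q
  proof -
    have "expectation (\<lambda>\<omega>. X p \<omega> * (X q \<omega> * Q \<omega> ^ k)) = C p q * m k +
      (\<Sum>r\<in>P. C p r * expectation (\<lambda>\<omega>. X q \<omega> * ((2 * real k) * (AX r \<omega> * Q \<omega> ^ (k - 1)))))"
      unfolding m_def by (rule ibp_X_D[OF ibp_Q_power that])
    also have "(\<Sum>r\<in>P. C p r * expectation (\<lambda>\<omega>. X q \<omega> * ((2 * real k) * (AX r \<omega> * Q \<omega> ^ (k - 1))))) =
      (\<Sum>r\<in>P. C p r * (2 * real k * (\<Sum>s\<in>P. A r s * e q s)))"
    proof (intro sum.cong refl arg_cong2[where f="(*)"])
      fix r assume r: "r \<in> P"
      have "expectation (\<lambda>\<omega>. X q \<omega> * ((2 * real k) * (AX r \<omega> * Q \<omega> ^ (k - 1)))) =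
        expectation (\<lambda>\<omega>. \<Sum>s\<in>P. (2 * real k * A r s) * (X q \<omega> * (X s \<omega> * Q \<omega> ^ (k - 1))))"
        unfolding AX_def by (simp only: sum_distrib_left sum_distrib_right mult_ac)
      also have "\<dots> = (\<Sum>s\<in>P. expectation (\<lambda>\<omega>. (2 * real k * A r s) * (X q \<omega> * (X s \<omega> * Q \<omega> ^ (k - 1)))))"
        by (intro Bochner_Integration.integral_sum all_moments_integrable all_moments_intros all_moments_X all_moments_Q that)
      finally show "expectation (\<lambda>\<omega>. X q \<omega> * ((2 * real k) * (AX r \<omega> * Q \<omega> ^ (k - 1)))) = 2 * real k * (\<Sum>s\<in>P. A r s * e q s)"
        unfolding e_def by (simp only: sum_distrib_left mult.assoc Bochner_Integration.integral_mult_right_zero)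
    qed
    finally show ?thesis by (simp only: sum_distrib_left mult_ac)
  qed
  have "u j k = (\<Sum>p\<in>P. \<Sum>q\<in>P. pow j p q * (C p q * m k + 2 * real k * (\<Sum>r\<in>P. \<Sum>s\<in>P. C p r * (A r s * e q s))))"
    unfolding u_expand by (intro sum.cong refl arg_cong2[where f="(*)"] 1)
  also have "\<dots> = (\<Sum>p\<in>P. \<Sum>q\<in>P. pow j p q * C q p) * m k +
     2 * real k * (\<Sum>p\<in>P. \<Sum>q\<in>P. \<Sum>r\<in>P. \<Sum>s\<in>P. pow j q p * C p r * A r s * e q s)"
  proof -
    \<comment> \<open>Symmetry of C and of \<open>pow j\<close> puts the indices in the order of a
      trace in the first term and of a matrix product in the second.\<close>
    have "pow j p q * (C p q * m k + 2 * real k * z) = pow j p q * C q p * m k + 2 * real k * (pow j q p * z)" for p q z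
      using C_commute[of p q] pow_commute[of j p q] by (simp add: algebra_simps)
    then show ?thesis
      by (simp only: sum.distrib sum_distrib_right[symmetric]) (simp add: sum_distrib_left mult.assoc)
  qed
  also have "(\<Sum>p\<in>P. \<Sum>q\<in>P. pow j p q * C q p) = T j"
    by (simp add: T_def tr_def mm_def)
  also have "(\<Sum>p\<in>P. \<Sum>q\<in>P. \<Sum>r\<in>P. \<Sum>s\<in>P. pow j q p * C p r * A r s * e q s) = (\<Sum>q\<in>P. \<Sum>s\<in>P. pow (Suc j) q s * e q s)"
  proof -
    have "(\<Sum>q\<in>P. \<Sum>s\<in>P. pow (Suc j) q s * e q s) = (\<Sum>q\<in>P. \<Sum>s\<in>P. \<Sum>r\<in>P. \<Sum>p\<in>P. pow j q p * C p r * A r s * e q s)"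
      by (simp add: mm_def sum_distrib_right)
    also have "\<dots> = (\<Sum>q\<in>P. \<Sum>p\<in>P. \<Sum>r\<in>P. \<Sum>s\<in>P. pow j q p * C p r * A r s * e q s)"
    proof (rule sum.cong[OF refl])
      fix q
      have "(\<Sum>s\<in>P. \<Sum>r\<in>P. \<Sum>p\<in>P. pow j q p * C p r * A r s * e q s) = (\<Sum>s\<in>P. \<Sum>p\<in>P. \<Sum>r\<in>P. pow j q p * C p r * A r s * e q s)"
        by (intro sum.cong refl sum.swap)
      also have "\<dots> = (\<Sum>p\<in>P. \<Sum>s\<in>P. \<Sum>r\<in>P. pow j q p * C p r * A r s * e q s)" by (rule sum.swap)
      also have "\<dots> = (\<Sum>p\<in>P. \<Sum>r\<in>P. \<Sum>s\<in>P. pow j q p * C p r * A r s * e q s)"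
        by (intro sum.cong refl sum.swap)
      finally show "(\<Sum>s\<in>P. \<Sum>r\<in>P. \<Sum>p\<in>P. pow j q p * C p r * A r s * e q s) = (\<Sum>p\<in>P. \<Sum>r\<in>P. \<Sum>s\<in>P. pow j q p * C p r * A r s * e q s)" .
    qed
    also have "\<dots> = (\<Sum>p\<in>P. \<Sum>q\<in>P. \<Sum>r\<in>P. \<Sum>s\<in>P. pow j q p * C p r * A r s * e q s)" by (rule sum.swap)
    finally show ?thesis by simp
  qed
  also have "(\<Sum>q\<in>P. \<Sum>s\<in>P. pow (Suc j) q s * e q s) = u (Suc j) (k - 1)"
    unfolding u_expand e_def ..
  finally show ?thesis .
qed

lemma m_0: "m 0 = 1"
  by (simp add: m_def prob_space)

text \<open>The centring constant cancels exactly the trace term of \<open>u_rec\<close> at j =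
  0.\<close>

lemma m_Suc: "m (Suc k) = 2 * real k * u 1 (k - 1)"
proof -
  have "m (Suc k) = expectation (\<lambda>\<omega>. (\<Sum>p\<in>P. \<Sum>q\<in>P. pow 0 p q * (X p \<omega> * X q \<omega>)) * Q \<omega> ^ k - T 0 * Q \<omega> ^ k)"
    unfolding m_def by (simp add: Q_def algebra_simps)
  also have "\<dots> = u 0 k - T 0 * m k"
    unfolding u_def m_def
    by (subst Bochner_Integration.integral_diff)
       (auto intro!: all_moments_integrable all_moments_intros all_moments_X all_moments_Q)
  finally show ?thesis unfolding u_rec[of 0 k] by simp
qed

lemma m_2: "m 2 = 2 * T 1"
  using m_Suc[of 1] u_rec[of 1 0] by (simp add: m_0 numeral_2_eq_2)

end

text \<open>Two steps of the recursions give m (k + 2) = (k + 1) (2 T 1) m k + 4 (k + 1) k u 2 (k -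
  1). The mixed moments with j \<ge> 2 vanish in the limit along with the higher traces, and what
  remains is the moment recursion of the normal law; both statements are proved in one
  induction.\<close>

lemma second_chaos_moments_tendsto:
  fixes m :: "nat \<Rightarrow> nat \<Rightarrow> real" and u :: "nat \<Rightarrow> nat \<Rightarrow> nat \<Rightarrow> real" and T :: "nat \<Rightarrow> nat \<Rightarrow> real"
  assumes m0: "\<And>n. m n 0 = 1" and mS: "\<And>n k. m n (Suc k) = 2 * real k * u n 1 (k - 1)"
    and u: "\<And>n j k. u n j k = T n j * m n k + 2 * real k * u n (Suc j) (k - 1)"
    and T1: "(\<lambda>n. 2 * T n 1) \<longlonglongrightarrow> v" and T2: "\<And>j. j \<ge> 2 \<Longrightarrow> (\<lambda>n. T n j) \<longlonglongrightarrow> 0"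
    and v: "v \<ge> 0"
  shows "(\<lambda>n. m n k) \<longlonglongrightarrow> (LINT x|normal_law 0 v. x ^ k)"
proof -
  have "(\<lambda>n. m n k) \<longlonglongrightarrow> (LINT x|normal_law 0 v. x ^ k) \<and> (\<forall>j\<ge>2. (\<lambda>n. u n j k) \<longlonglongrightarrow> 0)"
  proof (induction k rule: less_induct)
    case (less k)
    have M: "(\<lambda>n. m n k) \<longlonglongrightarrow> (LINT x|normal_law 0 v. x ^ k)"
    proof (cases "k \<le> 1")
      case True
      then consider "k = 0" | "k = 1" by linarith
      then show ?thesis
      proof cases
        case 1
        then show ?thesis using m0 prob_space.prob_space[OF real_distribution.axioms(1)[OF real_distribution_normal_law[OF v]]] by simp
      next
        case 2
        then show ?thesis using mS[of _ 0] normal_law_odd_moment[OF v, of 1] by simp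
      qed
    next
      case False
      then obtain i where i: "k = i + 2" by (metis add.commute le_Suc_ex not_less_eq_eq numeral_2_eq_2 One_nat_def)
      have "m n k = real (i + 1) * (2 * T n 1) * m n i + 4 * real (i + 1) * (real i * u n 2 (i - 1))" for n
        using mS[of n "Suc i"] u[of n 1 i] by (simp add: i algebra_simps numeral_2_eq_2)
      moreover have "(\<lambda>n. real (i + 1) * (2 * T n 1) * m n i + 4 * real (i + 1) * (real i * u n 2 (i - 1)))
        \<longlonglongrightarrow> real (i + 1) * v * (LINT x|normal_law 0 v. x ^ i) + 4 * real (i + 1) * 0"
      proof (intro tendsto_intros T1)
        show "(\<lambda>n. m n i) \<longlonglongrightarrow> (LINT x|normal_law 0 v. x ^ i)" using less.IH[of i] i by simp
        show "(\<lambda>n. real i * u n 2 (i - 1)) \<longlonglongrightarrow> 0"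
        proof (cases "i = 0")
          case False
          then have "(\<lambda>n. u n 2 (i - 1)) \<longlonglongrightarrow> 0" using less.IH[of "i - 1"] i by auto
          then show ?thesis by (auto intro: tendsto_mult_right_zero)
        qed simp
      qed
      ultimately show ?thesis using normal_law_moment_rec[OF v, of i] by (simp add: i)
    qed
    moreover have "(\<lambda>n. u n j k) \<longlonglongrightarrow> 0" if j: "j \<ge> 2" for j
    proof -
      have "(\<lambda>n. real k * u n (Suc j) (k - 1)) \<longlonglongrightarrow> 0"
      proof (cases "k = 0")
        case False
        then have "(\<lambda>n. u n (Suc j) (k - 1)) \<longlonglongrightarrow> 0" using less.IH[of "k - 1"] j by auto
        then show ?thesis by (auto intro: tendsto_mult_right_zero)
      qed simp
      then have "(\<lambda>n. T n j * m n k + 2 * (real k * u n (Suc j) (k - 1))) \<longlonglongrightarrow> 0 * (LINT x|normal_law 0 v. x ^ k) + 2 * 0"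
        by (intro tendsto_intros M T2 j)
      then show ?thesis unfolding u[of _ j k] by (simp add: mult.assoc)
    qed
    ultimately show ?case by auto
  qed
  then show ?thesis by simp
qed

text \<open>Moment determinacy is made explicit: both characteristic functions are expanded to
  degree 2 K, the polynomials converge with the moments, and the remainders are controlled by the
  moment of order 2 K. Levy's continuity theorem concludes.\<close>

lemma moments_imp_weak_conv_normal:
  fixes \<mu> :: "nat \<Rightarrow> real measure"
  assumes d: "\<And>n. real_distribution (\<mu> n)" and int: "\<And>n k. integrable (\<mu> n) (\<lambda>x. x ^ k)" and v: "v \<ge> 0"
    and mom: "\<And>k. (\<lambda>n. LINT x|\<mu> n. x ^ k) \<longlonglongrightarrow> (LINT x|normal_law 0 v. x ^ k)"
  shows "weak_conv_m \<mu> (normal_law 0 v)"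
proof (rule levy_continuity[OF d real_distribution_normal_law[OF v]])
  fix t :: real
  interpret N: real_distribution "normal_law 0 v" by (rule real_distribution_normal_law[OF v])
  define p where "p K f = (\<Sum>k\<le>2 * K. ((\<i> * t) ^ k / fact k) * complex_of_real (f k))" for K :: nat and f :: "nat \<Rightarrow> real"
  define N where "N k = (LINT x|normal_law 0 v. x ^ k)" for k
  \<comment> \<open>The remainder term of the normal law: dividing the even moment by (2 K)! leaves
    only 1 / K!, so it tends to 0.\<close>
  define e where "e K = (v * t\<^sup>2 / 2) ^ K / fact K" for K
  have N_even: "\<bar>t\<bar> ^ (2 * K) * N (2 * K) / fact (2 * K) = e K" for K
    unfolding N_def normal_law_even_moment[OF v] e_def
    by (simp add: power_mult power_divide power_mult_distrib)
  have pN: "cmod (char (normal_law 0 v) t - p K N) \<le> 2 * e K" for K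
    using N.char_approx1[of "2 * K" t] integrable_normal_law_power[OF v] N_even[of K]
    by (simp add: p_def N_def power_even_abs)
  \<comment> \<open>In even degree the absolute moment of the remainder is a plain moment. It
    converges as n grows, so for a fixed K this bound is eventually as small as the one for the
    normal law.\<close>
  have pm: "cmod (char (\<mu> n) t - p K (\<lambda>k. LINT x|\<mu> n. x ^ k)) \<le> 2 * (\<bar>t\<bar> ^ (2 * K) * (LINT x|\<mu> n. x ^ (2 * K)) / fact (2 * K))" for n K
    using real_distribution.char_approx1[OF d[of n], of "2 * K" t] int by (simp add: p_def power_even_abs)
  show "(\<lambda>n. char (\<mu> n) t) \<longlonglongrightarrow> char (normal_law 0 v) t"
  proof (rule LIMSEQ_I)
    fix \<epsilon> :: real assume \<epsilon>: "\<epsilon> > 0"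
    have "e \<longlonglongrightarrow> 0" 
      using summable_LIMSEQ_zero[OF summable_exp[of "v * t\<^sup>2 / 2"]]
      unfolding e_def[abs_def] by (simp only: divide_inverse mult.commute)
    then have "eventually (\<lambda>K. e K < \<epsilon> / 8) sequentially" using \<epsilon> by (intro order_tendstoD(2)[where y=0]) auto
    then obtain K where K: "e K < \<epsilon> / 8" by (auto simp: eventually_sequentially)
    have "(\<lambda>n. p K (\<lambda>k. LINT x|\<mu> n. x ^ k)) \<longlonglongrightarrow> p K N"
      unfolding p_def N_def by (intro tendsto_intros mom)
    then have 1: "eventually (\<lambda>n. dist (p K (\<lambda>k. LINT x|\<mu> n. x ^ k)) (p K N) < \<epsilon> / 4) sequentially"
      using \<epsilon> by (intro tendstoD) auto
    have "(\<lambda>n. \<bar>t\<bar> ^ (2 * K) * (LINT x|\<mu> n. x ^ (2 * K)) / fact (2 * K)) \<longlonglongrightarrow> \<bar>t\<bar> ^ (2 * K) * N (2 * K) / fact (2 * K)"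
      unfolding N_def by (intro tendsto_intros mom) auto
    then have 2: "eventually (\<lambda>n. \<bar>t\<bar> ^ (2 * K) * (LINT x|\<mu> n. x ^ (2 * K)) / fact (2 * K) < \<epsilon> / 8) sequentially"
      unfolding N_even using K by (rule order_tendstoD(2))
    have "eventually (\<lambda>n. norm (char (\<mu> n) t - char (normal_law 0 v) t) < \<epsilon>) sequentially"
      using 1 2
    proof eventually_elim
      case (elim n)
      let ?a = "char (\<mu> n) t" and ?b = "p K (\<lambda>k. LINT x|\<mu> n. x ^ k)" and ?c = "p K N" and ?d = "char (normal_law 0 v) t"
      have "?a - ?d = (?a - ?b) + (?b - ?c) - (?d - ?c)" by simp
      then have "norm (?a - ?d) \<le> norm (?a - ?b) + norm (?b - ?c) + norm (?d - ?c)"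
        by (metis norm_triangle_ineq norm_triangle_ineq4 add_right_mono order_trans)
      also have "\<dots> < \<epsilon>" using pm[of n K] pN[of K] K elim \<epsilon> unfolding dist_norm by linarith
      finally show ?case .
    qed
    then show "\<exists>no. \<forall>n\<ge>no. norm (char (\<mu> n) t - char (normal_law 0 v) t) < \<epsilon>"
      by (simp add: eventually_sequentially)
  qed
qed

section \<open>Power kernels\<close>

text \<open>The one-sided power of the positive part. It is 0 for all x \<le> 0 even when e < 0, so
  the singular kernels are functions on the whole line.\<close>

definition pospow :: "real \<Rightarrow> real \<Rightarrow> real" where
  "pospow e x = max 0 x powr e"

lemma pospow_measurable[measurable]: "pospow e \<in> borel_measurable borel"
  unfolding pospow_def[abs_def] by measurable

lemma pospow_nonneg: "pospow e x \<ge> 0"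
  by (simp add: pospow_def)

lemma pospow_nonpos: "x \<le> 0 \<Longrightarrow> pospow e x = 0"
  by (simp add: pospow_def max_def)

lemma pospow_pos: "x \<ge> 0 \<Longrightarrow> pospow e x = x powr e"
  by (simp add: pospow_def max_def)

lemma pospow_le_1: "e < 0 \<Longrightarrow> x \<ge> 1 \<Longrightarrow> pospow e x \<le> 1"
  using powr_mono[of e 0 x] by (simp add: pospow_pos)

lemma powr_has_bochner_integral:
  assumes e: "-1 < e" and c: "c \<ge> 0"
  shows "has_bochner_integral lborel (\<lambda>x. indicator {0<..c} x * pospow e x) (c powr (e + 1) / (e + 1))"
proof -
  have *: "indicator {0<..c} x * pospow e x = indicator {0..c} x * x powr e" for x
    by (auto simp: indicator_def pospow_pos)
  have "integral\<^sup>N lborel (\<lambda>x. ennreal (indicator {0..c} x * x powr e)) = ennreal (c powr (e + 1) / (e + 1))"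
    by (rule nn_integral_has_integral_lebesgue[OF _ has_integral_powr_from_0[OF e c]]) auto
  then show ?thesis
    unfolding * using e c by (intro has_bochner_integral_nn_integral) auto
qed

lemma has_bochner_integral_lborel_shift:
  fixes f :: "real \<Rightarrow> real"
  assumes "has_bochner_integral lborel f x"
  shows "has_bochner_integral lborel (\<lambda>v. f (v - u)) x"
    and "has_bochner_integral lborel (\<lambda>v. f (u - v)) x"
  using assms lborel_has_bochner_integral_real_affine_iff[of 1 f x "- u"]
    lborel_has_bochner_integral_real_affine_iff[of "-1" f x u] by simp_all

lemma pospow_has_bochner_integral:
  assumes e: "-1 < e" and ab: "a \<le> b"
  shows "has_bochner_integral lborel (\<lambda>x. indicator {a<..b} x * pospow e x) ((pospow (e + 1) b - pospow (e + 1) a) / (e + 1))"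
proof -
  have "has_bochner_integral lborel (\<lambda>x. indicator {0<..max 0 b} x * pospow e x - indicator {0<..max 0 a} x * pospow e x)
    (max 0 b powr (e + 1) / (e + 1) - max 0 a powr (e + 1) / (e + 1))"
    by (intro has_bochner_integral_diff powr_has_bochner_integral e) auto
  moreover have "indicator {0<..max 0 b} x * pospow e x - indicator {0<..max 0 a} x * pospow e x = indicator {a<..b} x * pospow e x" for x
    using ab by (auto simp: indicator_def pospow_nonpos)
  ultimately show ?thesis by (simp add: pospow_def diff_divide_distrib)
qed

lemma pospow_shift_has_bochner_integral:
  assumes e: "-1 < e" and ab: "a \<le> b"
  shows "has_bochner_integral lborel (\<lambda>v. indicator {a<..b} v * pospow e (v - u)) ((pospow (e + 1) (b - u) - pospow (e + 1) (a - u)) / (e + 1))"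
proof -
  have "has_bochner_integral lborel (\<lambda>x. indicator {a - u<..b - u} x * pospow e x) ((pospow (e + 1) (b - u) - pospow (e + 1) (a - u)) / (e + 1))"
    using ab by (intro pospow_has_bochner_integral e) auto
  from has_bochner_integral_lborel_shift(1)[OF this, of u]
  have "has_bochner_integral lborel (\<lambda>v. indicator {a - u<..b - u} (v - u) * pospow e (v - u)) ((pospow (e + 1) (b - u) - pospow (e + 1) (a - u)) / (e + 1))"
    by simp
  moreover have "indicator {a - u<..b - u} (v - u) = (indicator {a<..b} v :: real)" for v
    by (simp add: indicator_def)
  ultimately show ?thesis by simp
qed

lemma pospow_reflect_has_bochner_integral:
  assumes e: "-1 < e" and ab: "a \<le> b"
  shows "has_bochner_integral lborel (\<lambda>v. indicator {a<..b} v * pospow e (u - v)) ((pospow (e + 1) (u - a) - pospow (e + 1) (u - b)) / (e + 1))"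
proof -
  have "has_bochner_integral lborel (\<lambda>x. indicator {u - b<..u - a} x * pospow e x) ((pospow (e + 1) (u - a) - pospow (e + 1) (u - b)) / (e + 1))"
    using ab by (intro pospow_has_bochner_integral e) auto
  from has_bochner_integral_lborel_shift(2)[OF this, of u]
  have h: "has_bochner_integral lborel (\<lambda>v. indicator {u - b<..u - a} (u - v) * pospow e (u - v)) ((pospow (e + 1) (u - a) - pospow (e + 1) (u - b)) / (e + 1))"
    by simp
  \<comment> \<open>Reflection exchanges the open and the closed end of the interval; the two end
    points form a null set.\<close>
  have "AE v in lborel. indicator {u - b<..u - a} (u - v) * pospow e (u - v) = indicator {a<..b} v * pospow e (u - v)"
    using AE_lborel_singleton[of a] AE_lborel_singleton[of b] by eventually_elim (auto simp: indicator_def)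
  then show ?thesis
    by (subst has_bochner_integral_cong_AE[symmetric, OF _ _ _]) (use h in auto)
qed

text \<open>Integrability controls a test function far from the diagonal, where the kernel is
  bounded; the bound 1 controls it near the diagonal, where the kernel is singular but
  integrable.\<close>

definition tame :: "(real \<Rightarrow> real) \<Rightarrow> bool" where
  "tame f \<longleftrightarrow> integrable lborel f \<and> (\<forall>x. 0 \<le> f x \<and> f x \<le> 1)"

lemma tame_measurable: "tame f \<Longrightarrow> f \<in> borel_measurable borel"
  unfolding tame_def using borel_measurable_integrable by fastforce

lemma tame_indicator: "tame (indicator {a<..b})"
proof -
  have "integrable lborel (indicator {a<..b} :: real \<Rightarrow> real)"
    by (cases "a \<le> b") (auto intro!: integrable_real_indicator)
  then show ?thesis by (auto simp: tame_def indicator_def)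
qed

lemma tame_le: "tame F \<Longrightarrow> f \<in> borel_measurable borel \<Longrightarrow> (\<And>x. 0 \<le> f x) \<Longrightarrow> (\<And>x. f x \<le> F x) \<Longrightarrow> tame f"
  unfolding tame_def by (auto intro!: Bochner_Integration.integrable_bound[of lborel F f] intro: order_trans)

section \<open>Double integrals against a power kernel\<close>

locale power_kernel =
  fixes e A B :: real
  assumes e: "-1 < e" "e < 0"
begin

text \<open>The covariance density of the increments at v - u, with e = H i + H j - 2. The
  coefficients on the two sides of the diagonal differ because the bivariate process need not be
  reversible in time.\<close>

definition k :: "real \<Rightarrow> real" where
  "k x = A * pospow e x + B * pospow e (- x)"

lemma k_measurable[measurable]: "k \<in> borel_measurable borel"
  unfolding k_def[abs_def] by measurable

text \<open>The total mass of \<open>dom g u\<close> when g has integral c. It is the same for every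
  u, which keeps the outer integral under control.\<close>

definition K :: "real \<Rightarrow> real" where
  "K c = (\<bar>A\<bar> + \<bar>B\<bar>) * (2 / (e + 1) + 2 * c)"

text \<open>Within distance 1 of u the test function is replaced by 1 and the kernel kept; farther
  away the power is at most 1 and the test function is bounded by g.\<close>

definition dom :: "(real \<Rightarrow> real) \<Rightarrow> real \<Rightarrow> real \<Rightarrow> real" where
  "dom g u v = (\<bar>A\<bar> + \<bar>B\<bar>) * (indicator {u - 1<..u + 1} v * pospow e (v - u) + indicator {u - 1<..u + 1} v * pospow e (u - v) + 2 * g v)"

lemma dom_has_bochner_integral:
  assumes "tame g" shows "has_bochner_integral lborel (dom g u) (K (integral\<^sup>L lborel g))"
proof -
  have "has_bochner_integral lborel (\<lambda>v. indicator {u - 1<..u + 1} v * pospow e (v - u)) (1 / (e + 1))"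
    using pospow_shift_has_bochner_integral[OF e(1), of "u - 1" "u + 1" u] by (simp add: pospow_nonpos pospow_pos)
  moreover have "has_bochner_integral lborel (\<lambda>v. indicator {u - 1<..u + 1} v * pospow e (u - v)) (1 / (e + 1))"
    using pospow_reflect_has_bochner_integral[OF e(1), of "u - 1" "u + 1" u] by (simp add: pospow_nonpos pospow_pos)
  moreover have "has_bochner_integral lborel g (integral\<^sup>L lborel g)"
    using assms unfolding tame_def by (intro has_bochner_integral_integrable) auto
  ultimately have "has_bochner_integral lborel (dom g u) ((\<bar>A\<bar> + \<bar>B\<bar>) * (1 / (e + 1) + 1 / (e + 1) + 2 * integral\<^sup>L lborel g))"
    unfolding dom_def[abs_def] by (intro has_bochner_integral_mult_right has_bochner_integral_add)
  then show ?thesis by (simp add: K_def)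
qed

lemma le_dom:
  assumes g: "\<And>v. 0 \<le> f v \<and> f v \<le> g v \<and> g v \<le> 1"
  shows "\<bar>f v * k (v - u)\<bar> \<le> dom g u v"
proof -
  let ?I = "indicator {u - 1<..u + 1} v :: real"
  have *: "f v * pospow e x \<le> ?I * pospow e x + g v" if x: "\<bar>x\<bar> = \<bar>v - u\<bar>" for x
  proof (cases "v \<in> {u - 1<..u + 1}")
    case True
    have "f v * pospow e x \<le> 1 * pospow e x"
      using g[of v] by (intro mult_right_mono pospow_nonneg) auto
    then show ?thesis using True g[of v] by auto
  next
    case False
    have "pospow e x \<le> 1"
    proof (cases "x \<le> 0")
      case False
      then show ?thesis using \<open>v \<notin> _\<close> e x by (intro pospow_le_1) auto
    qed (simp add: pospow_nonpos)
    then have "f v * pospow e x \<le> g v * 1"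
      using g[of v] by (intro mult_mono pospow_nonneg) auto
    then show ?thesis using False by simp
  qed
  have b: "f v * pospow e (v - u) \<le> ?I * pospow e (v - u) + g v"
    and c: "f v * pospow e (u - v) \<le> ?I * pospow e (u - v) + g v" by (intro *; simp)+
  have nn: "0 \<le> f v * pospow e (v - u)" "0 \<le> f v * pospow e (u - v)"
    using g[of v] by (auto intro: mult_nonneg_nonneg pospow_nonneg)
  have "\<bar>f v * k (v - u)\<bar> = \<bar>A * (f v * pospow e (v - u)) + B * (f v * pospow e (u - v))\<bar>"
    by (simp add: k_def algebra_simps)
  also have "\<dots> \<le> \<bar>A\<bar> * (f v * pospow e (v - u)) + \<bar>B\<bar> * (f v * pospow e (u - v))"
    by (intro order_trans[OF abs_triangle_ineq]) (simp only: abs_mult[of A] abs_mult[of B] abs_of_nonneg[OF nn(1)] abs_of_nonneg[OF nn(2)] order_refl)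
  also have "\<dots> \<le> (\<bar>A\<bar> + \<bar>B\<bar>) * (f v * pospow e (v - u)) + (\<bar>A\<bar> + \<bar>B\<bar>) * (f v * pospow e (u - v))"
    using nn by (intro add_mono mult_right_mono) auto
  also have "\<dots> = (\<bar>A\<bar> + \<bar>B\<bar>) * (f v * pospow e (v - u) + f v * pospow e (u - v))" by (simp add: algebra_simps)
  also have "\<dots> \<le> dom g u v"
    unfolding dom_def using b c by (intro mult_left_mono) auto
  finally show ?thesis .
qed

lemma tame_kernel_integrable:
  assumes "tame g" shows "integrable lborel (\<lambda>v. g v * k (v - u))"
proof (rule Bochner_Integration.integrable_bound)
  show "integrable lborel (dom g u)"
    using dom_has_bochner_integral[OF assms] by (auto simp: has_bochner_integral_iff)
  show "(\<lambda>v. g v * k (v - u)) \<in> borel_measurable lborel"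
    using tame_measurable[OF assms] by measurable
  show "AE v in lborel. norm (g v * k (v - u)) \<le> norm (dom g u v)"
    using le_dom[of g g] assms unfolding tame_def by (intro AE_I2) (metis abs_le_D1 abs_le_iff order_refl order_trans real_norm_def)
qed

definition inner :: "(real \<Rightarrow> real) \<Rightarrow> real \<Rightarrow> real" where
  "inner g u = (LINT v|lborel. g v * k (v - u))"

lemma inner_measurable:
  assumes "tame g" shows "inner g \<in> borel_measurable borel"
proof -
  have [measurable]: "g \<in> borel_measurable borel" by (rule tame_measurable[OF assms])
  show ?thesis unfolding inner_def[abs_def] by measurable
qed

lemma inner_le:
  assumes f: "f \<in> borel_measurable borel" "\<And>v. 0 \<le> f v" "\<And>v. f v \<le> g v" and g: "tame g"
  shows "\<bar>inner f u\<bar> \<le> K (integral\<^sup>L lborel g)"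
proof -
  have "\<bar>inner f u\<bar> \<le> integral\<^sup>L lborel (dom g u)"
  proof -
    have "norm (inner f u) \<le> (LINT v|lborel. norm (f v * k (v - u)))"
      unfolding inner_def by (rule integral_norm_bound)
    also have "\<dots> \<le> integral\<^sup>L lborel (dom g u)"
    proof (rule integral_mono)
      show "integrable lborel (\<lambda>v. norm (f v * k (v - u)))"
        by (intro integrable_norm tame_kernel_integrable tame_le[OF g f])
      show "integrable lborel (dom g u)"
        using dom_has_bochner_integral[OF g] by (auto simp: has_bochner_integral_iff)
      show "norm (f v * k (v - u)) \<le> dom g u v" for v
        using le_dom[of f g v u] f g unfolding tame_def by auto
    qed
    finally show ?thesis by simp
  qed
  then show ?thesis using dom_has_bochner_integral[OF g] by (simp add: has_bochner_integral_iff)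
qed

definition \<Phi> :: "(real \<Rightarrow> real) \<Rightarrow> (real \<Rightarrow> real) \<Rightarrow> real" where
  "\<Phi> f g = (LINT u|lborel. f u * inner g u)"

lemma \<Phi>_integrable:
  assumes f: "tame f" and g: "tame g" shows "integrable lborel (\<lambda>u. f u * inner g u)"
proof (rule Bochner_Integration.integrable_bound)
  show "integrable lborel (\<lambda>u. K (integral\<^sup>L lborel g) * f u)" using f unfolding tame_def by auto
  show "(\<lambda>u. f u * inner g u) \<in> borel_measurable lborel"
    using tame_measurable[OF f] inner_measurable[OF g] by measurable
  have "\<bar>f u * inner g u\<bar> \<le> \<bar>K (integral\<^sup>L lborel g) * f u\<bar>" for u
  proof -
    have "\<bar>f u\<bar> * \<bar>inner g u\<bar> \<le> \<bar>f u\<bar> * \<bar>K (integral\<^sup>L lborel g)\<bar>"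
      using inner_le[OF tame_measurable[OF g] _ _ g, of u] g unfolding tame_def
      by (intro mult_left_mono) (auto intro: order_trans[OF _ abs_ge_self])
    then show ?thesis by (simp add: abs_mult mult.commute)
  qed
  then show "AE u in lborel. norm (f u * inner g u) \<le> norm (K (integral\<^sup>L lborel g) * f u)" by simp
qed

lemma inner_sum:
  assumes "\<And>l. l \<in> S \<Longrightarrow> tame (g l)"
  shows "inner (\<lambda>v. \<Sum>l\<in>S. b l * g l v) u = (\<Sum>l\<in>S. b l * inner (g l) u)"
proof -
  have "inner (\<lambda>v. \<Sum>l\<in>S. b l * g l v) u = (LINT v|lborel. (\<Sum>l\<in>S. b l * (g l v * k (v - u))))"
    unfolding inner_def by (simp add: sum_distrib_right mult.assoc)
  also have "\<dots> = (\<Sum>l\<in>S. LINT v|lborel. b l * (g l v * k (v - u)))"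
    by (intro Bochner_Integration.integral_sum integrable_mult_right tame_kernel_integrable assms)
  finally show ?thesis by (simp add: inner_def)
qed

lemma \<Phi>_sum:
  assumes f: "\<And>j. j \<in> R \<Longrightarrow> tame (f j)" and g: "\<And>l. l \<in> S \<Longrightarrow> tame (g l)"
  shows "\<Phi> (\<lambda>u. \<Sum>j\<in>R. a j * f j u) (\<lambda>v. \<Sum>l\<in>S. b l * g l v) = (\<Sum>j\<in>R. \<Sum>l\<in>S. a j * b l * \<Phi> (f j) (g l))"
proof -
  have "\<Phi> (\<lambda>u. \<Sum>j\<in>R. a j * f j u) (\<lambda>v. \<Sum>l\<in>S. b l * g l v) =
    (LINT u|lborel. (\<Sum>j\<in>R. \<Sum>l\<in>S. (a j * b l) * (f j u * inner (g l) u)))"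
  proof -
    have "inner (\<lambda>v. \<Sum>l\<in>S. b l * g l v) u = (\<Sum>l\<in>S. b l * inner (g l) u)" for u
      by (rule inner_sum) (rule g)
    then show ?thesis unfolding \<Phi>_def by (simp add: sum_product mult_ac)
  qed
  also have "\<dots> = (\<Sum>j\<in>R. LINT u|lborel. (\<Sum>l\<in>S. (a j * b l) * (f j u * inner (g l) u)))"
    by (intro Bochner_Integration.integral_sum Bochner_Integration.integrable_sum integrable_mult_right \<Phi>_integrable f g)
  also have "\<dots> = (\<Sum>j\<in>R. \<Sum>l\<in>S. LINT u|lborel. (a j * b l) * (f j u * inner (g l) u))"
    by (intro sum.cong refl Bochner_Integration.integral_sum integrable_mult_right \<Phi>_integrable f g)
  finally show ?thesis by (simp add: \<Phi>_def)
qed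

text \<open>Dominated convergence in both integrals: \<open>dom G u\<close> dominates the inner one,
  and since its mass does not depend on u, a multiple of F dominates the outer one.\<close>

lemma \<Phi>_tendsto:
  assumes F: "tame F" and G: "tame G"
    and f: "\<And>n. f n \<in> borel_measurable borel" "\<And>n x. 0 \<le> f n x" "\<And>n x. f n x \<le> F x" "\<And>x. (\<lambda>n. f n x) \<longlonglongrightarrow> f' x"
    and g: "\<And>n. g n \<in> borel_measurable borel" "\<And>n x. 0 \<le> g n x" "\<And>n x. g n x \<le> G x" "\<And>x. (\<lambda>n. g n x) \<longlonglongrightarrow> g' x"
  shows "(\<lambda>n. \<Phi> (f n) (g n)) \<longlonglongrightarrow> \<Phi> f' g'"
proof -
  have f': "f' \<in> borel_measurable borel" by (rule borel_measurable_LIMSEQ_real[OF f(4) f(1)])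
  have g': "g' \<in> borel_measurable borel" by (rule borel_measurable_LIMSEQ_real[OF g(4) g(1)])
  have g'b: "0 \<le> g' x" "g' x \<le> G x" for x
    using g by (auto intro: LIMSEQ_le_const[OF g(4)] LIMSEQ_le_const2[OF g(4)])
  have tg: "tame g'" by (rule tame_le[OF G g' g'b])
  have tgn: "tame (g n)" for n by (rule tame_le[OF G g(1-3)])
  have inner: "(\<lambda>n. inner (g n) u) \<longlonglongrightarrow> inner g' u" for u
    unfolding inner_def
  proof (rule integral_dominated_convergence[where w="dom G u"])
    show "integrable lborel (dom G u)"
      using dom_has_bochner_integral[OF G] by (auto simp: has_bochner_integral_iff)
    show "(\<lambda>v. g' v * k (v - u)) \<in> borel_measurable lborel" using g' by measurable
    show "(\<lambda>v. g n v * k (v - u)) \<in> borel_measurable lborel" for n using g(1)[of n] by measurable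
    show "AE v in lborel. (\<lambda>n. g n v * k (v - u)) \<longlonglongrightarrow> g' v * k (v - u)"
      by (intro AE_I2 tendsto_intros g)
    show "AE v in lborel. norm (g n v * k (v - u)) \<le> dom G u v" for n
      using le_dom[of "g n" G] g G unfolding tame_def by (intro AE_I2) auto
  qed
  show ?thesis
    unfolding \<Phi>_def
  proof (rule integral_dominated_convergence[where w="\<lambda>u. K (integral\<^sup>L lborel G) * F u"])
    show "integrable lborel (\<lambda>u. K (integral\<^sup>L lborel G) * F u)" using F by (simp add: tame_def)
    show "(\<lambda>u. f' u * inner g' u) \<in> borel_measurable lborel" using f' inner_measurable[OF tg] by measurable
    show "(\<lambda>u. f n u * inner (g n) u) \<in> borel_measurable lborel" for n using f(1)[of n] inner_measurable[OF tgn[of n]] by measurable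
    show "AE u in lborel. (\<lambda>n. f n u * inner (g n) u) \<longlonglongrightarrow> f' u * inner g' u"
      by (intro AE_I2 tendsto_intros f inner)
    show "AE u in lborel. norm (f n u * inner (g n) u) \<le> K (integral\<^sup>L lborel G) * F u" for n
    proof (rule AE_I2)
      fix u
      have "\<bar>f n u\<bar> * \<bar>inner (g n) u\<bar> \<le> F u * K (integral\<^sup>L lborel G)"
        using f(2,3)[of n u] F inner_le[OF g(1-3) G, of n u] unfolding tame_def by (intro mult_mono) auto
      then show "norm (f n u * inner (g n) u) \<le> K (integral\<^sup>L lborel G) * F u"
        by (simp add: abs_mult mult.commute)
    qed
  qed
qed

text \<open>A second antiderivative of \<open>k\<close> away from the origin; the double integral of
  the kernel over a rectangle is a mixed second difference of it.\<close>

definition W :: "real \<Rightarrow> real" where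
  "W x = (A * pospow (e + 2) x + B * pospow (e + 2) (- x)) / ((e + 1) * (e + 2))"

lemma inner_indicator:
  assumes "s \<le> s'"
  shows "inner (indicator {s<..s'}) u = (A * (pospow (e + 1) (s' - u) - pospow (e + 1) (s - u)) + B * (pospow (e + 1) (u - s) - pospow (e + 1) (u - s'))) / (e + 1)"
proof -
  have "has_bochner_integral lborel (\<lambda>v. A * (indicator {s<..s'} v * pospow e (v - u)) + B * (indicator {s<..s'} v * pospow e (u - v)))
    (A * ((pospow (e + 1) (s' - u) - pospow (e + 1) (s - u)) / (e + 1)) + B * ((pospow (e + 1) (u - s) - pospow (e + 1) (u - s')) / (e + 1)))"
    by (intro has_bochner_integral_add has_bochner_integral_mult_right pospow_shift_has_bochner_integral pospow_reflect_has_bochner_integral e assms)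
  from has_bochner_integral_integral_eq[OF this]
  show ?thesis by (simp add: inner_def k_def algebra_simps add_divide_distrib diff_divide_distrib)
qed

lemma \<Phi>_indicator:
  assumes t: "t \<le> t'" and s: "s \<le> s'"
  shows "\<Phi> (indicator {t<..t'}) (indicator {s<..s'}) = W (s' - t) - W (s' - t') - W (s - t) + W (s - t')"
proof -
  let ?I = "\<lambda>u. indicator {t<..t'} u :: real"
  let ?p = "pospow (e + 1)" and ?q = "pospow (e + 2)"
  have e2: "-1 < e + 1" and e12: "e + 1 + 1 = e + 2" using e by auto
  note refl = pospow_reflect_has_bochner_integral[OF e2 t, unfolded e12]
  note shift = pospow_shift_has_bochner_integral[OF e2 t, unfolded e12]
  have "has_bochner_integral lborel (\<lambda>u. (A * (?I u * ?p (s' - u) - ?I u * ?p (s - u)) + B * (?I u * ?p (u - s) - ?I u * ?p (u - s'))) / (e + 1))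
     ((A * ((?q (s' - t) - ?q (s' - t')) / (e + 2) - (?q (s - t) - ?q (s - t')) / (e + 2)) +
       B * ((?q (t' - s) - ?q (t - s)) / (e + 2) - (?q (t' - s') - ?q (t - s')) / (e + 2))) / (e + 1))"
    by (intro has_bochner_integral_divide has_bochner_integral_add has_bochner_integral_diff has_bochner_integral_mult_right refl shift)
  moreover have "(A * (?I u * ?p (s' - u) - ?I u * ?p (s - u)) + B * (?I u * ?p (u - s) - ?I u * ?p (u - s'))) / (e + 1)
    = ?I u * inner (indicator {s<..s'}) u" for u
    unfolding inner_indicator[OF s] by (simp add: algebra_simps add_divide_distrib diff_divide_distrib)
  ultimately have "\<Phi> (indicator {t<..t'}) (indicator {s<..s'}) =
     (A * ((?q (s' - t) - ?q (s' - t')) / (e + 2) - (?q (s - t) - ?q (s - t')) / (e + 2)) +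
       B * ((?q (t' - s) - ?q (t - s)) / (e + 2) - (?q (t' - s') - ?q (t - s')) / (e + 2))) / (e + 1)"
    unfolding \<Phi>_def using has_bochner_integral_integral_eq by fastforce
  also have "\<dots> = W (s' - t) - W (s' - t') - W (s - t) + W (s - t')"
  proof -
    have "(A * ((a1 / d - a2 / d) - (a3 / d - a4 / d)) + B * ((b1 / d - b2 / d) - (b3 / d - b4 / d))) / c
      = (A * a1 + B * b4) / (c * d) - (A * a2 + B * b3) / (c * d) - (A * a3 + B * b2) / (c * d) + (A * a4 + B * b1) / (c * d)"
      for a1 a2 a3 a4 b1 b2 b3 b4 c d :: real
      by (simp add: add_divide_distrib diff_divide_distrib right_diff_distrib distrib_left mult.commute)
    note this[of "?q (s' - t)" "e + 2" "?q (s' - t')" "?q (s - t)" "?q (s - t')" "?q (t' - s)" "?q (t - s)" "?q (t' - s')" "?q (t - s')" "e + 1"]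
    then show ?thesis by (simp add: W_def diff_divide_distrib)
  qed
  finally show ?thesis .
qed

end

section \<open>Exponential weights and their step approximations\<close>

lemma exp_Ici_has_bochner_integral:
  assumes "a > 0"
  shows "has_bochner_integral lborel (\<lambda>y::real. indicator {0..} y * exp (- a * y)) (1 / a)"
proof (rule has_bochner_integral_nn_integral)
  show "(\<integral>\<^sup>+ y. ennreal (indicator {0..} y * exp (- a * y)) \<partial>lborel) = ennreal (1 / a)"
    by (rule nn_integral_has_integral_lebesgue) (use has_integral_exp_minus_to_infinity[OF assms, of 0] in auto)
qed (use assms in auto)

definition expdecay :: "real \<Rightarrow> real \<Rightarrow> real \<Rightarrow> real" where
  "expdecay a t u = indicator {..t} u * exp (- a * (t - u))"

lemma expdecay_has_bochner_integral:
  assumes "a > 0" shows "has_bochner_integral lborel (expdecay a t) (1 / a)"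
proof -
  have "has_bochner_integral lborel (\<lambda>u::real. indicator {0..} (t - u) * exp (- a * (t - u))) (1 / a)"
    by (rule has_bochner_integral_lborel_shift(2)[OF exp_Ici_has_bochner_integral[OF assms]])
  moreover have "indicator {0..} (t - u) = (indicator {..t} u :: real)" for u by (simp add: indicator_def)
  ultimately show ?thesis by (simp add: expdecay_def[abs_def])
qed

lemma tame_expdecay: "a > 0 \<Longrightarrow> tame (expdecay a t)"
  using expdecay_has_bochner_integral[of a t] unfolding tame_def
  by (auto simp: has_bochner_integral_iff expdecay_def indicator_def)

lemma expdecay_measurable[measurable]: "expdecay a t \<in> borel_measurable borel"
  unfolding expdecay_def[abs_def] by measurable

text \<open>With tags at the left end points the step functions stay below the increasing exponential, so that
  \<open>expdecay\<close> dominates both limits (mesh to zero, then lower limit to \<open>-\<infinity>\<close>).\<close>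

definition stepdecay :: "real \<Rightarrow> real \<Rightarrow> real \<Rightarrow> nat \<Rightarrow> real \<Rightarrow> real" where
  "stepdecay a t d J u = (\<Sum>j<J. exp (- a * (real (Suc j) * d)) * indicator {t - real (Suc j) * d<..t - real j * d} u)"

lemma stepdecay_measurable[measurable]: "stepdecay a t d J \<in> borel_measurable borel"
  unfolding stepdecay_def[abs_def] by measurable

text \<open>On a cell of length d the exponential varies by a factor of at most exp (a d), which
  gives the lower bound; it is smallest at the left end, which gives the upper one. Cells are
  disjoint, so the induction changes the value at u at most once.\<close>

lemma stepdecay_bounds:
  assumes a: "a > 0" and d: "d > 0"
  shows "stepdecay a t d J u \<le> indicator {t - real J * d<..t} u * expdecay a t u"
    and "exp (- a * d) * (indicator {t - real J * d<..t} u * expdecay a t u) \<le> stepdecay a t d J u"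
proof -
  have "stepdecay a t d J u \<le> indicator {t - real J * d<..t} u * expdecay a t u \<and>
    exp (- a * d) * (indicator {t - real J * d<..t} u * expdecay a t u) \<le> stepdecay a t d J u"
  proof (induction J)
    case 0
    then show ?case by (simp add: stepdecay_def)
  next
    case (Suc J)
    have S: "stepdecay a t d (Suc J) u = stepdecay a t d J u + exp (- a * (real (Suc J) * d)) * indicator {t - real (Suc J) * d<..t - real J * d} u"
      by (simp add: stepdecay_def)
    show ?case
    proof (cases "u \<in> {t - real (Suc J) * d<..t - real J * d}")
      case False
      then have "indicator {t - real (Suc J) * d<..t} u = (indicator {t - real J * d<..t} u :: real)"
        using d by (auto simp: indicator_def algebra_simps)
      then show ?thesis using Suc False unfolding S by simp
    next
      case True
      have z: "indicator {t - real J * d<..t} u = (0::real)" using True by auto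
      have s0: "stepdecay a t d J u = 0" using Suc z by simp
      have "t - real J * d \<le> t" using d by simp
      then have i: "indicator {t - real (Suc J) * d<..t} u = (1::real)" "u \<le> t"
        using True unfolding indicator_def by (auto intro: order_trans)
      have "exp (- a * (real (Suc J) * d)) \<le> exp (- a * (t - u))"
        using True a by (simp add: less_imp_le)
      moreover have "exp (- a * d) * exp (- a * (t - u)) \<le> exp (- a * (real (Suc J) * d))"
      proof -
        have "a * (real J * d) \<le> a * (t - u)" using True a by (intro mult_left_mono) auto
        then have "- a * d + - a * (t - u) \<le> - a * (real (Suc J) * d)"
          by (simp add: algebra_simps)
        then show ?thesis unfolding exp_add[symmetric] by simp
      qed
      ultimately show ?thesis
        using True i(2) unfolding S s0 i(1) expdecay_def by simp
    qed
  qed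
  then show "stepdecay a t d J u \<le> indicator {t - real J * d<..t} u * expdecay a t u"
    "exp (- a * d) * (indicator {t - real J * d<..t} u * expdecay a t u) \<le> stepdecay a t d J u" by auto
qed

lemma stepdecay_nonneg: "0 \<le> stepdecay a t d J u"
  by (auto simp: stepdecay_def intro!: sum_nonneg)

lemma stepdecay_le_expdecay:
  assumes a: "a > 0" and d: "d > 0"
  shows "stepdecay a t d J u \<le> expdecay a t u"
  by (rule order_trans[OF stepdecay_bounds(1)[OF assms]]) (auto simp: indicator_def expdecay_def)

lemma stepdecay_tendsto:
  assumes a: "a > 0"
  shows "(\<lambda>N. stepdecay a t (1 / real (Suc N)) (m * Suc N) u) \<longlonglongrightarrow> indicator {t - real m<..t} u * expdecay a t u"
proof (rule tendsto_sandwich)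
  let ?f = "indicator {t - real m<..t} u * expdecay a t u"
  \<comment> \<open>m (N + 1) cells of length 1 / (N + 1) cover an interval of length exactly
    m.\<close>
  have J: "real (m * Suc N) * (1 / real (Suc N)) = real m" for N
    unfolding of_nat_mult by (simp only: times_divide_eq_right mult_1_right) (rule nonzero_mult_div_cancel_right, simp)
  show "eventually (\<lambda>N. exp (- a * (1 / real (Suc N))) * ?f \<le> stepdecay a t (1 / real (Suc N)) (m * Suc N) u) sequentially"
    using stepdecay_bounds(2)[OF a, of "1 / real (Suc N)" t "m * Suc N" u for N] unfolding J by auto
  show "eventually (\<lambda>N. stepdecay a t (1 / real (Suc N)) (m * Suc N) u \<le> ?f) sequentially"
    using stepdecay_bounds(1)[OF a, of "1 / real (Suc N)" t "m * Suc N" u for N] unfolding J by auto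
  have "(\<lambda>N. exp (- a * (1 / real (Suc N))) * ?f) \<longlonglongrightarrow> exp (- a * 0) * ?f"
    by (intro tendsto_intros LIMSEQ_inverse_real_of_nat[unfolded inverse_eq_divide])
  then show "(\<lambda>N. exp (- a * (1 / real (Suc N))) * ?f) \<longlonglongrightarrow> ?f" by simp
qed simp

lemma truncated_expdecay_tendsto:
  "(\<lambda>m. indicator {t - real m<..t} u * expdecay a t u) \<longlonglongrightarrow> expdecay a t u"
proof (rule tendsto_eventually)
  obtain M :: nat where M: "t - u < real M" using reals_Archimedean2 by blast
  have "indicator {t - real m<..t} u * expdecay a t u = expdecay a t u" if "m \<ge> M" for m
    using M that by (auto simp: indicator_def expdecay_def)
  then show "eventually (\<lambda>m. indicator {t - real m<..t} u * expdecay a t u = expdecay a t u) sequentially"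
    by (auto simp: eventually_sequentially)
qed

lemma lborel_integral_shift:
  fixes f :: "real \<Rightarrow> real"
  shows "(LINT u|lborel. f (u - a)) = integral\<^sup>L lborel f"
    and "(LINT u|lborel. f (a - u)) = integral\<^sup>L lborel f"
  using lborel_integral_real_affine[of 1 f "- a"] lborel_integral_real_affine[of "-1" f a] by simp_all

lemma expdecay_shift: "expdecay a (t + c) u = expdecay a t (u - c)"
  by (simp add: expdecay_def indicator_def algebra_simps)

section \<open>Stationarity and the decomposition at the origin\<close>

context power_kernel
begin

lemma \<Phi>_shift: "\<Phi> (\<lambda>u. f (u - a)) (\<lambda>v. g (v - a)) = \<Phi> f g"
proof -
  have "inner (\<lambda>v. g (v - a)) u = inner g (u - a)" for u
    using lborel_integral_shift(1)[of "\<lambda>v. g v * k (v - (u - a))" a]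
    unfolding inner_def by (simp add: algebra_simps)
  then show ?thesis
    using lborel_integral_shift(1)[of "\<lambda>u. f u * inner g u" a] unfolding \<Phi>_def by simp
qed

lemma \<Phi>_expdecay_shift: "\<Phi> (expdecay a (t + c)) (expdecay b (s + c)) = \<Phi> (expdecay a t) (expdecay b s)"
  using \<Phi>_shift[of "expdecay a t" c "expdecay b s"] by (simp add: expdecay_shift[abs_def])

definition G :: "real \<Rightarrow> real \<Rightarrow> real" where
  "G b u = (LINT v:{..0}|lborel. exp (b * v) * (u - v) powr e)"

text \<open>With e = h - 2 and x = s this is the number \<open>I_coef\<close> of the estimators; a
  real upper limit is allowed for the asymptotics.\<close>

definition J :: "real \<Rightarrow> real \<Rightarrow> real \<Rightarrow> real" where
  "J a b x = (LINT u:{0..x}|lborel. exp (a * u) * G b u)"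

lemma inner_expdecay:
  assumes "u \<ge> 0" shows "inner (expdecay b 0) u = B * G b u"
proof -
  have "expdecay b 0 v * k (v - u) = B * (indicator {..0} v *\<^sub>R (exp (b * v) * (u - v) powr e))" for v
    using assms by (cases "v \<le> 0") (auto simp: expdecay_def k_def pospow_nonpos pospow_pos)
  then show ?thesis
    unfolding inner_def G_def set_lebesgue_integral_def by simp
qed

text \<open>Up to the factor exp (-a x) the weight ending at x extends the one ending at 0, and the
  rest lives on (0, x]. There u > 0 \<ge> v, so that of the two halves of the kernel only the one
  with coefficient B is met. The lagged covariance minus the damped simultaneous one therefore
  isolates B.\<close>

lemma \<Phi>_decompose:
  assumes a: "a > 0" and b: "b > 0" and x: "x \<ge> 0"
  shows "\<Phi> (expdecay a x) (expdecay b 0) = exp (- a * x) * (\<Phi> (expdecay a 0) (expdecay b 0) + B * J a b x)"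
proof -
  define f where "f u = indicator {0<..x} u * exp (- a * (x - u))" for u
  have f: "tame f"
    using a by (intro tame_le[OF tame_indicator[of 0 x]]) (auto simp: f_def[abs_def] indicator_def)
  note g = tame_expdecay[OF b, of 0] and f0 = tame_expdecay[OF a, of 0]
  have split: "expdecay a x u = exp (- a * x) * expdecay a 0 u + f u" for u
    using x by (auto simp: expdecay_def f_def indicator_def exp_add[symmetric] algebra_simps)
  have "\<Phi> (expdecay a x) (expdecay b 0) =
    (LINT u|lborel. exp (- a * x) * (expdecay a 0 u * inner (expdecay b 0) u) + f u * inner (expdecay b 0) u)"
    unfolding \<Phi>_def split by (simp add: algebra_simps)
  also have "\<dots> = exp (- a * x) * \<Phi> (expdecay a 0) (expdecay b 0) + (LINT u|lborel. f u * inner (expdecay b 0) u)"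
    using \<Phi>_integrable[OF f0 g] \<Phi>_integrable[OF f g] unfolding \<Phi>_def by simp
  also have "(LINT u|lborel. f u * inner (expdecay b 0) u) =
      (LINT u|lborel. (exp (- a * x) * B) * (indicator {0..x} u *\<^sub>R (exp (a * u) * G b u)))"
  proof (rule integral_cong_AE)
    show "AE u in lborel. f u * inner (expdecay b 0) u = (exp (- a * x) * B) * (indicator {0..x} u *\<^sub>R (exp (a * u) * G b u))"
      \<comment> \<open>The integral in \<open>J\<close> runs over the closed interval, while f
        vanishes at 0.\<close>
      using AE_lborel_singleton[of 0]
    proof eventually_elim
      case (elim u)
      then show ?case
        using inner_expdecay[of u b]
        by (cases "u \<in> {0<..x}") (auto simp: f_def indicator_def exp_add[symmetric] algebra_simps exp_diff exp_minus field_simps)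
    qed
    show "(\<lambda>u. f u * inner (expdecay b 0) u) \<in> borel_measurable lborel"
      using borel_measurable_integrable[OF \<Phi>_integrable[OF f g]] .
    show "(\<lambda>u. (exp (- a * x) * B) * (indicator {0..x} u *\<^sub>R (exp (a * u) * G b u))) \<in> borel_measurable lborel"
      unfolding G_def set_lebesgue_integral_def by measurable
  qed
  also have "\<dots> = exp (- a * x) * (B * J a b x)"
    unfolding J_def set_lebesgue_integral_def by simp
  finally show ?thesis by (simp add: algebra_simps)
qed

end

section \<open>Size and positivity of the integrals \<open>G\<close> and \<open>J\<close>\<close>

locale power_tail = power_kernel e 0 1 for e
begin

text \<open>\<open>G\<close> and \<open>J\<close> are determined by the exponent alone. For the
  one-sided kernel with coefficients 0 and 1 the function \<open>G\<close> is an instance of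
  \<open>inner\<close>, so the bounds of the general kernel apply to it.\<close>

lemma G_eq_inner: "u \<ge> 0 \<Longrightarrow> G b u = inner (expdecay b 0) u"
  using inner_expdecay by simp

lemma G_measurable[measurable]: "G b \<in> borel_measurable borel"
  unfolding G_def[abs_def] set_lebesgue_integral_def by measurable

lemma G_nonneg: "G b u \<ge> 0"
  unfolding G_def set_lebesgue_integral_def by (intro integral_nonneg_AE AE_I2) auto

lemma G_le_K: "b > 0 \<Longrightarrow> u \<ge> 0 \<Longrightarrow> G b u \<le> K (1 / b)"
  using inner_le[OF expdecay_measurable, of b 0 "expdecay b 0" u] tame_expdecay[of b 0] expdecay_has_bochner_integral[of b 0]
  by (auto simp: G_eq_inner has_bochner_integral_iff tame_def)

lemma G_integrable: "b > 0 \<Longrightarrow> u \<ge> 0 \<Longrightarrow> integrable lborel (\<lambda>v. indicator {..0} v * (exp (b * v) * (u - v) powr e))"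
proof -
  assume b: "b > 0" and u: "u \<ge> 0"
  have "expdecay b 0 v * k (v - u) = indicator {..0} v * (exp (b * v) * (u - v) powr e)" for v
    using u by (cases "v \<le> 0") (auto simp: expdecay_def k_def pospow_nonpos pospow_pos)
  then show ?thesis using tame_kernel_integrable[OF tame_expdecay[OF b], of 0 u] by simp
qed

text \<open>Absorbing the factor u^(-e) replaces the base of the power by (u - v) / u, which is at
  least 1 on the support and tends to 1 as u grows. As e < 0, \<open>expdecay b 0\<close> then
  dominates the integrand.\<close>

lemma scaled_G:
  assumes "u > 0"
  shows "u powr (- e) * G b u = (LINT v|lborel. expdecay b 0 v * ((u - v) / u) powr e)"
proof -
  have "u powr (- e) * G b u = (LINT v|lborel. u powr (- e) * (indicator {..0} v *\<^sub>R (exp (b * v) * (u - v) powr e)))"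
    unfolding G_def set_lebesgue_integral_def by simp
  also have "\<dots> = (LINT v|lborel. expdecay b 0 v * ((u - v) / u) powr e)"
  proof (rule Bochner_Integration.integral_cong[OF refl])
    fix v
    show "u powr (- e) * (indicator {..0} v *\<^sub>R (exp (b * v) * (u - v) powr e)) = expdecay b 0 v * ((u - v) / u) powr e"
      using assms by (cases "v \<le> 0") (auto simp: expdecay_def powr_divide powr_minus field_simps)
  qed
  finally show ?thesis .
qed

lemma scaled_integrand_le:
  assumes "u > 0"
  shows "0 \<le> expdecay b 0 v * ((u - v) / u) powr e" "expdecay b 0 v * ((u - v) / u) powr e \<le> expdecay b 0 v"
proof -
  show "0 \<le> expdecay b 0 v * ((u - v) / u) powr e" by (simp add: expdecay_def)
  show "expdecay b 0 v * ((u - v) / u) powr e \<le> expdecay b 0 v"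
  proof (cases "v \<le> 0")
    case True
    then have "((u - v) / u) powr e \<le> ((u - v) / u) powr 0"
      using assms e by (intro powr_mono) (auto simp: field_simps)
    also have "\<dots> \<le> 1" by simp
    finally show ?thesis by (simp add: expdecay_def mult_left_le indicator_def)
  qed (simp add: expdecay_def)
qed

lemma scaled_G_le:
  assumes b: "b > 0" and u: "u > 0"
  shows "u powr (- e) * G b u \<le> 1 / b"
proof -
  have i: "integrable lborel (expdecay b 0)" "integral\<^sup>L lborel (expdecay b 0) = 1 / b"
    using expdecay_has_bochner_integral[OF b, of 0] by (auto simp: has_bochner_integral_iff)
  have "u powr (- e) * G b u \<le> integral\<^sup>L lborel (expdecay b 0)"
    unfolding scaled_G[OF u]
  proof (rule integral_mono)
    show "integrable lborel (\<lambda>v. expdecay b 0 v * ((u - v) / u) powr e)"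
      by (rule Bochner_Integration.integrable_bound[OF i(1)])
         (use scaled_integrand_le[OF u, of b] in \<open>auto intro!: AE_I2 order_trans[OF _ abs_ge_self]\<close>)
  qed (use i scaled_integrand_le[OF u] in auto)
  then show ?thesis using i by simp
qed

lemma scaled_G_tendsto:
  assumes b: "b > 0" and x: "filterlim x at_top sequentially"
  shows "(\<lambda>n. x n powr (- e) * G b (x n)) \<longlonglongrightarrow> 1 / b"
proof -
  have i: "integrable lborel (expdecay b 0)" "integral\<^sup>L lborel (expdecay b 0) = 1 / b"
    using expdecay_has_bochner_integral[OF b, of 0] by (auto simp: has_bochner_integral_iff)
  \<comment> \<open>Truncation at 1 makes the domination valid for every n and alters only finitely
    many terms.\<close>
  define y where "y n = max 1 (x n)" for n
  have y: "y n > 0" for n by (simp add: y_def)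
  have xy: "eventually (\<lambda>n. y n = x n) sequentially"
    using x unfolding filterlim_at_top y_def by (auto elim!: allE[of _ 1] eventually_mono)
  have yt: "filterlim y at_top sequentially"
    by (rule filterlim_cong[THEN iffD1, OF refl refl _ x]) (use xy in \<open>auto elim: eventually_mono\<close>)
  have "(\<lambda>n. LINT v|lborel. expdecay b 0 v * ((y n - v) / y n) powr e) \<longlonglongrightarrow> integral\<^sup>L lborel (expdecay b 0)"
  proof (rule integral_dominated_convergence[where w="expdecay b 0"])
    show "AE v in lborel. (\<lambda>n. expdecay b 0 v * ((y n - v) / y n) powr e) \<longlonglongrightarrow> expdecay b 0 v"
    proof (rule AE_I2)
      fix v
      have "(\<lambda>n. v / y n) \<longlonglongrightarrow> 0"
        by (rule tendsto_divide_0[OF tendsto_const filterlim_at_top_imp_at_infinity[OF yt]])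
      then have "(\<lambda>n. 1 - v / y n) \<longlonglongrightarrow> 1 - 0" by (intro tendsto_intros)
      moreover have "1 - v / y n = (y n - v) / y n" for n using y[of n] by (simp add: field_simps)
      ultimately have "(\<lambda>n. (y n - v) / y n) \<longlonglongrightarrow> 1" by simp
      then have "(\<lambda>n. expdecay b 0 v * ((y n - v) / y n) powr e) \<longlonglongrightarrow> expdecay b 0 v * 1 powr e"
        by (intro tendsto_intros) auto
      then show "(\<lambda>n. expdecay b 0 v * ((y n - v) / y n) powr e) \<longlonglongrightarrow> expdecay b 0 v" by simp
    qed
    show "AE v in lborel. norm (expdecay b 0 v * ((y n - v) / y n) powr e) \<le> expdecay b 0 v" for n
      using scaled_integrand_le[OF y, of b _ n] by (intro AE_I2) (simp only: real_norm_def abs_of_nonneg)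
  qed (use i in auto)
  then have "(\<lambda>n. y n powr (- e) * G b (y n)) \<longlonglongrightarrow> 1 / b" using scaled_G[OF y] i by simp
  then show ?thesis
    by (rule Lim_transform_eventually) (use xy in \<open>auto elim: eventually_mono\<close>)
qed

text \<open>The substitution y = x - u turns the integral into a convolution whose exponential
  weight stays fixed while x grows.\<close>

lemma scaled_J:
  "exp (- a * x) * J a b x = (LINT y|lborel. indicator {0..x} y * (exp (- a * y) * G b (x - y)))"
proof -
  have "exp (- a * x) * J a b x = (LINT u|lborel. indicator {0..x} u * (exp (- a * (x - u)) * G b u))"
    unfolding J_def set_lebesgue_integral_def integral_mult_right_zero[symmetric]
    by (intro Bochner_Integration.integral_cong) (auto simp: indicator_def exp_diff exp_minus field_simps)
  also have "\<dots> = (LINT y|lborel. indicator {0..x} (x - y) * (exp (- a * (x - (x - y))) * G b (x - y)))"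
    by (rule lborel_integral_shift(2)[symmetric])
  also have "\<dots> = (LINT y|lborel. indicator {0..x} y * (exp (- a * y) * G b (x - y)))"
    by (intro Bochner_Integration.integral_cong) (auto simp: indicator_def)
  finally show ?thesis .
qed

text \<open>A bound uniform in x and linear in y, which the exponential weight can absorb. If x - y
  \<ge> 1 then x \<le> (1 + y) (x - y) and the scaled bound for \<open>G\<close> applies; otherwise
  x < 1 + y and the plain bound \<open>K\<close> is enough.\<close>

lemma scaled_G_shift_le:
  assumes b: "b > 0" and y: "0 \<le> y" "y \<le> x"
  shows "x powr (- e) * G b (x - y) \<le> (1 + y) * (1 / b + K (1 / b))"
proof -
  have K: "0 \<le> K (1 / b)" using G_le_K[OF b, of 0] G_nonneg[of b 0] by linarith
  have e': "0 \<le> - e" "- e \<le> 1" using e by auto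
  have y1: "(1 + y) powr (- e) \<le> 1 + y"
    using powr_mono[of "- e" 1 "1 + y"] e' y by simp
  show ?thesis
  proof (cases "x - y \<ge> 1")
    case True
    \<comment> \<open>This product is the difference of (1 + y) (x - y) and x.\<close>
    have "0 \<le> y * (x - y - 1)" using True y by simp
    then have "x \<le> (1 + y) * (x - y)" by (simp add: algebra_simps)
    then have "x powr (- e) \<le> ((1 + y) * (x - y)) powr (- e)"
      using y e' by (intro powr_mono2) auto
    also have "\<dots> = (1 + y) powr (- e) * (x - y) powr (- e)" by (intro powr_mult)
    also have "\<dots> \<le> (1 + y) * (x - y) powr (- e)" by (intro mult_right_mono y1) auto
    finally have "x powr (- e) * G b (x - y) \<le> (1 + y) * (x - y) powr (- e) * G b (x - y)"
      by (intro mult_right_mono G_nonneg)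
    also have "\<dots> \<le> (1 + y) * (1 / b)"
      using scaled_G_le[OF b, of "x - y"] True y unfolding mult.assoc by (intro mult_left_mono) auto
    also have "\<dots> \<le> (1 + y) * (1 / b + K (1 / b))" using K y by (intro mult_left_mono) auto
    finally show ?thesis .
  next
    case False
    have "x powr (- e) \<le> (1 + y) powr (- e)" using False y e' by (intro powr_mono2) auto
    also note y1
    finally have "x powr (- e) * G b (x - y) \<le> (1 + y) * K (1 / b)"
      using y b by (intro mult_mono G_le_K G_nonneg) auto
    also have "\<dots> \<le> (1 + y) * (1 / b + K (1 / b))" using b y by (intro mult_left_mono) auto
    finally show ?thesis .
  qed
qed

text \<open>After scaling, \<open>G\<close> at n - y tends to 1 / b for each fixed y, and the weight
  exp (-a y) has mass 1 / a. For the domination half of the decay rate a is spent on the linear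
  factor of \<open>scaled_G_shift_le\<close>.\<close>

lemma J_tendsto:
  assumes a: "a > 0" and b: "b > 0"
  shows "(\<lambda>n. real n powr (- e) * (exp (- a * real n) * J a b (real n))) \<longlonglongrightarrow> 1 / (a * b)"
proof -
  define c where "c = (1 + 2 / a) * (1 / b + K (1 / b))"
  have K: "0 \<le> K (1 / b)" using G_le_K[OF b, of 0] G_nonneg[of b 0] by linarith
  have h1: "has_bochner_integral lborel (\<lambda>y. indicator {0..} y * exp (- a * y)) (1 / a)"
    by (rule exp_Ici_has_bochner_integral[OF a])
  have h2: "integrable lborel (\<lambda>y. c * (indicator {0..} y * exp (- (a / 2) * y)))"
    using exp_Ici_has_bochner_integral[of "a / 2"] a by (auto simp: has_bochner_integral_iff)
  define F where "F n y = real n powr (- e) * (indicator {0..real n} y * (exp (- a * y) * G b (real n - y)))" for n y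
  have "(\<lambda>n. LINT y|lborel. F n y) \<longlonglongrightarrow> (LINT y|lborel. (indicator {0..} y * exp (- a * y)) * (1 / b))"
  proof (rule integral_dominated_convergence[where w="\<lambda>y. c * (indicator {0..} y * exp (- (a / 2) * y))"])
    show "(\<lambda>y. F n y) \<in> borel_measurable lborel" for n unfolding F_def by measurable
    show "AE y in lborel. (\<lambda>n. F n y) \<longlonglongrightarrow> (indicator {0..} y * exp (- a * y)) * (1 / b)"
    proof (rule AE_I2)
      fix y :: real
      show "(\<lambda>n. F n y) \<longlonglongrightarrow> (indicator {0..} y * exp (- a * y)) * (1 / b)"
      proof (cases "y \<ge> 0")
        case False
        then show ?thesis by (simp add: F_def)
      next
        case True
        have ft: "filterlim (\<lambda>n. real n - y) at_top sequentially"
          by real_asymp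
        have r: "(\<lambda>n. (real n / (real n - y)) powr (- e)) \<longlonglongrightarrow> 1 powr (- e)"
          by (intro tendsto_intros) (real_asymp | simp)+
        have "(\<lambda>n. exp (- a * y) * ((real n / (real n - y)) powr (- e) * ((real n - y) powr (- e) * G b (real n - y)))) \<longlonglongrightarrow> exp (- a * y) * (1 powr (- e) * (1 / b))"
          by (intro tendsto_intros r scaled_G_tendsto[OF b ft])
        moreover have "eventually (\<lambda>n. exp (- a * y) * ((real n / (real n - y)) powr (- e) * ((real n - y) powr (- e) * G b (real n - y))) = F n y) sequentially"
          using filterlim_at_top_dense[THEN iffD1, OF ft, rule_format, of 0]
        proof eventually_elim
          case (elim n)
          then have "(real n / (real n - y)) powr (- e) * (real n - y) powr (- e) = real n powr (- e)"
            by (subst powr_mult[symmetric]) auto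
          then show ?case using elim True by (simp add: F_def mult_ac)
        qed
        ultimately have "(\<lambda>n. F n y) \<longlonglongrightarrow> exp (- a * y) * (1 powr (- e) * (1 / b))"
          by (rule Lim_transform_eventually)
        then show ?thesis using True by simp
      qed
    qed
    show "AE y in lborel. norm (F n y) \<le> c * (indicator {0..} y * exp (- (a / 2) * y))" for n
    proof (rule AE_I2)
      fix y :: real
      show "norm (F n y) \<le> c * (indicator {0..} y * exp (- (a / 2) * y))"
      proof (cases "y \<in> {0..real n}")
        case True
        then have y: "0 \<le> y" "y \<le> real n" by auto
        \<comment> \<open>This inequality is the origin of the factor 1 + 2 / a in \<open>c\<close>:
          it trades the linear growth for exp (a y / 2).\<close>
        have "1 + y \<le> (1 + 2 / a) * (1 + a / 2 * y)" using a y by (simp add: field_simps)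
        also have "\<dots> \<le> (1 + 2 / a) * exp (a / 2 * y)" using a by (intro mult_left_mono exp_ge_add_one_self) auto
        finally have y2: "(1 + y) * exp (- a * y) \<le> (1 + 2 / a) * exp (a / 2 * y) * exp (- a * y)"
          by (intro mult_right_mono) auto
        have "norm (F n y) = exp (- a * y) * (real n powr (- e) * G b (real n - y))"
          using True G_nonneg[of b "real n - y"] by (simp add: F_def abs_mult)
        also have "\<dots> \<le> exp (- a * y) * ((1 + y) * (1 / b + K (1 / b)))"
          by (intro mult_left_mono scaled_G_shift_le b y) auto
        also have "\<dots> = ((1 + y) * exp (- a * y)) * (1 / b + K (1 / b))" by simp
        also have "\<dots> \<le> ((1 + 2 / a) * exp (a / 2 * y) * exp (- a * y)) * (1 / b + K (1 / b))"
          using b K by (intro mult_right_mono y2) auto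
        also have "\<dots> = c * (exp (a / 2 * y) * exp (- a * y))" by (simp add: c_def)
        also have "exp (a / 2 * y) * exp (- a * y) = exp (- (a / 2) * y)"
          unfolding exp_add[symmetric] by (rule arg_cong[where f=exp]) (simp add: field_simps)
        finally show ?thesis using y by simp
      next
        case False
        then show ?thesis using a b K by (auto simp: F_def c_def indicator_def intro!: mult_nonneg_nonneg add_nonneg_nonneg)
      qed
    qed
  qed (use h1 h2 in \<open>auto simp: has_bochner_integral_iff\<close>)
  moreover have "(LINT y|lborel. F n y) = real n powr (- e) * (exp (- a * real n) * J a b (real n))" for n
    unfolding scaled_J F_def by simp
  moreover have "(LINT y|lborel. (indicator {0..} y * exp (- a * y)) * (1 / b)) = 1 / (a * b)"
    using h1 by (simp add: has_bochner_integral_iff)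
  ultimately show ?thesis by simp
qed

text \<open>Needed because the estimators divide by these integrals. The integrand of
  \<open>G\<close> is bounded below on -1 < v < 0, uniformly for u in [0, x].\<close>

lemma J_pos:
  assumes a: "a > 0" and b: "b > 0" and x: "x > 0"
  shows "J a b x > 0"
proof -
  \<comment> \<open>For -1 < v < 0 and u \<le> x one has exp (b v) \<ge> exp (-b) and u - v \<le> x
    + 1, and the power decreases since e < 0.\<close>
  define c where "c = exp (- b) * (x + 1) powr e"
  have c: "c > 0" using x by (simp add: c_def)
  have G: "c \<le> G b u" if u: "u \<in> {0..x}" for u
  proof -
    have "c = (LINT v|lborel. indicator {-1<..<0::real} v * c)" by simp
    also have "\<dots> \<le> (LINT v|lborel. indicator {..0} v * (exp (b * v) * (u - v) powr e))"
    proof (rule integral_mono)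
      show "integrable lborel (\<lambda>v. indicator {..0} v * (exp (b * v) * (u - v) powr e))"
        using G_integrable[OF b, of u] u by simp
      show "indicator {-1<..<0} v * c \<le> indicator {..0} v * (exp (b * v) * (u - v) powr e)" for v
      proof (cases "v \<in> {-1<..<0}")
        case True
        have "exp (- b) \<le> exp (b * v)" using True b by (simp add: algebra_simps) (metis less_imp_le mult_less_cancel_left_pos mult_minus_right mult.right_neutral)
        moreover have "(x + 1) powr e \<le> (u - v) powr e"
          using True u e by (intro powr_mono2') auto
        ultimately show ?thesis using True unfolding c_def by (auto intro!: mult_mono)
      qed auto
    qed auto
    also have "\<dots> = G b u" by (simp add: G_def set_lebesgue_integral_def)
    finally show ?thesis .
  qed
  have "x * c = (LINT u|lborel. indicator {0..x} u * c)" using x by simp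
  also have "\<dots> \<le> (LINT u|lborel. indicator {0..x} u * (exp (a * u) * G b u))"
  proof (rule integral_mono)
    show "integrable lborel (\<lambda>u. indicator {0..x} u * (exp (a * u) * G b u))"
    proof (rule Bochner_Integration.integrable_bound)
      show "integrable lborel (\<lambda>u. indicator {0..x} u * (exp (a * x) * K (1 / b)))" using x by auto
      show "AE u in lborel. norm (indicator {0..x} u * (exp (a * u) * G b u)) \<le> norm (indicator {0..x} u * (exp (a * x) * K (1 / b)))"
        using G_le_K[OF b] G_nonneg[of b] a by (intro AE_I2) (auto simp: indicator_def abs_mult intro!: mult_mono order_trans[OF _ abs_ge_self])
    qed measurable
    show "indicator {0..x} u * c \<le> indicator {0..x} u * (exp (a * u) * G b u)" for u
    proof (cases "u \<in> {0..x}")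
      case True
      have "c \<le> 1 * G b u" using G[OF True] by simp
      also have "\<dots> \<le> exp (a * u) * G b u" using True a by (intro mult_right_mono G_nonneg) auto
      finally show ?thesis using True by simp
    qed auto
  qed (use x in auto)
  also have "\<dots> = J a b x" by (simp add: J_def set_lebesgue_integral_def)
  finally show ?thesis using x c by (metis less_le_trans mult_pos_pos)
qed

end

context power_kernel
begin

text \<open>The contribution of the simultaneous covariance is exponentially small, so the
  polynomial tail is that of \<open>J\<close> and has a coefficient proportional to B.\<close>

lemma \<Phi>_expdecay_tendsto:
  assumes a: "a > 0" and b: "b > 0"
  shows "(\<lambda>n. real n powr (- e) * \<Phi> (expdecay a (real n)) (expdecay b 0)) \<longlonglongrightarrow> B / (a * b)"
proof -
  interpret T: power_tail e by unfold_locales (use e in auto)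
  have J: "T.J a b x = J a b x" for x by (simp add: T.J_def J_def T.G_def G_def)
  let ?c = "\<Phi> (expdecay a 0) (expdecay b 0)"
  have "(\<lambda>n. (real n powr (- e) * exp (- a * real n)) * ?c + B * (real n powr (- e) * (exp (- a * real n) * J a b (real n)))) \<longlonglongrightarrow> 0 * ?c + B * (1 / (a * b))"
  proof (intro tendsto_intros)
    show "(\<lambda>n. real n powr (- e) * exp (- a * real n)) \<longlonglongrightarrow> 0" using a by real_asymp
    show "(\<lambda>n. real n powr (- e) * (exp (- a * real n) * J a b (real n))) \<longlonglongrightarrow> 1 / (a * b)"
      using T.J_tendsto[OF a b] J by simp
  qed
  moreover have "(real n powr (- e) * exp (- a * real n)) * ?c + B * (real n powr (- e) * (exp (- a * real n) * J a b (real n)))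
    = real n powr (- e) * \<Phi> (expdecay a (real n)) (expdecay b 0)" for n
    unfolding \<Phi>_decompose[OF a b of_nat_0_le_iff] by (simp add: algebra_simps)
  ultimately show ?thesis by simp
qed

lemma J_positive: "a > 0 \<Longrightarrow> b > 0 \<Longrightarrow> x > 0 \<Longrightarrow> J a b x > 0"
proof -
  interpret T: power_tail e by unfold_locales (use e in auto)
  show "a > 0 \<Longrightarrow> b > 0 \<Longrightarrow> x > 0 \<Longrightarrow> J a b x > 0"
    using T.J_pos[of a b x] by (simp add: T.J_def J_def T.G_def G_def)
qed

end

section \<open>The covariance of the Ornstein--Uhlenbeck process\<close>

text \<open>Cells are numbered downwards from the right end t, which stays fixed while the lower
  limit recedes; each tag is the left end of its cell.\<close>

definition left_cells :: "real \<Rightarrow> real \<Rightarrow> nat \<Rightarrow> (real \<times> real set) set" where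
  "left_cells t d J = (\<lambda>j. (t - real (Suc j) * d, {t - real (Suc j) * d..t - real j * d})) ` {..<J}"

lemma left_cells_Union:
  assumes d: "d > 0"
  shows "(\<Union>j<Suc J. {t - real (Suc j) * d..t - real j * d}) = {t - real (Suc J) * d..t}"
proof (induction J)
  case 0
  then show ?case by (simp add: lessThan_Suc)
next
  case (Suc J)
  have "(\<Union>j<Suc (Suc J). {t - real (Suc j) * d..t - real j * d}) = {t - real (Suc (Suc J)) * d..t - real (Suc J) * d} \<union> {t - real (Suc J) * d..t}"
    unfolding Suc[symmetric] by (simp only: lessThan_Suc[of "Suc J"] UN_insert)
  also have "\<dots> = {t - real (Suc (Suc J)) * d..t}"
    using d by (intro ivl_disj_un_two_touch) (auto simp: algebra_simps)
  finally show ?case .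
qed

lemma left_cells_tagged_division:
  assumes d: "d > 0" and J: "J > 0"
  shows "left_cells t d J tagged_division_of {t - real J * d..t}"
proof (rule tagged_division_ofI)
  obtain J' where J': "J = Suc J'" using J gr0_conv_Suc by auto
  have U: "(\<Union>j<J. {t - real (Suc j) * d..t - real j * d}) = {t - real J * d..t}"
    unfolding J' by (rule left_cells_Union[OF d])
  show "finite (left_cells t d J)" by (simp add: left_cells_def)
  fix x k assume xk: "(x, k) \<in> left_cells t d J"
  then obtain j where j: "j < J" "x = t - real (Suc j) * d" "k = {t - real (Suc j) * d..t - real j * d}"
    unfolding left_cells_def by auto
  show "x \<in> k" unfolding j using d by (simp add: algebra_simps)
  show "k \<subseteq> {t - real J * d..t}" unfolding U[symmetric] j(3) using j(1) by blast
  show "\<exists>a b. k = cbox a b" unfolding j(3) by (metis interval_cbox)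
  fix x' k' assume xk': "(x', k') \<in> left_cells t d J" and ne: "(x, k) \<noteq> (x', k')"
  then obtain j' where j': "j' < J" "x' = t - real (Suc j') * d" "k' = {t - real (Suc j') * d..t - real j' * d}"
    unfolding left_cells_def by auto
  have "j \<noteq> j'" using ne j j' by auto
  have *: "{t - real (Suc i) * d<..<t - real i * d} \<inter> {t - real (Suc i') * d<..<t - real i' * d} = {}" if "i < i'" for i i'
  proof -
    have "real (Suc i) * d \<le> real i' * d" using that d by (intro mult_right_mono) auto
    then show ?thesis by auto
  qed
  from \<open>j \<noteq> j'\<close> consider "j < j'" | "j' < j" by linarith
  then show "interior k \<inter> interior k' = {}"
    unfolding j(3) j'(3) interior_atLeastAtMost_real using * by cases blast+
next
  obtain J' where J': "J = Suc J'" using J gr0_conv_Suc by auto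
  show "\<Union> {k. \<exists>x. (x, k) \<in> left_cells t d J} = {t - real J * d..t}"
  proof -
    have "{k. \<exists>x. (x, k) \<in> left_cells t d J} = (\<lambda>j. {t - real (Suc j) * d..t - real j * d}) ` {..<J}"
      unfolding left_cells_def by (auto simp del: of_nat_Suc)
    then show ?thesis using left_cells_Union[OF d, of t J'] unfolding J' by (simp only:)
  qed
qed

lemma has_RS_integral_left_sums:
  assumes "has_RS_integral f g (t - real (Suc m)) t I"
  shows "(\<lambda>N. \<Sum>j<Suc m * Suc N. f (t - real (Suc j) * (1 / real (Suc N))) *
    (g (t - real j * (1 / real (Suc N))) - g (t - real (Suc j) * (1 / real (Suc N))))) \<longlonglongrightarrow> I"
proof (rule LIMSEQ_I)
  fix r :: real assume "r > 0"
  then obtain d where d: "d > 0" and D: "\<And>p. p tagged_division_of {t - real (Suc m)..t} \<Longrightarrow> (\<forall>(x, k)\<in>p. Sup k - Inf k < d) \<Longrightarrow>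
      \<bar>(\<Sum>(x, k)\<in>p. f x * (g (Sup k) - g (Inf k))) - I\<bar> < r"
    using assms unfolding has_RS_integral_def by meson
  obtain N0 where N0: "inverse (real (Suc N0)) < d" using reals_Archimedean[OF d] by blast
  show "\<exists>no. \<forall>N\<ge>no. norm ((\<Sum>j<Suc m * Suc N. f (t - real (Suc j) * (1 / real (Suc N))) *
    (g (t - real j * (1 / real (Suc N))) - g (t - real (Suc j) * (1 / real (Suc N))))) - I) < r"
  proof (intro exI allI impI)
    fix N assume N: "N \<ge> N0"
    define \<delta> where "\<delta> = 1 / real (Suc N)"
    have \<delta>: "\<delta> > 0" "\<delta> < d"
    proof -
      show "\<delta> > 0" by (simp add: \<delta>_def)
      have "\<delta> \<le> inverse (real (Suc N0))" using N by (simp add: \<delta>_def inverse_eq_divide frac_le)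
      then show "\<delta> < d" using N0 by simp
    qed
    let ?J = "Suc m * Suc N"
    have J: "real ?J * \<delta> = real (Suc m)"
      unfolding of_nat_mult \<delta>_def by (simp only: times_divide_eq_right mult_1_right) (rule nonzero_mult_div_cancel_right, simp)
    have le: "t - real (Suc j) * \<delta> \<le> t - real j * \<delta>" for j using \<delta> by (simp add: algebra_simps)
    have "left_cells t \<delta> ?J tagged_division_of {t - real (Suc m)..t}"
      using left_cells_tagged_division[OF \<delta>(1), of ?J t] unfolding J by simp
    moreover have "\<forall>(x, k)\<in>left_cells t \<delta> ?J. Sup k - Inf k < d"
    proof (clarsimp simp: left_cells_def simp del: of_nat_Suc)
      fix j
      show "Sup {t - real (Suc j) * \<delta>..t - real j * \<delta>} - Inf {t - real (Suc j) * \<delta>..t - real j * \<delta>} < d"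
        using le[of j] \<delta> by (simp add: algebra_simps)
    qed
    ultimately have "\<bar>(\<Sum>(x, k)\<in>left_cells t \<delta> ?J. f x * (g (Sup k) - g (Inf k))) - I\<bar> < r" by (rule D)
    moreover have "(\<Sum>(x, k)\<in>left_cells t \<delta> ?J. f x * (g (Sup k) - g (Inf k))) =
      (\<Sum>j<?J. f (t - real (Suc j) * \<delta>) * (g (t - real j * \<delta>) - g (t - real (Suc j) * \<delta>)))"
      unfolding left_cells_def
    proof (subst sum.reindex)
      show "inj_on (\<lambda>j. (t - real (Suc j) * \<delta>, {t - real (Suc j) * \<delta>..t - real j * \<delta>})) {..<?J}"
        using \<delta> by (auto simp: inj_on_def)
    qed (use le in \<open>simp add: o_def del: of_nat_Suc\<close>)
    ultimately show "norm ((\<Sum>j<?J. f (t - real (Suc j) * (1 / real (Suc N))) *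
      (g (t - real j * (1 / real (Suc N))) - g (t - real (Suc j) * (1 / real (Suc N))))) - I) < r"
      by (simp add: \<delta>_def)
  qed
qed

text \<open>With h = e + 2 the coefficients carry the factor h (h - 1) that two integrations divide
  out, so that \<open>W\<close> reproduces the terms of the fractional covariance, including the
  sign convention on both half lines.\<close>

lemma (in power_kernel) W_eq:
  assumes "A = (e + 2) * (e + 1) * (r - y) / 2" "B = (e + 2) * (e + 1) * (r + y) / 2"
  shows "W x = (r - sign1 x * y) * \<bar>x\<bar> powr (e + 2) / 2"
proof -
  have "(e + 2) * (e + 1) \<noteq> 0" using e by auto
  then have c: "((e + 2) * (e + 1) * z / 2) / ((e + 1) * (e + 2)) = z / 2" for z by (simp add: field_simps)
  show ?thesis
  proof (cases "x \<ge> 0")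
    case True
    then have "W x = A * x powr (e + 2) / ((e + 1) * (e + 2))"
      by (simp add: W_def pospow_pos pospow_nonpos)
    also have "A * x powr (e + 2) = (e + 2) * (e + 1) * ((r - y) * x powr (e + 2)) / 2"
      unfolding assms(1) by simp
    finally show ?thesis using True unfolding c by (simp add: sign1_def)
  next
    case False
    then have "W x = B * (- x) powr (e + 2) / ((e + 1) * (e + 2))"
      by (simp add: W_def pospow_pos pospow_nonpos)
    also have "B * (- x) powr (e + 2) = (e + 2) * (e + 1) * ((r + y) * (- x) powr (e + 2)) / 2"
      unfolding assms(2) by simp
    finally show ?thesis using False unfolding c by (simp add: sign1_def)
  qed
qed

section \<open>The process as an iterated almost sure limit of Riemann--Stieltjes sums\<close>

locale bivariate_fou = prob_space M for M :: "'a measure" +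
  fixes H \<alpha> \<nu> :: "nat \<Rightarrow> real" and \<rho> :: real and \<eta> :: "nat \<Rightarrow> nat \<Rightarrow> real"
    and B Y :: "nat \<Rightarrow> real \<Rightarrow> 'a \<Rightarrow> real"
  assumes H_bounds: "\<And>i. i \<in> {1, 2} \<Longrightarrow> 1 / 2 < H i \<and> H i < 1"
    and H_sum: "H 1 + H 2 = 3 / 2"
    and pos: "\<And>i. i \<in> {1, 2} \<Longrightarrow> \<alpha> i > 0 \<and> \<nu> i > 0"
    and fBm: "bivariate_fBm M H \<rho> \<eta> B"
    and fOU: "bivariate_fOU M \<alpha> \<nu> B Y"
begin

abbreviation "idx \<equiv> {1, 2::nat} \<times> (UNIV :: real set)"

definition h :: "nat \<Rightarrow> nat \<Rightarrow> real" where "h i j = H i + H j"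
text \<open>With the values 1 and 0 of \<open>rr\<close> and \<open>ee\<close> on the diagonal,
  where \<open>h i i\<close> is 2 * H i, one formula covers the marginal and the cross
  covariances.\<close>

definition rr :: "nat \<Rightarrow> nat \<Rightarrow> real" where "rr i j = (if i = j then 1 else \<rho>)"
definition ee :: "nat \<Rightarrow> nat \<Rightarrow> real" where "ee i j = (if i = j then 0 else \<eta> i j)"
definition kA :: "nat \<Rightarrow> nat \<Rightarrow> real" where "kA i j = h i j * (h i j - 1) * (rr i j - ee i j) / 2"
definition kB :: "nat \<Rightarrow> nat \<Rightarrow> real" where "kB i j = h i j * (h i j - 1) * (rr i j + ee i j) / 2"

lemma power_kernel_ij: "i \<in> {1, 2} \<Longrightarrow> j \<in> {1, 2} \<Longrightarrow> power_kernel (h i j - 2)"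
  using H_bounds[of i] H_bounds[of j] by unfold_locales (auto simp: h_def)

lemma B_gaussian: "centered_gaussian_process M idx (\<lambda>(i, t). B i t)"
  using fBm by (simp add: bivariate_fBm_def)

lemma B_integrable:
  assumes "i \<in> {1, 2}" "j \<in> {1, 2}" shows "integrable M (\<lambda>\<omega>. B i t \<omega> * B j s \<omega>)"
  using centered_gaussian_process_polarize(2)[OF B_gaussian, of "(i, t)" "(j, s)"] assms by auto

lemma B_covariance:
  assumes i: "i \<in> {1, 2}" and j: "j \<in> {1, 2}"
  defines "W \<equiv> power_kernel.W (h i j - 2) (kA i j) (kB i j)"
  shows "expectation (\<lambda>\<omega>. B i t \<omega> * B j s \<omega>) = W (- t) + W s - W (s - t)"
proof -
  interpret K: power_kernel "h i j - 2" "kA i j" "kB i j" by (rule power_kernel_ij[OF i j])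
  have W: "W x = (rr i j - sign1 x * ee i j) * \<bar>x\<bar> powr h i j / 2" for x
    using K.W_eq[of "rr i j" "ee i j" x] unfolding W_def by (simp add: kA_def kB_def)
  show ?thesis
  proof (cases "i = j")
    case True
    have "fractional_brownian_motion M (H i) (B i)" "variance (B i 1) = 1"
      using fBm i unfolding bivariate_fBm_def by blast+
    then have "expectation (\<lambda>\<omega>. B i t \<omega> * B i s \<omega>) = 1 / 2 * (\<bar>t\<bar> powr (2 * H i) + \<bar>s\<bar> powr (2 * H i) - \<bar>t - s\<bar> powr (2 * H i))"
      unfolding fractional_brownian_motion_def by simp
    then show ?thesis unfolding W True using True
      by (simp add: rr_def ee_def h_def abs_minus_commute[of s t] field_simps)
  next
    case False
    have "expectation (\<lambda>\<omega>. B i t \<omega> * B j s \<omega>) =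
          1 / 2 * ((\<rho> + sign1 t * \<eta> i j) * \<bar>t\<bar> powr (H 1 + H 2)
                 + (\<rho> - sign1 s * \<eta> i j) * \<bar>s\<bar> powr (H 1 + H 2)
                 - (\<rho> - sign1 (s - t) * \<eta> i j) * \<bar>s - t\<bar> powr (H 1 + H 2))"
      using fBm i j False unfolding bivariate_fBm_def by blast
    moreover have "h i j = H 1 + H 2" using i j False by (auto simp: h_def)
    \<comment> \<open>\<open>sign1\<close> fails to be odd only at 0, where the power of t
      vanishes.\<close>
    moreover have "(\<rho> - sign1 (- t) * \<eta> i j) * \<bar>t\<bar> powr (H 1 + H 2) = (\<rho> + sign1 t * \<eta> i j) * \<bar>t\<bar> powr (H 1 + H 2)"
      by (cases "t = 0") (auto simp: sign1_def)
    ultimately show ?thesis unfolding W using False by (simp add: rr_def ee_def field_simps)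
  qed
qed

lemma B_increment_covariance:
  assumes i: "i \<in> {1, 2}" and j: "j \<in> {1, 2}" and t: "t \<le> t'" and s: "s \<le> s'"
  shows "expectation (\<lambda>\<omega>. (B i t' \<omega> - B i t \<omega>) * (B j s' \<omega> - B j s \<omega>)) =
    power_kernel.\<Phi> (h i j - 2) (kA i j) (kB i j) (indicator {t<..t'}) (indicator {s<..s'})"
proof -
  interpret K: power_kernel "h i j - 2" "kA i j" "kB i j" by (rule power_kernel_ij[OF i j])
  have "expectation (\<lambda>\<omega>. (B i t' \<omega> - B i t \<omega>) * (B j s' \<omega> - B j s \<omega>)) =
    expectation (\<lambda>\<omega>. B i t' \<omega> * B j s' \<omega> - B i t' \<omega> * B j s \<omega> - B i t \<omega> * B j s' \<omega> + B i t \<omega> * B j s \<omega>)"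
    by (simp add: algebra_simps)
  also have "\<dots> = expectation (\<lambda>\<omega>. B i t' \<omega> * B j s' \<omega>) - expectation (\<lambda>\<omega>. B i t' \<omega> * B j s \<omega>) - expectation (\<lambda>\<omega>. B i t \<omega> * B j s' \<omega>) + expectation (\<lambda>\<omega>. B i t \<omega> * B j s \<omega>)"
    using B_integrable[OF i j] by simp
  also have "\<dots> = K.\<Phi> (indicator {t<..t'}) (indicator {s<..s'})"
    unfolding B_covariance[OF i j] K.\<Phi>_indicator[OF t s] by simp
  finally show ?thesis .
qed

text \<open>Left-point sums over [t - (m + 1), t] with mesh 1 / (N + 1); the shifts by one exclude
  empty partitions and division by zero.\<close>

definition RSsum :: "nat \<Rightarrow> nat \<Rightarrow> nat \<times> real \<Rightarrow> 'a \<Rightarrow> real" where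
  "RSsum m N = (\<lambda>(i, t) \<omega>. \<nu> i * (\<Sum>l<Suc m * Suc N. exp (- \<alpha> i * (real (Suc l) * (1 / real (Suc N)))) *
    (B i (t - real l * (1 / real (Suc N))) \<omega> - B i (t - real (Suc l) * (1 / real (Suc N))) \<omega>)))"

lemma RSsum_gaussian: "centered_gaussian_process M idx (RSsum m N)"
proof -
  \<comment> \<open>The Boolean selects an end point of the increment: true for the upper one with
    sign +1, false for the lower one with sign -1.\<close>
  define I where "I p = {..<Suc m * Suc N} \<times> (UNIV :: bool set)" for p :: "nat \<times> real"
  define a where "a p x = (if snd x then 1 else -1) * (\<nu> (fst p) * exp (- \<alpha> (fst p) * (real (Suc (fst x)) * (1 / real (Suc N)))))" for p :: "nat \<times> real" and x :: "nat \<times> bool"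
  define q where "q p x = (fst p, snd p - (if snd x then real (fst x) else real (Suc (fst x))) * (1 / real (Suc N)))" for p :: "nat \<times> real" and x :: "nat \<times> bool"
  have "centered_gaussian_process M idx (\<lambda>p \<omega>. \<Sum>x\<in>I p. a p x * (case q p x of (i, t) \<Rightarrow> B i t) \<omega>)"
    by (rule centered_gaussian_process_linear[OF B_gaussian]) (auto simp: I_def q_def)
  moreover have "(\<Sum>x\<in>I p. a p x * (case q p x of (i, t) \<Rightarrow> B i t) \<omega>) = RSsum m N p \<omega>" for p \<omega>
    unfolding I_def RSsum_def sum.cartesian_product' split_def sum_distrib_left
    by (rule sum.cong[OF refl]) (simp add: UNIV_bool a_def q_def right_diff_distrib mult.assoc del: of_nat_Suc)
  ultimately show ?thesis by simp
qed

lemma RSsum_covariance: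
  assumes i: "i \<in> {1, 2}" and j: "j \<in> {1, 2}"
  shows "expectation (\<lambda>\<omega>. RSsum m N (i, t) \<omega> * RSsum m N (j, s) \<omega>) = \<nu> i * \<nu> j *
    power_kernel.\<Phi> (h i j - 2) (kA i j) (kB i j) (stepdecay (\<alpha> i) t (1 / real (Suc N)) (Suc m * Suc N)) (stepdecay (\<alpha> j) s (1 / real (Suc N)) (Suc m * Suc N))"
proof -
  interpret K: power_kernel "h i j - 2" "kA i j" "kB i j" by (rule power_kernel_ij[OF i j])
  define d where "d = 1 / real (Suc N)"
  define J where "J = Suc m * Suc N"
  have d: "d > 0" by (simp add: d_def)
  have le: "t - real (Suc l) * d \<le> t - real l * d" for l t using d by (simp add: algebra_simps)
  define c where "c i l = exp (- \<alpha> i * (real (Suc l) * d))" for i l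
  define D where "D i t l \<omega> = B i (t - real l * d) \<omega> - B i (t - real (Suc l) * d) \<omega>" for i t l \<omega>
  have RS: "RSsum m N (i, t) \<omega> = \<nu> i * (\<Sum>l<J. c i l * D i t l \<omega>)" for i t \<omega>
    by (simp add: RSsum_def d_def J_def c_def D_def)
  have int: "integrable M (\<lambda>\<omega>. D i t l \<omega> * D j s l' \<omega>)" for l l'
  proof -
    have "D i t l \<omega> * D j s l' \<omega> = B i (t - real l * d) \<omega> * B j (s - real l' * d) \<omega> - B i (t - real l * d) \<omega> * B j (s - real (Suc l') * d) \<omega>
      - B i (t - real (Suc l) * d) \<omega> * B j (s - real l' * d) \<omega> + B i (t - real (Suc l) * d) \<omega> * B j (s - real (Suc l') * d) \<omega>" for \<omega>
      unfolding D_def by (simp add: left_diff_distrib right_diff_distrib)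
    then show ?thesis using B_integrable[OF i j] by simp
  qed
  have "expectation (\<lambda>\<omega>. RSsum m N (i, t) \<omega> * RSsum m N (j, s) \<omega>) =
    expectation (\<lambda>\<omega>. \<Sum>l<J. \<Sum>l'<J. (\<nu> i * \<nu> j * (c i l * c j l')) * (D i t l \<omega> * D j s l' \<omega>))"
  proof (rule Bochner_Integration.integral_cong[OF refl])
    fix \<omega>
    have "RSsum m N (i, t) \<omega> * RSsum m N (j, s) \<omega> = \<nu> i * \<nu> j * ((\<Sum>l<J. c i l * D i t l \<omega>) * (\<Sum>l<J. c j l * D j s l \<omega>))"
      unfolding RS by simp
    also have "\<dots> = (\<Sum>l<J. \<Sum>l'<J. (\<nu> i * \<nu> j * (c i l * c j l')) * (D i t l \<omega> * D j s l' \<omega>))"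
      by (simp only: sum_product) (simp only: sum_distrib_left mult_ac)
    finally show "RSsum m N (i, t) \<omega> * RSsum m N (j, s) \<omega> = (\<Sum>l<J. \<Sum>l'<J. (\<nu> i * \<nu> j * (c i l * c j l')) * (D i t l \<omega> * D j s l' \<omega>))" .
  qed
  also have "\<dots> = (\<Sum>l<J. \<Sum>l'<J. (\<nu> i * \<nu> j * (c i l * c j l')) * expectation (\<lambda>\<omega>. D i t l \<omega> * D j s l' \<omega>))"
    using int by (simp add: Bochner_Integration.integral_sum)
  also have "\<dots> = (\<Sum>l<J. \<Sum>l'<J. (\<nu> i * \<nu> j * (c i l * c j l')) *
      K.\<Phi> (indicator {t - real (Suc l) * d<..t - real l * d}) (indicator {s - real (Suc l') * d<..s - real l' * d}))"
    unfolding D_def by (intro sum.cong refl arg_cong2[where f="(*)"] B_increment_covariance i j le)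
  also have "\<dots> = \<nu> i * \<nu> j * (\<Sum>l<J. \<Sum>l'<J. c i l * c j l' *
      K.\<Phi> (indicator {t - real (Suc l) * d<..t - real l * d}) (indicator {s - real (Suc l') * d<..s - real l' * d}))"
    by (simp only: sum_distrib_left mult.assoc)
  also have "(\<Sum>l<J. \<Sum>l'<J. c i l * c j l' *
      K.\<Phi> (indicator {t - real (Suc l) * d<..t - real l * d}) (indicator {s - real (Suc l') * d<..s - real l' * d}))
    = K.\<Phi> (stepdecay (\<alpha> i) t d J) (stepdecay (\<alpha> j) s d J)"
    unfolding stepdecay_def[abs_def] c_def by (intro K.\<Phi>_sum[symmetric] tame_indicator)
  finally show ?thesis unfolding d_def J_def .
qed

text \<open>Taking \<open>lim\<close> of the sums gives a function that is measurable and defined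
  for every outcome; almost surely it is \<nu> i times the integral over [t - (m + 1), t].\<close>

definition RSlim :: "nat \<Rightarrow> nat \<times> real \<Rightarrow> 'a \<Rightarrow> real" where
  "RSlim m p \<omega> = lim (\<lambda>N. RSsum m N p \<omega>)"

lemma RS_limits:
  assumes i: "i \<in> {1, 2}"
  shows "AE \<omega> in M. (\<lambda>N. RSsum m N (i, t) \<omega>) \<longlonglongrightarrow> RSlim m (i, t) \<omega>"
    and "AE \<omega> in M. (\<lambda>m. RSlim m (i, t) \<omega>) \<longlonglongrightarrow> Y i t \<omega>"
proof -
  have "AE \<omega> in M. \<exists>I. has_RS_integral_lower (\<lambda>u. exp (- \<alpha> i * (t - u))) (\<lambda>u. B i u \<omega>) t I \<and> Y i t \<omega> = \<nu> i * I"
    using fOU i unfolding bivariate_fOU_def by (auto elim: AE_mp)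
  then have "AE \<omega> in M. (\<forall>m. (\<lambda>N. RSsum m N (i, t) \<omega>) \<longlonglongrightarrow> RSlim m (i, t) \<omega>) \<and> (\<lambda>m. RSlim m (i, t) \<omega>) \<longlonglongrightarrow> Y i t \<omega>"
  proof eventually_elim
    case (elim \<omega>)
    then obtain F I where F: "\<And>a. a \<le> t \<Longrightarrow> has_RS_integral (\<lambda>u. exp (- \<alpha> i * (t - u))) (\<lambda>u. B i u \<omega>) a t (F a)"
      and I: "(F \<longlongrightarrow> I) at_bot" and Y: "Y i t \<omega> = \<nu> i * I"
      unfolding has_RS_integral_lower_def by blast
    have lim: "(\<lambda>N. RSsum m N (i, t) \<omega>) \<longlonglongrightarrow> \<nu> i * F (t - real (Suc m))" for m
    proof -
      have "has_RS_integral (\<lambda>u. exp (- \<alpha> i * (t - u))) (\<lambda>u. B i u \<omega>) (t - real (Suc m)) t (F (t - real (Suc m)))"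
        by (rule F) simp
      from tendsto_mult[OF tendsto_const has_RS_integral_left_sums[OF this], of "\<nu> i"]
      show ?thesis unfolding RSsum_def by (simp del: of_nat_Suc sum.lessThan_Suc mult_Suc mult_Suc_right)
    qed
    then have eq: "RSlim m (i, t) \<omega> = \<nu> i * F (t - real (Suc m))" for m
      unfolding RSlim_def by (rule limI)
    have "filterlim (\<lambda>m. t - real (Suc m)) at_bot sequentially" by real_asymp
    then have "(\<lambda>m. F (t - real (Suc m))) \<longlonglongrightarrow> I" by (rule filterlim_compose[OF I])
    then have "(\<lambda>m. RSlim m (i, t) \<omega>) \<longlonglongrightarrow> Y i t \<omega>" unfolding eq Y by (intro tendsto_intros)
    then show ?case using lim eq by simp
  qed
  then show "AE \<omega> in M. (\<lambda>N. RSsum m N (i, t) \<omega>) \<longlonglongrightarrow> RSlim m (i, t) \<omega>"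
    "AE \<omega> in M. (\<lambda>m. RSlim m (i, t) \<omega>) \<longlonglongrightarrow> Y i t \<omega>" by (auto elim: AE_mp)
qed

lemma RSlim_measurable: "p \<in> idx \<Longrightarrow> RSlim m p \<in> borel_measurable M"
  unfolding RSlim_def[abs_def] using centered_gaussian_processD(1)[OF RSsum_gaussian]
  by (intro borel_measurable_lim_metric) auto

lemma RSlim_gaussian: "centered_gaussian_process M idx (RSlim m)"
  using RS_limits(1) by (intro AE_limit_centered_gaussian_process(1)[where X="RSsum m" and Z="RSlim m", OF RSsum_gaussian RSlim_measurable]) auto

lemma Y_measurable: "i \<in> {1, 2} \<Longrightarrow> Y i t \<in> borel_measurable M"
  using fOU unfolding bivariate_fOU_def by blast

lemma Y_gaussian: "centered_gaussian_process M idx (\<lambda>(i, t). Y i t)"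
  using RS_limits(2) Y_measurable by (intro AE_limit_centered_gaussian_process(1)[where X=RSlim, OF RSlim_gaussian]) auto

lemma RSlim_covariance:
  assumes i: "i \<in> {1, 2}" and j: "j \<in> {1, 2}"
  shows "expectation (\<lambda>\<omega>. RSlim m (i, t) \<omega> * RSlim m (j, s) \<omega>) = \<nu> i * \<nu> j *
    power_kernel.\<Phi> (h i j - 2) (kA i j) (kB i j) (\<lambda>u. indicator {t - real (Suc m)<..t} u * expdecay (\<alpha> i) t u) (\<lambda>u. indicator {s - real (Suc m)<..s} u * expdecay (\<alpha> j) s u)"
proof (rule LIMSEQ_unique)
  interpret K: power_kernel "h i j - 2" "kA i j" "kB i j" by (rule power_kernel_ij[OF i j])
  have ai: "\<alpha> i > 0" and aj: "\<alpha> j > 0" using pos i j by auto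
  show "(\<lambda>N. expectation (\<lambda>\<omega>. RSsum m N (i, t) \<omega> * RSsum m N (j, s) \<omega>)) \<longlonglongrightarrow> expectation (\<lambda>\<omega>. RSlim m (i, t) \<omega> * RSlim m (j, s) \<omega>)"
    using RS_limits(1) i j by (intro AE_limit_centered_gaussian_process(2)[where X="RSsum m" and Z="RSlim m", OF RSsum_gaussian RSlim_measurable]) auto
  show "(\<lambda>N. expectation (\<lambda>\<omega>. RSsum m N (i, t) \<omega> * RSsum m N (j, s) \<omega>)) \<longlonglongrightarrow> \<nu> i * \<nu> j *
    K.\<Phi> (\<lambda>u. indicator {t - real (Suc m)<..t} u * expdecay (\<alpha> i) t u) (\<lambda>u. indicator {s - real (Suc m)<..s} u * expdecay (\<alpha> j) s u)"
    unfolding RSsum_covariance[OF i j]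
    by (intro tendsto_mult tendsto_const K.\<Phi>_tendsto[OF tame_expdecay[OF ai, of t] tame_expdecay[OF aj, of s]]
        stepdecay_measurable stepdecay_nonneg stepdecay_le_expdecay stepdecay_tendsto ai aj) auto
qed

text \<open>The covariances on the truncated intervals have two limits that must agree: almost sure
  convergence of Gaussian families carries them to the covariance of Y, and dominated convergence
  carries the double integrals to the one over the full half lines.\<close>

lemma Y_covariance:
  assumes i: "i \<in> {1, 2}" and j: "j \<in> {1, 2}"
  shows "expectation (\<lambda>\<omega>. Y i t \<omega> * Y j s \<omega>) = \<nu> i * \<nu> j *
    power_kernel.\<Phi> (h i j - 2) (kA i j) (kB i j) (expdecay (\<alpha> i) t) (expdecay (\<alpha> j) s)"
proof (rule LIMSEQ_unique)
  interpret K: power_kernel "h i j - 2" "kA i j" "kB i j" by (rule power_kernel_ij[OF i j])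
  have ai: "\<alpha> i > 0" and aj: "\<alpha> j > 0" using pos i j by auto
  have "(\<lambda>m. expectation (\<lambda>\<omega>. RSlim m (i, t) \<omega> * RSlim m (j, s) \<omega>)) \<longlonglongrightarrow> expectation (\<lambda>\<omega>. (case (i, t) of (i, t) \<Rightarrow> Y i t) \<omega> * (case (j, s) of (i, t) \<Rightarrow> Y i t) \<omega>)"
    using RS_limits(2) i j Y_measurable by (intro AE_limit_centered_gaussian_process(2)[where X=RSlim, OF RSlim_gaussian]) auto
  then show "(\<lambda>m. expectation (\<lambda>\<omega>. RSlim m (i, t) \<omega> * RSlim m (j, s) \<omega>)) \<longlonglongrightarrow> expectation (\<lambda>\<omega>. Y i t \<omega> * Y j s \<omega>)"
    by simp
  show "(\<lambda>m. expectation (\<lambda>\<omega>. RSlim m (i, t) \<omega> * RSlim m (j, s) \<omega>)) \<longlonglongrightarrow> \<nu> i * \<nu> j * K.\<Phi> (expdecay (\<alpha> i) t) (expdecay (\<alpha> j) s)"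
    unfolding RSlim_covariance[OF i j]
    by (intro tendsto_mult tendsto_const K.\<Phi>_tendsto[OF tame_expdecay[OF ai, of t] tame_expdecay[OF aj, of s]]
        LIMSEQ_Suc[OF truncated_expdecay_tendsto]) (auto simp: expdecay_def indicator_def)
qed

section \<open>The stationary covariance: decomposition and decay\<close>

definition r :: "nat \<Rightarrow> nat \<Rightarrow> real \<Rightarrow> real" where
  "r i j x = expectation (\<lambda>\<omega>. Y i x \<omega> * Y j 0 \<omega>)"

lemma Y_stationary:
  assumes i: "i \<in> {1, 2}" and j: "j \<in> {1, 2}"
  shows "expectation (\<lambda>\<omega>. Y i (t + c) \<omega> * Y j c \<omega>) = r i j t"
proof -
  interpret K: power_kernel "h i j - 2" "kA i j" "kB i j" by (rule power_kernel_ij[OF i j])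
  show ?thesis
    unfolding r_def Y_covariance[OF i j] using K.\<Phi>_expdecay_shift[of "\<alpha> i" t c "\<alpha> j" 0] by simp
qed

text \<open>For i \<noteq> j the constant \<open>kB i j\<close> contains \<rho> + \<eta> i j, and
  exchanging the components flips the sign of \<eta>. The two lagged cross covariances together thus
  determine both parameters.\<close>

lemma r_decompose:
  assumes i: "i \<in> {1, 2}" and j: "j \<in> {1, 2}"
  shows "exp (\<alpha> i * real s) * r i j (real s) = r i j 0 + \<nu> i * \<nu> j * kB i j * I_coef \<alpha> (h i j) i j s"
proof -
  interpret K: power_kernel "h i j - 2" "kA i j" "kB i j" by (rule power_kernel_ij[OF i j])
  have "I_coef \<alpha> (h i j) i j s = K.J (\<alpha> i) (\<alpha> j) (real s)"
    by (simp add: I_coef_def K.J_def K.G_def)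
  moreover have "K.\<Phi> (expdecay (\<alpha> i) (real s)) (expdecay (\<alpha> j) 0) =
      exp (- (\<alpha> i * real s)) * (K.\<Phi> (expdecay (\<alpha> i) 0) (expdecay (\<alpha> j) 0) + kB i j * K.J (\<alpha> i) (\<alpha> j) (real s))"
    using K.\<Phi>_decompose[of "\<alpha> i" "\<alpha> j" "real s"] pos[OF i] pos[OF j] by simp
  moreover have "exp (\<alpha> i * real s) * (n * (exp (- (\<alpha> i * real s)) * z)) = n * z" for n z
    by (simp add: exp_minus)
  ultimately show ?thesis
    unfolding r_def Y_covariance[OF i j] by (simp only:) (simp only: distrib_left mult.assoc)
qed

lemma I_coef_pos:
  assumes i: "i \<in> {1, 2}" and j: "j \<in> {1, 2}" and s: "s \<ge> 1"
  shows "I_coef \<alpha> (h i j) i j s > 0"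
proof -
  interpret K: power_kernel "h i j - 2" "kA i j" "kB i j" by (rule power_kernel_ij[OF i j])
  have "I_coef \<alpha> (h i j) i j s = K.J (\<alpha> i) (\<alpha> j) (real s)"
    by (simp add: I_coef_def K.J_def K.G_def)
  then show ?thesis using K.J_positive[of "\<alpha> i" "\<alpha> j" "real s"] pos i j s by simp
qed

lemma r_tendsto:
  assumes i: "i \<in> {1, 2}" and j: "j \<in> {1, 2}"
  shows "(\<lambda>n. real n powr (2 - h i j) * r i j (real n)) \<longlonglongrightarrow> \<nu> i * \<nu> j * (kB i j / (\<alpha> i * \<alpha> j))"
proof -
  interpret K: power_kernel "h i j - 2" "kA i j" "kB i j" by (rule power_kernel_ij[OF i j])
  have "(\<lambda>n. \<nu> i * \<nu> j * (real n powr (- (h i j - 2)) * K.\<Phi> (expdecay (\<alpha> i) (real n)) (expdecay (\<alpha> j) 0))) \<longlonglongrightarrow> \<nu> i * \<nu> j * (kB i j / (\<alpha> i * \<alpha> j))"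
    using pos i j by (intro tendsto_intros K.\<Phi>_expdecay_tendsto) auto
  then show ?thesis unfolding r_def Y_covariance[OF i j] by (simp add: mult_ac)
qed

end

section \<open>Logarithmic averages and negligible perturbations\<close>

text \<open>Cesaro averaging with general weights: the initial terms contribute the fixed amount
  \<open>c\<close>, which the diverging total weight outgrows.\<close>

lemma weighted_average_tendsto:
  fixes w x :: "nat \<Rightarrow> real"
  assumes w: "\<And>k. w k \<ge> 0" and W: "filterlim (\<lambda>n. \<Sum>k<n. w k) at_top sequentially" and x: "x \<longlonglongrightarrow> g"
  shows "(\<lambda>n. (\<Sum>k<n. w k * x k) / (\<Sum>k<n. w k)) \<longlonglongrightarrow> g"
proof (rule LIMSEQ_I)
  fix r :: real assume r: "r > 0"
  obtain N where N: "\<And>k. k \<ge> N \<Longrightarrow> \<bar>x k - g\<bar> < r / 2"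
    using LIMSEQ_D[OF x, of "r / 2"] r by auto
  define c where "c = (\<Sum>k<N. w k * \<bar>x k - g\<bar>)"
  have c: "c \<ge> 0" unfolding c_def by (intro sum_nonneg mult_nonneg_nonneg w) auto
  have "eventually (\<lambda>n. (\<Sum>k<n. w k) > 2 * c / r + 1) sequentially"
    using W by (simp add: filterlim_at_top_dense)
  then obtain N' where N': "\<And>n. n \<ge> N' \<Longrightarrow> (\<Sum>k<n. w k) > 2 * c / r + 1" by (auto simp: eventually_sequentially)
  have "norm ((\<Sum>k<n. w k * x k) / (\<Sum>k<n. w k) - g) < r" if n: "n \<ge> max N N'" for n
  proof -
    have Wn: "(\<Sum>k<n. w k) > 2 * c / r + 1" using N' n by simp
    have W0: "(\<Sum>k<n. w k) > 0" using Wn c r by (smt (verit) divide_nonneg_pos)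
    have cW: "c < r / 2 * (\<Sum>k<n. w k)" using Wn r by (simp add: field_simps)
    have "(\<Sum>k<n. w k * x k) / (\<Sum>k<n. w k) - g = (\<Sum>k<n. w k * (x k - g)) / (\<Sum>k<n. w k)"
      using W0 by (simp add: right_diff_distrib sum_subtractf sum_distrib_right[symmetric] diff_divide_distrib)
    then have eq: "norm ((\<Sum>k<n. w k * x k) / (\<Sum>k<n. w k) - g) = \<bar>\<Sum>k<n. w k * (x k - g)\<bar> / (\<Sum>k<n. w k)"
      using W0 by simp
    have "\<bar>\<Sum>k<n. w k * (x k - g)\<bar> \<le> (\<Sum>k<n. w k * \<bar>x k - g\<bar>)"
      using w by (intro order_trans[OF sum_abs]) (simp add: abs_mult)
    also have "(\<Sum>k<n. w k * \<bar>x k - g\<bar>) = c + (\<Sum>k\<in>{N..<n}. w k * \<bar>x k - g\<bar>)"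
      unfolding c_def using n by (subst sum.union_disjoint[symmetric]) (auto intro!: sum.cong)
    also have "(\<Sum>k\<in>{N..<n}. w k * \<bar>x k - g\<bar>) \<le> (\<Sum>k\<in>{N..<n}. w k * (r / 2))"
      using w N by (intro sum_mono mult_left_mono) (auto intro: less_imp_le)
    also have "\<dots> \<le> (\<Sum>k<n. w k * (r / 2))"
      using w r by (intro sum_mono2) auto
    also have "\<dots> = r / 2 * (\<Sum>k<n. w k)" by (subst sum_distrib_right[symmetric]) simp
    finally have "\<bar>\<Sum>k<n. w k * (x k - g)\<bar> < r * (\<Sum>k<n. w k)" using cW by simp
    then show ?thesis unfolding eq using W0 by (simp add: pos_divide_less_eq)
  qed
  then show "\<exists>no. \<forall>n\<ge>no. norm ((\<Sum>k<n. w k * x k) / (\<Sum>k<n. w k) - g) < r" by blast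
qed

lemma harm_eq_sum: "harm n = (\<Sum>k<n. 1 / (real k + 1))"
  by (induction n) (simp_all add: harm_Suc harm_expand(1) inverse_eq_divide)

text \<open>A weighted average of (m + 1) g m with weights 1 / (m + 1), whose total is the harmonic
  number. Passing from m to m + 1 costs g m, which tends to 0.\<close>

lemma partial_sums_over_harm_tendsto:
  assumes g: "(\<lambda>m. real m * g m) \<longlonglongrightarrow> c"
  shows "(\<lambda>n. (\<Sum>m<n. g m) / harm n) \<longlonglongrightarrow> c"
proof -
  have "(\<lambda>m. (real m * g m) * (1 / real m)) \<longlonglongrightarrow> c * 0" by (intro tendsto_mult g) real_asymp
  moreover have "eventually (\<lambda>m. (real m * g m) * (1 / real m) = g m) sequentially"
    using eventually_gt_at_top[of 0] by eventually_elim auto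
  ultimately have g0: "g \<longlonglongrightarrow> 0" using Lim_transform_eventually by fastforce
  have "(\<lambda>m. real m * g m + g m) \<longlonglongrightarrow> c + 0" by (intro tendsto_intros g g0)
  then have "(\<lambda>m. (real m + 1) * g m) \<longlonglongrightarrow> c" by (simp add: algebra_simps)
  from weighted_average_tendsto[OF _ _ this, of "\<lambda>k. 1 / (real k + 1)"] harm_at_top
  show ?thesis by (simp add: harm_eq_sum[symmetric] add_eq_0_iff)
qed

lemma sum_harm: "(\<Sum>j<n. harm (Suc j)) = (real n + 1) * harm n - real n"
proof (induction n)
  case (Suc n)
  have "(real n + 1) * harm (Suc n) = (real n + 1) * harm n + 1"
  proof -
    have "(real n + 1) * inverse (real (Suc n)) = 1" by (simp add: field_simps)
    then show ?thesis by (simp only: harm_Suc distrib_left)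
  qed
  then show ?case using Suc by (simp add: algebra_simps)
qed (simp add: harm_expand(1))

lemma harm_over_ln_tendsto: "(\<lambda>n. harm n / ln (real n)) \<longlonglongrightarrow> 1"
proof -
  have "(\<lambda>n. (harm n - ln (real n)) * (1 / ln (real n)) + 1 :: real) \<longlonglongrightarrow> euler_mascheroni * 0 + 1"
    by (intro tendsto_intros euler_mascheroni_LIMSEQ) real_asymp
  moreover have "eventually (\<lambda>n. (harm n - ln (real n)) * (1 / ln (real n)) + 1 = (harm n / ln (real n) :: real)) sequentially"
    using eventually_gt_at_top[of 1] by eventually_elim (simp add: field_simps)
  ultimately show ?thesis using Lim_transform_eventually by fastforce
qed

lemma sum_harm_asymp: "(\<lambda>n. (\<Sum>j<n. harm (Suc j)) / (real n * ln (real n))) \<longlonglongrightarrow> 1"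
proof -
  have "(\<lambda>n. (harm n / ln (real n)) * ((real n + 1) / real n) - 1 / ln (real n)) \<longlonglongrightarrow> 1 * 1 - 0"
    by (intro tendsto_diff tendsto_mult harm_over_ln_tendsto) real_asymp+
  moreover have "eventually (\<lambda>n. (harm n / ln (real n)) * ((real n + 1) / real n) - 1 / ln (real n) = (\<Sum>j<n. harm (Suc j)) / (real n * ln (real n))) sequentially"
    using eventually_gt_at_top[of 1] by eventually_elim (simp add: sum_harm field_simps)
  ultimately show ?thesis using Lim_transform_eventually by fastforce
qed

text \<open>A second averaging, now with the harmonic numbers as weights; their sum is asymptotic to
  n ln n, the norming of the theorem.\<close>

lemma iterated_partial_sums_tendsto:
  assumes g: "(\<lambda>m. real m * g m) \<longlonglongrightarrow> c"
  shows "(\<lambda>n. (\<Sum>j<n. \<Sum>m<Suc j. g m) / (real n * ln (real n))) \<longlonglongrightarrow> c"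
proof -
  have hp: "harm (Suc j) > (0::real)" for j by (rule harm_pos) simp
  have 1: "(\<lambda>j. (\<Sum>m<Suc j. g m) / harm (Suc j)) \<longlonglongrightarrow> c"
    by (rule LIMSEQ_Suc[OF partial_sums_over_harm_tendsto[OF g]])
  have t: "filterlim (\<lambda>n. \<Sum>j<n. harm (Suc j) :: real) at_top sequentially"
  proof (rule filterlim_at_top_mono[OF harm_at_top])
    have "harm n \<le> (\<Sum>j<n. harm (Suc j) :: real)" for n
    proof (cases n)
      case (Suc k)
      have "harm (Suc k) \<le> (\<Sum>j\<in>{..<Suc k}. harm (Suc j) :: real)"
        using hp by (intro member_le_sum[where i=k]) (auto intro: less_imp_le)
      then show ?thesis by (simp add: Suc)
    qed (simp add: harm_expand)
    then show "eventually (\<lambda>n. harm n \<le> (\<Sum>j<n. harm (Suc j) :: real)) sequentially" by simp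
  qed
  have "(\<lambda>n. (\<Sum>j<n. harm (Suc j) * ((\<Sum>m<Suc j. g m) / harm (Suc j))) / (\<Sum>j<n. harm (Suc j))) \<longlonglongrightarrow> c"
    by (rule weighted_average_tendsto[OF _ t 1]) (use hp in \<open>auto intro: less_imp_le\<close>)
  moreover have "harm (Suc j) * ((\<Sum>m<Suc j. g m) / harm (Suc j)) = (\<Sum>m<Suc j. g m)" for j
  proof -
    have "harm (Suc j) \<noteq> (0::real)" using hp[of j] by (metis less_irrefl)
    then show ?thesis by simp
  qed
  ultimately have 2: "(\<lambda>n. (\<Sum>j<n. \<Sum>m<Suc j. g m) / (\<Sum>j<n. harm (Suc j))) \<longlonglongrightarrow> c" by simp
  have "(\<lambda>n. ((\<Sum>j<n. \<Sum>m<Suc j. g m) / (\<Sum>j<n. harm (Suc j))) * ((\<Sum>j<n. harm (Suc j)) / (real n * ln (real n)))) \<longlonglongrightarrow> c * 1"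
    by (intro tendsto_mult 2 sum_harm_asymp)
  moreover have "((\<Sum>j<n. \<Sum>m<Suc j. g m) / (\<Sum>j<n. harm (Suc j))) * ((\<Sum>j<n. harm (Suc j)) / (real n * ln (real n)))
    = (\<Sum>j<n. \<Sum>m<Suc j. g m) / (real n * ln (real n))" for n
  proof (cases "n = 0")
    case False
    have "(\<Sum>j<n. harm (Suc j)) > (0::real)" using False hp by (intro sum_pos) auto
    then show ?thesis by simp
  qed simp
  ultimately show ?thesis by (simp only: mult_1_right)
qed

section \<open>Double sums of Toeplitz matrices\<close>

lemma sum_comp_inj_le:
  fixes f :: "nat \<Rightarrow> real"
  assumes "inj_on \<phi> S" "\<phi> ` S \<subseteq> {..<n}" "\<And>m. f m \<ge> 0"
  shows "(\<Sum>k\<in>S. f (\<phi> k)) \<le> (\<Sum>m<n. f m)"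
proof -
  have "(\<Sum>k\<in>S. f (\<phi> k)) = (\<Sum>m\<in>\<phi> ` S. f m)" using assms(1) by (simp add: sum.reindex)
  also have "\<dots> \<le> (\<Sum>m<n. f m)" using assms by (intro sum_mono2) auto
  finally show ?thesis .
qed

text \<open>Two sequences are kept, one for each side of the diagonal, because cross covariances are
  not symmetric in the lag.\<close>

locale toeplitz_kernel =
  fixes G :: "nat \<Rightarrow> nat \<Rightarrow> real" and g g' :: "nat \<Rightarrow> real"
  assumes lower: "\<And>j m. G (j + m) j = g m" and upper: "\<And>j m. G j (j + m) = g' m"
begin

lemma lower': "k \<le> j \<Longrightarrow> G j k = g (j - k)"
  using lower[of k "j - k"] by simp

lemma upper': "j \<le> k \<Longrightarrow> G j k = g' (k - j)"
  using upper[of j "k - j"] by simp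

lemma row_le:
  assumes "j < n"
  shows "(\<Sum>k<n. \<bar>G j k\<bar>) \<le> (\<Sum>m<n. \<bar>g m\<bar>) + (\<Sum>m<n. \<bar>g' m\<bar>)"
proof -
  have "(\<Sum>k<n. \<bar>G j k\<bar>) = (\<Sum>k\<le>j. \<bar>G j k\<bar>) + (\<Sum>k\<in>{j<..<n}. \<bar>G j k\<bar>)"
    using assms by (subst sum.union_disjoint[symmetric]) (auto intro!: sum.cong)
  also have "(\<Sum>k\<le>j. \<bar>G j k\<bar>) = (\<Sum>k\<le>j. \<bar>g (j - k)\<bar>)"
    by (intro sum.cong) (auto simp: lower')
  also have "\<dots> \<le> (\<Sum>m<n. \<bar>g m\<bar>)"
    using assms by (intro sum_comp_inj_le[where f="\<lambda>m. \<bar>g m\<bar>"]) (auto simp: inj_on_def)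
  also have "(\<Sum>k\<in>{j<..<n}. \<bar>G j k\<bar>) = (\<Sum>k\<in>{j<..<n}. \<bar>g' (k - j)\<bar>)"
    by (intro sum.cong) (auto simp: upper')
  also have "\<dots> \<le> (\<Sum>m<n. \<bar>g' m\<bar>)"
    using assms by (intro sum_comp_inj_le[where f="\<lambda>m. \<bar>g' m\<bar>"]) (auto simp: inj_on_def)
  finally show ?thesis by simp
qed

lemma column_le:
  assumes "k < n"
  shows "(\<Sum>j<n. \<bar>G j k\<bar>) \<le> (\<Sum>m<n. \<bar>g m\<bar>) + (\<Sum>m<n. \<bar>g' m\<bar>)"
proof -
  interpret t: toeplitz_kernel "\<lambda>j k. G k j" g' g by unfold_locales (use lower upper in auto)
  show ?thesis using t.row_le[OF assms] by simp
qed

text \<open>Each triangle is an iterated partial sum. Both contain the diagonal, and its surplus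
  copy is the subtracted term; the induction adds the last row and column.\<close>

lemma double_sum: "(\<Sum>j<n. \<Sum>k<n. G j k) = (\<Sum>j<n. \<Sum>m<Suc j. g m) + (\<Sum>j<n. \<Sum>m<Suc j. g' m) - real n * g' 0"
proof (induction n)
  case (Suc n)
  have r1: "(\<Sum>k<n. G n k) = (\<Sum>m<n. g (Suc m))"
  proof -
    have "(\<Sum>k<n. G n k) = (\<Sum>k<n. g (Suc (n - Suc k)))"
      by (intro sum.cong) (auto simp: lower' Suc_diff_Suc)
    also have "\<dots> = (\<Sum>m<n. g (Suc m))" by (rule sum.nat_diff_reindex)
    finally show ?thesis .
  qed
  have r2: "(\<Sum>j<n. G j n) = (\<Sum>m<n. g' (Suc m))"
  proof -
    have "(\<Sum>j<n. G j n) = (\<Sum>j<n. g' (Suc (n - Suc j)))"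
      by (intro sum.cong) (auto simp: upper' Suc_diff_Suc)
    also have "\<dots> = (\<Sum>m<n. g' (Suc m))" by (rule sum.nat_diff_reindex)
    finally show ?thesis .
  qed
  have "(\<Sum>j<Suc n. \<Sum>k<Suc n. G j k) = (\<Sum>j<n. \<Sum>k<n. G j k) + (\<Sum>j<n. G j n) + (\<Sum>k<n. G n k) + G n n"
    by (simp add: sum.distrib)
  also have "G n n = g 0" using lower[of n 0] by simp
  also have "(\<Sum>k<n. G n k) = (\<Sum>m<Suc n. g m) - g 0" by (simp add: r1 sum.lessThan_Suc_shift del: sum.lessThan_Suc)
  also have "(\<Sum>j<n. G j n) = (\<Sum>m<Suc n. g' m) - g' 0" by (simp add: r2 sum.lessThan_Suc_shift del: sum.lessThan_Suc)
  finally show ?case unfolding Suc.IH by (simp add: algebra_simps)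
qed simp

text \<open>The lagged sums have l or l' fewer terms. The missing rows and columns have absolute
  sums of order ln n each, which is negligible against n ln n.\<close>

lemma rect_double_sum_tendsto:
  assumes g: "(\<lambda>m. real m * g m) \<longlonglongrightarrow> c" and g': "(\<lambda>m. real m * g' m) \<longlonglongrightarrow> c'"
  shows "(\<lambda>n. (\<Sum>j<n - l. \<Sum>k<n - l'. G j k) / (real n * ln (real n))) \<longlonglongrightarrow> c + c'"
proof -
  let ?N = "\<lambda>n. real n * ln (real n)"
  define b where "b n = (\<Sum>m<n. \<bar>g m\<bar>) + (\<Sum>m<n. \<bar>g' m\<bar>)" for n
  have "(\<lambda>n. (\<Sum>j<n. \<Sum>m<Suc j. g m) / ?N n + (\<Sum>j<n. \<Sum>m<Suc j. g' m) / ?N n - g' 0 * (1 / ln (real n))) \<longlonglongrightarrow> c + c' - g' 0 * 0"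
    by (intro tendsto_diff tendsto_add iterated_partial_sums_tendsto g g' tendsto_mult tendsto_const) real_asymp
  moreover have "eventually (\<lambda>n. (\<Sum>j<n. \<Sum>m<Suc j. g m) / ?N n + (\<Sum>j<n. \<Sum>m<Suc j. g' m) / ?N n - g' 0 * (1 / ln (real n)) =
      (\<Sum>j<n. \<Sum>k<n. G j k) / ?N n) sequentially"
    using eventually_gt_at_top[of 1] unfolding double_sum
    by eventually_elim (simp add: add_divide_distrib diff_divide_distrib del: sum.lessThan_Suc)
  ultimately have full: "(\<lambda>n. (\<Sum>j<n. \<Sum>k<n. G j k) / ?N n) \<longlonglongrightarrow> c + c'"
    using Lim_transform_eventually by fastforce
  have ag: "(\<lambda>m. real m * \<bar>g m\<bar>) \<longlonglongrightarrow> \<bar>c\<bar>" "(\<lambda>m. real m * \<bar>g' m\<bar>) \<longlonglongrightarrow> \<bar>c'\<bar>"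
    using tendsto_rabs[OF g] tendsto_rabs[OF g'] by (simp_all add: abs_mult)
  have "(\<lambda>n. ((\<Sum>m<n. \<bar>g m\<bar>) / harm n + (\<Sum>m<n. \<bar>g' m\<bar>) / harm n) * (harm n / ln (real n)) * (1 / real n)) \<longlonglongrightarrow> (\<bar>c\<bar> + \<bar>c'\<bar>) * 1 * 0"
    by (intro tendsto_mult tendsto_add partial_sums_over_harm_tendsto ag harm_over_ln_tendsto) real_asymp
  moreover have "eventually (\<lambda>n. ((\<Sum>m<n. \<bar>g m\<bar>) / harm n + (\<Sum>m<n. \<bar>g' m\<bar>) / harm n) * (harm n / ln (real n)) * (1 / real n) = b n / ?N n) sequentially"
    using eventually_gt_at_top[of 0]
  proof eventually_elim
    case (elim n)
    then have "harm n \<noteq> (0::real)" using harm_pos[of n] by (metis less_irrefl)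
    then show ?case by (simp add: b_def add_divide_distrib[symmetric] mult.commute)
  qed
  ultimately have b0: "(\<lambda>n. b n / ?N n) \<longlonglongrightarrow> 0" using Lim_transform_eventually by fastforce
  have diff: "\<bar>(\<Sum>j<n - l. \<Sum>k<n - l'. G j k) - (\<Sum>j<n. \<Sum>k<n. G j k)\<bar> \<le> (real l + real l') * b n" for n
  proof -
    have b: "b n \<ge> 0" unfolding b_def by (intro add_nonneg_nonneg sum_nonneg) auto
    have 1: "(\<Sum>j<n. \<Sum>k<n. G j k) = (\<Sum>j<n - l. \<Sum>k<n. G j k) + (\<Sum>j\<in>{n - l..<n}. \<Sum>k<n. G j k)"
      by (subst sum.union_disjoint[symmetric]) (auto intro!: sum.cong)
    have 2: "(\<Sum>j<n - l. \<Sum>k<n. G j k) = (\<Sum>j<n - l. \<Sum>k<n - l'. G j k) + (\<Sum>j<n - l. \<Sum>k\<in>{n - l'..<n}. G j k)"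
      unfolding sum.distrib[symmetric]
      by (intro sum.cong refl, subst sum.union_disjoint[symmetric]) (auto intro!: sum.cong)
    have "\<bar>\<Sum>j\<in>{n - l..<n}. \<Sum>k<n. G j k\<bar> \<le> (\<Sum>j\<in>{n - l..<n}. \<Sum>k<n. \<bar>G j k\<bar>)"
      by (intro order_trans[OF sum_abs] sum_mono sum_abs)
    also have "\<dots> \<le> (\<Sum>j\<in>{n - l..<n}. b n)" unfolding b_def by (intro sum_mono row_le) auto
    also have "\<dots> \<le> real l * b n" using b by (simp add: mult_right_mono)
    finally have 3: "\<bar>\<Sum>j\<in>{n - l..<n}. \<Sum>k<n. G j k\<bar> \<le> real l * b n" .
    have "\<bar>\<Sum>j<n - l. \<Sum>k\<in>{n - l'..<n}. G j k\<bar> \<le> (\<Sum>j<n - l. \<Sum>k\<in>{n - l'..<n}. \<bar>G j k\<bar>)"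
      by (intro order_trans[OF sum_abs] sum_mono sum_abs)
    also have "\<dots> \<le> (\<Sum>j<n. \<Sum>k\<in>{n - l'..<n}. \<bar>G j k\<bar>)" by (intro sum_mono2) (auto intro: sum_nonneg)
    also have "\<dots> = (\<Sum>k\<in>{n - l'..<n}. \<Sum>j<n. \<bar>G j k\<bar>)" by (rule sum.swap)
    also have "\<dots> \<le> (\<Sum>k\<in>{n - l'..<n}. b n)" unfolding b_def by (intro sum_mono column_le) auto
    also have "\<dots> \<le> real l' * b n" using b by (simp add: mult_right_mono)
    finally have 4: "\<bar>\<Sum>j<n - l. \<Sum>k\<in>{n - l'..<n}. G j k\<bar> \<le> real l' * b n" .
    show ?thesis using 1 2 3 4 unfolding distrib_right by linarith
  qed
  have "(\<lambda>n. (\<Sum>j<n - l. \<Sum>k<n - l'. G j k) / ?N n - (\<Sum>j<n. \<Sum>k<n. G j k) / ?N n) \<longlonglongrightarrow> 0"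
  proof (rule tendsto_rabs_zero_cancel, rule tendsto_sandwich[OF _ _ tendsto_const])
    show "(\<lambda>n. (real l + real l') * (b n / ?N n)) \<longlonglongrightarrow> 0" using tendsto_mult[OF tendsto_const b0] by simp
    show "eventually (\<lambda>n. \<bar>(\<Sum>j<n - l. \<Sum>k<n - l'. G j k) / ?N n - (\<Sum>j<n. \<Sum>k<n. G j k) / ?N n\<bar> \<le> (real l + real l') * (b n / ?N n)) sequentially"
      using eventually_gt_at_top[of 1]
    proof eventually_elim
      case (elim n)
      then have N: "?N n > 0" by simp
      have "\<bar>(\<Sum>j<n - l. \<Sum>k<n - l'. G j k) / ?N n - (\<Sum>j<n. \<Sum>k<n. G j k) / ?N n\<bar> = \<bar>(\<Sum>j<n - l. \<Sum>k<n - l'. G j k) - (\<Sum>j<n. \<Sum>k<n. G j k)\<bar> / ?N n"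
        unfolding diff_divide_distrib[symmetric] abs_divide using N by simp
      also have "\<dots> \<le> (real l + real l') * b n / ?N n" using N by (intro divide_right_mono diff) auto
      finally show ?case by simp
    qed
  qed auto
  from tendsto_add[OF this full] show ?thesis by simp
qed

end

text \<open>Each term is at most the integral of the decreasing power over the preceding unit
  interval, and the antiderivatives telescope. The first interval reaches the singularity, which is
  integrable since p > -1.\<close>

lemma sum_powr_le:
  assumes p: "-1 < p" "p < 0"
  shows "(\<Sum>m<n. (real m + 1) powr p) \<le> real n powr (p + 1) / (p + 1)"
proof -
  have "(real m + 1) powr p \<le> ((real m + 1) powr (p + 1) - real m powr (p + 1)) / (p + 1)" for m
  proof -
    have h: "has_bochner_integral lborel (\<lambda>x. indicator {real m<..real m + 1} x * pospow p x) (((real m + 1) powr (p + 1) - real m powr (p + 1)) / (p + 1))"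
      using pospow_has_bochner_integral[OF p(1), of "real m" "real m + 1"] by (simp add: pospow_pos)
    have "(real m + 1) powr p = (LINT x|lborel. indicator {real m<..real m + 1} x * (real m + 1) powr p)" by simp
    also have "\<dots> \<le> (LINT x|lborel. indicator {real m<..real m + 1} x * pospow p x)"
    proof (rule integral_mono)
      show "indicator {real m<..real m + 1} x * (real m + 1) powr p \<le> indicator {real m<..real m + 1} x * pospow p x" for x
        using p by (cases "x \<in> {real m<..real m + 1}") (auto simp: pospow_pos intro!: powr_mono2')
    qed (use h in \<open>auto simp: has_bochner_integral_iff\<close>)
    finally show ?thesis using h by (simp add: has_bochner_integral_iff)
  qed
  then have "(\<Sum>m<n. (real m + 1) powr p) \<le> (\<Sum>m<n. ((real m + 1) powr (p + 1) - real m powr (p + 1)) / (p + 1))"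
    by (intro sum_mono)
  also have "\<dots> = real n powr (p + 1) / (p + 1)"
    by (induction n) (simp_all add: add_divide_distrib[symmetric] diff_divide_distrib add.commute)
  finally show ?thesis .
qed

section \<open>Scaling of normal laws and mean-square perturbation of weak limits\<close>

lemma distr_normal_law_scale:
  assumes "v \<ge> 0" shows "distr (normal_law 0 v) borel (\<lambda>x. a * x) = normal_law 0 (a\<^sup>2 * v)"
proof -
  interpret N: real_distribution "normal_law 0 v" by (rule real_distribution_normal_law[OF assms])
  have v': "a\<^sup>2 * v \<ge> 0" using assms by simp
  show ?thesis
  proof (rule Levy_uniqueness)
    show "real_distribution (distr (normal_law 0 v) borel (\<lambda>x. a * x))" by (rule N.real_distribution_distr) simp
    show "real_distribution (normal_law 0 (a\<^sup>2 * v))" by (rule real_distribution_normal_law[OF v'])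
    show "char (distr (normal_law 0 v) borel (\<lambda>x. a * x)) = char (normal_law 0 (a\<^sup>2 * v))"
    proof
      fix t
      have "char (distr (normal_law 0 v) borel (\<lambda>x. a * x)) t = char (normal_law 0 v) (t * a)"
        unfolding char_def by (subst integral_distr) (auto simp: mult.assoc)
      also have "\<dots> = char (normal_law 0 (a\<^sup>2 * v)) t"
        unfolding char_normal_law[OF assms] char_normal_law[OF v'] by (simp add: power_mult_distrib mult_ac)
      finally show "char (distr (normal_law 0 v) borel (\<lambda>x. a * x)) t = char (normal_law 0 (a\<^sup>2 * v)) t" .
    qed
  qed
qed

text \<open>A Slutsky argument for test functions that are merely bounded and continuous: f is
  uniformly continuous on a large ball, and Chebyshev's inequality bounds both the escape from the
  ball and large deviations of X' from X.\<close>

lemma (in prob_space) expectation_diff_tendsto_0: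
  fixes X X' :: "nat \<Rightarrow> 'a \<Rightarrow> real \<times> real" and f :: "real \<times> real \<Rightarrow> real"
  assumes X: "\<And>n. X n \<in> borel_measurable M" and X': "\<And>n. X' n \<in> borel_measurable M"
    and iX: "\<And>n. integrable M (\<lambda>\<omega>. (norm (X n \<omega>))\<^sup>2)" and iD: "\<And>n. integrable M (\<lambda>\<omega>. (norm (X' n \<omega> - X n \<omega>))\<^sup>2)"
    and C: "\<And>n. expectation (\<lambda>\<omega>. (norm (X n \<omega>))\<^sup>2) \<le> C"
    and D: "(\<lambda>n. expectation (\<lambda>\<omega>. (norm (X' n \<omega> - X n \<omega>))\<^sup>2)) \<longlonglongrightarrow> 0"
    and f: "continuous_on UNIV f" "bounded (range f)"
  shows "(\<lambda>n. expectation (\<lambda>\<omega>. f (X' n \<omega>)) - expectation (\<lambda>\<omega>. f (X n \<omega>))) \<longlonglongrightarrow> 0"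
proof (rule LIMSEQ_I)
  fix r :: real assume r: "r > 0"
  obtain b where b: "b > 0" "\<And>x. \<bar>f x\<bar> \<le> b"
    using f(2) by (auto simp: bounded_pos)
  have "0 \<le> expectation (\<lambda>\<omega>. (norm (X 0 \<omega>))\<^sup>2)" by simp
  then have C0: "C \<ge> 0" using C[of 0] by linarith
  \<comment> \<open>Chosen so that 2 b (C + 1) / L^2 = r / 4; the summand 1 keeps L positive when C
    = 0.\<close>
  define L where "L = sqrt (8 * b * (C + 1) / r)"
  have L: "L > 0" "L\<^sup>2 = 8 * b * (C + 1) / r" using r b C0 by (auto simp: L_def)
  have "uniformly_continuous_on (cball 0 (L + 1)) f"
    by (rule compact_uniformly_continuous[OF continuous_on_subset[OF f(1)]]) auto
  then obtain d' where d': "d' > 0" "\<And>x x'. x \<in> cball 0 (L + 1) \<Longrightarrow> x' \<in> cball 0 (L + 1) \<Longrightarrow> dist x' x < d' \<Longrightarrow> dist (f x') (f x) < r / 4"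
    unfolding uniformly_continuous_on_def using r by (metis divide_pos_pos zero_less_numeral)
  \<comment> \<open>The cap 1 keeps X' inside the ball of radius L + 1 on which d' was
    chosen.\<close>
  define d where "d = min d' 1"
  have d: "d > 0" using d' by (simp add: d_def)
  have f_meas: "f \<in> borel_measurable borel" by (rule borel_measurable_continuous_onI[OF f(1)])
  \<comment> \<open>Chebyshev's inequality in pointwise form: on the bad set at least one of the two
    quotients is 1 or more.\<close>
  have pw: "\<bar>f x' - f x\<bar> \<le> r / 4 + 2 * b * ((norm x)\<^sup>2 / L\<^sup>2 + (norm (x' - x))\<^sup>2 / d\<^sup>2)" for x x'
  proof (cases "norm x \<le> L \<and> norm (x' - x) < d")
    case True
    have "norm x' \<le> norm x + norm (x' - x)" by (metis norm_triangle_sub add.commute)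
    then have "\<bar>f x' - f x\<bar> < r / 4"
      using True d'(2)[of x x'] by (auto simp: d_def dist_norm)
    moreover have "0 \<le> 2 * b * ((norm x)\<^sup>2 / L\<^sup>2 + (norm (x' - x))\<^sup>2 / d\<^sup>2)" using b by simp
    ultimately show ?thesis by simp
  next
    case False
    have "1 \<le> (norm x)\<^sup>2 / L\<^sup>2 + (norm (x' - x))\<^sup>2 / d\<^sup>2"
    proof (cases "norm x \<le> L")
      case True
      then have "d\<^sup>2 \<le> (norm (x' - x))\<^sup>2" using False d by (intro power_mono) auto
      then have "1 \<le> (norm (x' - x))\<^sup>2 / d\<^sup>2" using d by simp
      moreover have "0 \<le> (norm x)\<^sup>2 / L\<^sup>2" by simp
      ultimately show ?thesis by linarith
    next
      case False
      then have "L\<^sup>2 \<le> (norm x)\<^sup>2" using L(1) by (intro power_mono) auto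
      then have "1 \<le> (norm x)\<^sup>2 / L\<^sup>2" using L(1) by simp
      moreover have "0 \<le> (norm (x' - x))\<^sup>2 / d\<^sup>2" by simp
      ultimately show ?thesis by linarith
    qed
    then have "2 * b * 1 \<le> 2 * b * ((norm x)\<^sup>2 / L\<^sup>2 + (norm (x' - x))\<^sup>2 / d\<^sup>2)" using b by (intro mult_left_mono) auto
    moreover have "\<bar>f x' - f x\<bar> \<le> 2 * b" using b(2)[of x] b(2)[of x'] by linarith
    ultimately show ?thesis using r by linarith
  qed
  have "(\<lambda>n. 2 * b * expectation (\<lambda>\<omega>. (norm (X' n \<omega> - X n \<omega>))\<^sup>2) / d\<^sup>2) \<longlonglongrightarrow> 2 * b * 0 / d\<^sup>2"
    using d by (intro tendsto_intros D) auto
  then have "eventually (\<lambda>n. 2 * b * expectation (\<lambda>\<omega>. (norm (X' n \<omega> - X n \<omega>))\<^sup>2) / d\<^sup>2 < r / 4) sequentially"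
    using r by (intro order_tendstoD(2)[where y=0]) auto
  then have "eventually (\<lambda>n. norm (expectation (\<lambda>\<omega>. f (X' n \<omega>)) - expectation (\<lambda>\<omega>. f (X n \<omega>)) - 0) < r) sequentially"
  proof eventually_elim
    case (elim n)
    have if': "integrable M (\<lambda>\<omega>. f (X' n \<omega>))" "integrable M (\<lambda>\<omega>. f (X n \<omega>))"
    proof -
      have "integrable M (\<lambda>\<omega>. f (Z \<omega>))" if Z: "Z \<in> borel_measurable M" for Z
      proof (rule integrable_const_bound[where B=b])
        show "AE \<omega> in M. norm (f (Z \<omega>)) \<le> b" using b(2) by (intro AE_I2) (simp only: real_norm_def)
        show "(\<lambda>\<omega>. f (Z \<omega>)) \<in> borel_measurable M" using measurable_compose[OF Z f_meas] .
      qed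
      then show "integrable M (\<lambda>\<omega>. f (X' n \<omega>))" "integrable M (\<lambda>\<omega>. f (X n \<omega>))" using X X' by auto
    qed
    have ib: "integrable M (\<lambda>\<omega>. r / 4 + 2 * b * ((norm (X n \<omega>))\<^sup>2 / L\<^sup>2 + (norm (X' n \<omega> - X n \<omega>))\<^sup>2 / d\<^sup>2))"
      using iX iD by auto
    have "\<bar>expectation (\<lambda>\<omega>. f (X' n \<omega>)) - expectation (\<lambda>\<omega>. f (X n \<omega>))\<bar> = \<bar>expectation (\<lambda>\<omega>. f (X' n \<omega>) - f (X n \<omega>))\<bar>"
      using if' by simp
    also have "\<dots> \<le> expectation (\<lambda>\<omega>. \<bar>f (X' n \<omega>) - f (X n \<omega>)\<bar>)"
      by (rule integral_abs_bound)
    also have "\<dots> \<le> expectation (\<lambda>\<omega>. r / 4 + 2 * b * ((norm (X n \<omega>))\<^sup>2 / L\<^sup>2 + (norm (X' n \<omega> - X n \<omega>))\<^sup>2 / d\<^sup>2))"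
      using if' ib pw by (intro integral_mono) auto
    also have "\<dots> = r / 4 + 2 * b * (expectation (\<lambda>\<omega>. (norm (X n \<omega>))\<^sup>2) / L\<^sup>2 + expectation (\<lambda>\<omega>. (norm (X' n \<omega> - X n \<omega>))\<^sup>2) / d\<^sup>2)"
      using iX iD by (simp add: prob_space)
    also have "\<dots> < r"
    proof -
      have "2 * b * (expectation (\<lambda>\<omega>. (norm (X n \<omega>))\<^sup>2) / L\<^sup>2) \<le> 2 * b * ((C + 1) / L\<^sup>2)"
        using C[of n] b by (intro mult_left_mono divide_right_mono) auto
      also have "\<dots> = r / 4"
      proof -
        define z where "z = b * (C + 1)"
        have z: "z \<noteq> 0" using b C0 by (simp add: z_def)
        have "2 * b * ((C + 1) / L\<^sup>2) = 2 * z / (8 * z / r)" unfolding L(2) z_def by (simp only: mult.assoc times_divide_eq_right)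
        also have "\<dots> = r / 4" using z r by simp
        finally show ?thesis .
      qed
      finally show ?thesis using elim r by (simp add: distrib_left)
    qed
    finally show ?case by simp
  qed
  then show "\<exists>no. \<forall>n\<ge>no. norm (expectation (\<lambda>\<omega>. f (X' n \<omega>)) - expectation (\<lambda>\<omega>. f (X n \<omega>)) - 0) < r"
    by (simp add: eventually_sequentially)
qed

section \<open>Asymptotic normality of the estimators\<close>

context bivariate_fou
begin

definition cov :: "nat \<Rightarrow> nat \<Rightarrow> nat \<Rightarrow> nat \<Rightarrow> real" where
  "cov i j t u = expectation (\<lambda>\<omega>. Y i (real t) \<omega> * Y j (real u) \<omega>)"

lemma cov_commute: "cov i j t u = cov j i u t"
  by (simp add: cov_def mult.commute)

lemma cov_lower: "i \<in> {1, 2} \<Longrightarrow> j \<in> {1, 2} \<Longrightarrow> cov i j (u + m) u = r i j (real m)"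
  using Y_stationary[of i j "real m" "real u"] by (simp add: cov_def add.commute)

lemma cov_upper: "i \<in> {1, 2} \<Longrightarrow> j \<in> {1, 2} \<Longrightarrow> cov i j u (u + m) = r j i (real m)"
  unfolding cov_commute[of i j] by (rule cov_lower)

lemma cov_shift: "i \<in> {1, 2} \<Longrightarrow> j \<in> {1, 2} \<Longrightarrow> cov i j (t + c) (u + c) = cov i j t u"
proof (cases "u \<le> t")
  case True
  assume ij: "i \<in> {1, 2}" "j \<in> {1, 2}"
  show ?thesis using cov_lower[OF ij, of "u + c" "t - u"] cov_lower[OF ij, of u "t - u"] True by (simp add: add.commute add.left_commute)
next
  case False
  assume ij: "i \<in> {1, 2}" "j \<in> {1, 2}"
  show ?thesis using cov_upper[OF ij, of "t + c" "u - t"] cov_upper[OF ij, of t "u - t"] False by (simp add: add.commute add.left_commute)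
qed

definition Lim :: "nat \<Rightarrow> nat \<Rightarrow> real" where
  "Lim i j = \<nu> i * \<nu> j * (kB i j / (\<alpha> i * \<alpha> j))"

text \<open>Fixed shifts p and p' change m only by a bounded amount, and the ratio of the
  corresponding powers tends to 1.\<close>

lemma cov_lag_tendsto:
  assumes i: "i \<in> {1, 2}" and j: "j \<in> {1, 2}"
  shows "(\<lambda>m. real m powr (2 - h i j) * cov i j (m + p) p') \<longlonglongrightarrow> Lim i j"
proof -
  let ?e = "2 - h i j"
  \<comment> \<open>The sequence is first treated at m + p', so that the lag m + p never involves a
    truncated subtraction of natural numbers; the offset p' is removed at the end.\<close>
  have "(\<lambda>m. (real (m + p' - p') / real (m + p' + p - p')) powr ?e * (real (m + p) powr ?e * r i j (real (m + p)))) \<longlonglongrightarrow> 1 powr ?e * Lim i j"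
  proof (intro tendsto_mult tendsto_powr tendsto_const)
    show "(\<lambda>m. real (m + p' - p') / real (m + p' + p - p')) \<longlonglongrightarrow> 1" by (simp, real_asymp)
    show "(\<lambda>m. real (m + p) powr ?e * r i j (real (m + p))) \<longlonglongrightarrow> Lim i j"
      unfolding Lim_def by (rule LIMSEQ_ignore_initial_segment[OF r_tendsto[OF i j]])
  qed auto
  moreover have "eventually (\<lambda>m. (real (m + p' - p') / real (m + p' + p - p')) powr ?e * (real (m + p) powr ?e * r i j (real (m + p))) =
      real m powr ?e * cov i j (m + p' + p) p') sequentially"
    using eventually_gt_at_top[of 0]
  proof eventually_elim
    case (elim m)
    have "(real m / real (m + p)) powr ?e * real (m + p) powr ?e = real m powr ?e"
      using elim by (subst powr_mult[symmetric]) auto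
    moreover have "cov i j (m + p' + p) p' = r i j (real (m + p))"
      using cov_lower[OF i j, of p' "m + p"] by (simp add: add.commute add.left_commute)
    ultimately show ?case by (simp add: mult.assoc[symmetric])
  qed
  ultimately have 1: "(\<lambda>m. real m powr ?e * cov i j (m + p' + p) p') \<longlonglongrightarrow> Lim i j"
    using Lim_transform_eventually by fastforce
  have "(\<lambda>m. (real (m + p') / real m) powr ?e * (real m powr ?e * cov i j (m + p' + p) p')) \<longlonglongrightarrow> 1 powr ?e * Lim i j"
  proof (intro tendsto_mult tendsto_powr tendsto_const 1)
    show "(\<lambda>m. real (m + p') / real m) \<longlonglongrightarrow> 1" by (simp, real_asymp)
  qed auto
  moreover have "eventually (\<lambda>m. (real (m + p') / real m) powr ?e * (real m powr ?e * cov i j (m + p' + p) p') =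
      real (m + p') powr ?e * cov i j (m + p' + p) p') sequentially"
    using eventually_gt_at_top[of 0]
  proof eventually_elim
    case (elim m)
    have "(real (m + p') / real m) powr ?e * real m powr ?e = real (m + p') powr ?e"
      using elim by (subst powr_mult[symmetric]) auto
    then show ?case by (simp add: mult.assoc[symmetric])
  qed
  ultimately have "(\<lambda>m. real (m + p') powr ?e * cov i j (m + p' + p) p') \<longlonglongrightarrow> Lim i j"
    using Lim_transform_eventually by fastforce
  then show ?thesis
    by (rule LIMSEQ_offset[where k=p'])
qed

lemma cov_bound:
  assumes i: "i \<in> {1, 2}" and j: "j \<in> {1, 2}"
  obtains K where "K > 0" "\<And>m. \<bar>r i j (real m)\<bar> \<le> K * (real m + 1) powr (h i j - 2)"
proof -
  let ?e = "2 - h i j"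
  \<comment> \<open>With reference time 1 the lag m is paired with the weight of m + 1, which is
    positive at m = 0 as well.\<close>
  have "(\<lambda>m. real (m + 1) powr ?e * cov i j (m + 1 + 0) 1) \<longlonglongrightarrow> Lim i j"
    by (rule LIMSEQ_ignore_initial_segment[OF cov_lag_tendsto[OF i j]])
  moreover have "cov i j (m + 1 + 0) 1 = r i j (real m)" for m
    using cov_lower[OF i j, of 1 m] by (simp add: add.commute)
  ultimately have "(\<lambda>m. real (m + 1) powr ?e * r i j (real m)) \<longlonglongrightarrow> Lim i j" by simp
  then have "Bseq (\<lambda>m. real (m + 1) powr ?e * r i j (real m))" by (intro convergent_imp_Bseq convergentI)
  then obtain K where K: "K > 0" "\<And>m. norm (real (m + 1) powr ?e * r i j (real m)) \<le> K" by (auto elim: BseqE)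
  have "\<bar>r i j (real m)\<bar> \<le> K * (real m + 1) powr (h i j - 2)" for m
  proof -
    have "(real m + 1) powr (h i j - 2) * (real m + 1) powr ?e = 1"
      by (simp add: powr_add[symmetric])
    then have "\<bar>r i j (real m)\<bar> = (real m + 1) powr (h i j - 2) * \<bar>(real m + 1) powr ?e * r i j (real m)\<bar>"
      by (simp add: abs_mult mult.assoc[symmetric])
    also have "\<dots> \<le> (real m + 1) powr (h i j - 2) * K"
      using K(2)[of m] by (intro mult_left_mono) (auto simp: add.commute)
    finally show ?thesis by (simp add: mult.commute)
  qed
  with K(1) show ?thesis by (rule that)
qed

definition \<gamma> :: real where
  "\<gamma> = Lim 1 1 * Lim 2 2 + Lim 1 2 * Lim 2 1"

text \<open>Isserlis' formula for the covariance of two lagged products at base times j and k, the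
  product of the means being removed.\<close>

definition prodcov :: "nat \<Rightarrow> nat \<Rightarrow> nat \<Rightarrow> nat \<Rightarrow> nat \<Rightarrow> nat \<Rightarrow> real" where
  "prodcov p q p' q' j k = cov 1 1 (j + p) (k + p') * cov 2 2 (j + q) (k + q') + cov 1 2 (j + p) (k + q') * cov 2 1 (j + q) (k + p')"

lemma prodcov_shift: "prodcov p q p' q' (j + c) (k + c) = prodcov p q p' q' j k"
proof -
  have *: "cov i i' (j + c + a) (k + c + b) = cov i i' (j + a) (k + b)" if "i \<in> {1, 2}" "i' \<in> {1, 2}" for i i' a b
    using cov_shift[OF that, of "j + a" c "k + b"] by (simp add: add.commute add.left_commute)
  show ?thesis unfolding prodcov_def by (simp add: *)
qed

lemma prodcov_commute: "prodcov p q p' q' j k = prodcov p' q' p q k j"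
  unfolding prodcov_def cov_commute[of 1 1 "j + p"] cov_commute[of 2 2 "j + q"] cov_commute[of 1 2 "j + p"] cov_commute[of 2 1 "j + q"]
  by simp

text \<open>Here H 1 + H 2 = 3/2 is decisive: the exponents (2 - 2 H 1) + (2 - 2 H 2) and 2 (2 - H 1
  - H 2) both equal 1, so both products in \<open>prodcov\<close> decay like 1 / m and contribute to
  \<gamma>.\<close>

lemma prodcov_lag_tendsto: "(\<lambda>m. real m * prodcov p q p' q' m 0) \<longlonglongrightarrow> \<gamma>"
proof -
  have "(\<lambda>m. (real m powr (2 - h 1 1) * cov 1 1 (m + p) p') * (real m powr (2 - h 2 2) * cov 2 2 (m + q) q') +
    (real m powr (2 - h 1 2) * cov 1 2 (m + p) q') * (real m powr (2 - h 2 1) * cov 2 1 (m + q) p')) \<longlonglongrightarrow> \<gamma>"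
    unfolding \<gamma>_def by (intro tendsto_add tendsto_mult cov_lag_tendsto) auto
  moreover have "eventually (\<lambda>m. (real m powr (2 - h 1 1) * cov 1 1 (m + p) p') * (real m powr (2 - h 2 2) * cov 2 2 (m + q) q') +
    (real m powr (2 - h 1 2) * cov 1 2 (m + p) q') * (real m powr (2 - h 2 1) * cov 2 1 (m + q) p') = real m * prodcov p q p' q' m 0) sequentially"
    using eventually_gt_at_top[of 0]
  proof eventually_elim
    case (elim m)
    have e: "2 - h 1 1 + (2 - h 2 2) = 1" "2 - h 1 2 + (2 - h 2 1) = 1"
      using H_sum by (auto simp: h_def)
    have "real m powr (2 - h 1 1) * real m powr (2 - h 2 2) = real m"
      "real m powr (2 - h 1 2) * real m powr (2 - h 2 1) = real m"
      unfolding powr_add[symmetric] e using elim by auto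
    then have c: "(real m powr (2 - h 1 1) * x) * (real m powr (2 - h 2 2) * y) = real m * (x * y)"
      "(real m powr (2 - h 1 2) * x) * (real m powr (2 - h 2 1) * y) = real m * (x * y)" for x y
      by (metis mult.assoc mult.left_commute)+
    show ?case unfolding c prodcov_def by (simp add: distrib_left)
  qed
  ultimately show ?thesis by (rule Lim_transform_eventually)
qed

text \<open>The lags on either side of the diagonal contribute \<gamma> each, independently of all
  shifts.\<close>

lemma prodcov_sum_tendsto:
  "(\<lambda>n. (\<Sum>j=1..n - l. \<Sum>k=1..n - l'. prodcov p q p' q' j k) / (real n * ln (real n))) \<longlonglongrightarrow> 2 * \<gamma>"
proof -
  interpret K: toeplitz_kernel "\<lambda>j k. prodcov p q p' q' (Suc j) (Suc k)" "\<lambda>m. prodcov p q p' q' m 0" "\<lambda>m. prodcov p q p' q' 0 m"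
  proof
    show "prodcov p q p' q' (Suc (j + m)) (Suc j) = prodcov p q p' q' m 0" for j m
      using prodcov_shift[of p q p' q' m "Suc j" 0] by (simp add: add.commute)
    show "prodcov p q p' q' (Suc j) (Suc (j + m)) = prodcov p q p' q' 0 m" for j m
      using prodcov_shift[of p q p' q' 0 "Suc j" m] by (simp add: add.commute)
  qed
  have "(\<lambda>m. real m * prodcov p q p' q' 0 m) \<longlonglongrightarrow> \<gamma>"
    unfolding prodcov_commute[of p q p' q' 0] by (rule prodcov_lag_tendsto)
  from K.rect_double_sum_tendsto[OF prodcov_lag_tendsto this, of l' l] show ?thesis
    by (simp add: sum.atLeast1_atMost_eq)
qed

section \<open>Centred lagged product sums and their covariances\<close>

definition mean :: "nat \<Rightarrow> nat \<Rightarrow> real" where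
  "mean p q = cov 1 2 p q"

text \<open>\<open>p\<close> and \<open>q\<close> shift the two components and \<open>l\<close>
  counts the dropped terms; the three sums of an estimator have parameters (0, 0, 0), (s, 0, s) and
  (0, s, s).\<close>

definition D :: "nat \<Rightarrow> nat \<Rightarrow> nat \<Rightarrow> nat \<Rightarrow> 'a \<Rightarrow> real" where
  "D p q l n \<omega> = (\<Sum>j=1..n - l. Y 1 (real (j + p)) \<omega> * Y 2 (real (j + q)) \<omega> - mean p q)"

lemma Y_gaussian_vector:
  assumes "finite P" "P \<subseteq> idx" shows "gaussian_vector M P (\<lambda>(i, t). Y i t)"
proof
  show "finite P" by fact
  show "centered_gaussian_process M P (\<lambda>(i, t). Y i t)"
    by (rule centered_gaussian_process_subset[OF Y_gaussian assms(2)])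
qed

lemma all_moments_Y:
  assumes "i \<in> {1, 2}" shows "all_moments M (Y i t)"
proof -
  interpret gaussian_vector M "{(i, t)}" "\<lambda>(i, t). Y i t"
    by (rule Y_gaussian_vector) (use assms in auto)
  show ?thesis using all_moments_X[of "(i, t)"] by simp
qed

lemma all_moments_D: "all_moments M (D p q l n)"
  unfolding D_def by (intro all_moments_intros all_moments_Y) auto

lemma expectation_product: "expectation (\<lambda>\<omega>. Y 1 (real (j + p)) \<omega> * Y 2 (real (j + q)) \<omega>) = mean p q"
  using cov_shift[of 1 2 p j q] by (simp add: mean_def cov_def add.commute)

lemma expectation_D: "expectation (D p q l n) = 0"
proof -
  have "expectation (D p q l n) = (\<Sum>j=1..n - l. expectation (\<lambda>\<omega>. Y 1 (real (j + p)) \<omega> * Y 2 (real (j + q)) \<omega> - mean p q))"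
    unfolding D_def by (intro Bochner_Integration.integral_sum all_moments_integrable all_moments_intros all_moments_Y) auto
  also have "\<dots> = 0"
  proof (intro sum.neutral ballI)
    fix j
    have "integrable M (\<lambda>\<omega>. Y 1 (real (j + p)) \<omega> * Y 2 (real (j + q)) \<omega>)"
      by (intro all_moments_integrable all_moments_intros all_moments_Y) auto
    then have "expectation (\<lambda>\<omega>. Y 1 (real (j + p)) \<omega> * Y 2 (real (j + q)) \<omega> - mean p q) =
        expectation (\<lambda>\<omega>. Y 1 (real (j + p)) \<omega> * Y 2 (real (j + q)) \<omega>) - expectation (\<lambda>_. mean p q)"
      by (intro Bochner_Integration.integral_diff) auto
    then show "expectation (\<lambda>\<omega>. Y 1 (real (j + p)) \<omega> * Y 2 (real (j + q)) \<omega> - mean p q) = 0"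
      unfolding expectation_product by (simp add: prob_space)
  qed
  finally show ?thesis .
qed

lemma expectation_product_product:
  "expectation (\<lambda>\<omega>. (Y 1 (real (j + p)) \<omega> * Y 2 (real (j + q)) \<omega> - mean p q) * (Y 1 (real (k + p')) \<omega> * Y 2 (real (k + q')) \<omega> - mean p' q'))
    = prodcov p q p' q' j k"
proof -
  let ?P = "{(1, real (j + p)), (2, real (j + q)), (1, real (k + p')), (2, real (k + q'))} :: (nat \<times> real) set"
  interpret V: gaussian_vector M ?P "\<lambda>(i, t). Y i t" by (rule Y_gaussian_vector) auto
  let ?a = "\<lambda>\<omega>. Y 1 (real (j + p)) \<omega> * Y 2 (real (j + q)) \<omega>" and ?b = "\<lambda>\<omega>. Y 1 (real (k + p')) \<omega> * Y 2 (real (k + q')) \<omega>"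
  have i: "integrable M ?a" "integrable M ?b" "integrable M (\<lambda>\<omega>. ?a \<omega> * ?b \<omega>)"
    by (intro all_moments_integrable all_moments_intros all_moments_Y; simp)+
  have "expectation (\<lambda>\<omega>. (?a \<omega> - mean p q) * (?b \<omega> - mean p' q')) =
    expectation (\<lambda>\<omega>. ?a \<omega> * ?b \<omega> - mean p' q' * ?a \<omega> - mean p q * ?b \<omega> + mean p q * mean p' q')"
    by (simp add: algebra_simps)
  also have "\<dots> = expectation (\<lambda>\<omega>. ?a \<omega> * ?b \<omega>) - mean p' q' * expectation ?a - mean p q * expectation ?b + mean p q * mean p' q'"
    using i by (simp add: prob_space del: of_nat_add)
  also have "\<dots> = expectation (\<lambda>\<omega>. ?a \<omega> * ?b \<omega>) - mean p q * mean p' q'"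
    unfolding expectation_product by simp
  also have "expectation (\<lambda>\<omega>. ?a \<omega> * ?b \<omega>) = cov 1 2 (j + p) (j + q) * cov 1 2 (k + p') (k + q') + prodcov p q p' q' j k"
    using V.isserlis4[of "(1, real (j + p))" "(2, real (j + q))" "(1, real (k + p'))" "(2, real (k + q'))"]
    by (simp add: V.C_def cov_def prodcov_def del: of_nat_add)
  also have "cov 1 2 (j + p) (j + q) = mean p q" using cov_shift[of 1 2 p j q] by (simp add: mean_def add.commute)
  also have "cov 1 2 (k + p') (k + q') = mean p' q'" using cov_shift[of 1 2 p' k q'] by (simp add: mean_def add.commute)
  finally show ?thesis by simp
qed

lemma expectation_D_D: "expectation (\<lambda>\<omega>. D p q l n \<omega> * D p' q' l' n \<omega>) = (\<Sum>j=1..n - l. \<Sum>k=1..n - l'. prodcov p q p' q' j k)"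
proof -
  let ?a = "\<lambda>j \<omega>. Y 1 (real (j + p)) \<omega> * Y 2 (real (j + q)) \<omega> - mean p q" and ?b = "\<lambda>k \<omega>. Y 1 (real (k + p')) \<omega> * Y 2 (real (k + q')) \<omega> - mean p' q'"
  have am: "all_moments M (?a j)" "all_moments M (?b j)" for j by (intro all_moments_intros all_moments_Y; simp)+
  have "expectation (\<lambda>\<omega>. D p q l n \<omega> * D p' q' l' n \<omega>) = expectation (\<lambda>\<omega>. \<Sum>j=1..n - l. \<Sum>k=1..n - l'. 1 * (?a j \<omega> * ?b k \<omega>))"
    unfolding D_def by (simp only: sum_product mult_1)
  also have "\<dots> = (\<Sum>j=1..n - l. \<Sum>k=1..n - l'. 1 * expectation (\<lambda>\<omega>. ?a j \<omega> * ?b k \<omega>))"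
    by (intro expectation_double_sum all_moments_mult am)
  finally show ?thesis unfolding expectation_product_product mult_1 .
qed

definition U :: "nat \<Rightarrow> real \<Rightarrow> real \<Rightarrow> real \<Rightarrow> nat \<Rightarrow> 'a \<Rightarrow> real" where
  "U s c1 c2 c3 n \<omega> = (1 / sqrt (real n * ln (real n))) * (c1 * D 0 0 0 n \<omega> + c2 * D s 0 s n \<omega> + c3 * D 0 s s n \<omega>)"

lemma all_moments_U: "all_moments M (U s c1 c2 c3 n)"
  unfolding U_def by (intro all_moments_intros all_moments_D)

lemma expectation_U: "expectation (U s c1 c2 c3 n) = 0"
proof -
  have i: "integrable M (D p q l n)" for p q l by (rule all_moments_integrable[OF all_moments_D])
  show ?thesis unfolding U_def by (simp add: i expectation_D)
qed

text \<open>All nine pairs of sums have the same limit 2 \<gamma>, so the limiting bilinear form has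
  rank at most one and sees only the sums of the coefficients.\<close>

lemma expectation_U_U_tendsto:
  "(\<lambda>n. expectation (\<lambda>\<omega>. U s c1 c2 c3 n \<omega> * U s d1 d2 d3 n \<omega>)) \<longlonglongrightarrow> (c1 + c2 + c3) * (d1 + d2 + d3) * (2 * \<gamma>)"
proof -
  define DD where "DD a b n = expectation (\<lambda>\<omega>. D (fst a) (fst (snd a)) (snd (snd a)) n \<omega> * D (fst b) (fst (snd b)) (snd (snd b)) n \<omega>)"
    for a b :: "nat \<times> nat \<times> nat" and n
  have DD: "(\<lambda>n. DD a b n / (real n * ln (real n))) \<longlonglongrightarrow> 2 * \<gamma>" for a b
    unfolding DD_def expectation_D_D by (rule prodcov_sum_tendsto)
  let ?x = "(0, 0, 0) :: nat \<times> nat \<times> nat" and ?y = "(s, 0, s) :: nat \<times> nat \<times> nat" and ?z = "(0, s, s) :: nat \<times> nat \<times> nat"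
  have i: "integrable M (\<lambda>\<omega>. D p q l n \<omega> * D p' q' l' n \<omega>)" for p q l p' q' l' n
    by (intro all_moments_integrable all_moments_mult all_moments_D)
  have eq: "expectation (\<lambda>\<omega>. U s c1 c2 c3 n \<omega> * U s d1 d2 d3 n \<omega>) =
      c1 * d1 * (DD ?x ?x n / (real n * ln (real n))) + c1 * d2 * (DD ?x ?y n / (real n * ln (real n))) + c1 * d3 * (DD ?x ?z n / (real n * ln (real n)))
    + c2 * d1 * (DD ?y ?x n / (real n * ln (real n))) + c2 * d2 * (DD ?y ?y n / (real n * ln (real n))) + c2 * d3 * (DD ?y ?z n / (real n * ln (real n)))
    + c3 * d1 * (DD ?z ?x n / (real n * ln (real n))) + c3 * d2 * (DD ?z ?y n / (real n * ln (real n))) + c3 * d3 * (DD ?z ?z n / (real n * ln (real n)))" for n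
  proof -
    have nn: "0 \<le> real n * ln (real n)" by (cases "n = 0") auto
    define \<theta> where "\<theta> = 1 / (real n * ln (real n))"
    have l: "1 / sqrt (real n * ln (real n)) * (1 / sqrt (real n * ln (real n))) = \<theta>"
      using nn by (simp add: \<theta>_def)
    have "U s c1 c2 c3 n \<omega> * U s d1 d2 d3 n \<omega> = \<theta> * (c1 * d1 * (D 0 0 0 n \<omega> * D 0 0 0 n \<omega>) + c1 * d2 * (D 0 0 0 n \<omega> * D s 0 s n \<omega>) + c1 * d3 * (D 0 0 0 n \<omega> * D 0 s s n \<omega>)
      + c2 * d1 * (D s 0 s n \<omega> * D 0 0 0 n \<omega>) + c2 * d2 * (D s 0 s n \<omega> * D s 0 s n \<omega>) + c2 * d3 * (D s 0 s n \<omega> * D 0 s s n \<omega>)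
      + c3 * d1 * (D 0 s s n \<omega> * D 0 0 0 n \<omega>) + c3 * d2 * (D 0 s s n \<omega> * D s 0 s n \<omega>) + c3 * d3 * (D 0 s s n \<omega> * D 0 s s n \<omega>))" for \<omega>
    proof -
      have "U s c1 c2 c3 n \<omega> * U s d1 d2 d3 n \<omega> =
      \<theta> * ((c1 * D 0 0 0 n \<omega> + c2 * D s 0 s n \<omega> + c3 * D 0 s s n \<omega>) * (d1 * D 0 0 0 n \<omega> + d2 * D s 0 s n \<omega> + d3 * D 0 s s n \<omega>))"
      unfolding U_def l[symmetric] by (simp only: mult_ac)
      then show ?thesis by (simp only: distrib_left distrib_right mult_ac add_ac)
    qed
    then have "expectation (\<lambda>\<omega>. U s c1 c2 c3 n \<omega> * U s d1 d2 d3 n \<omega>) =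
      \<theta> * (c1 * d1 * DD ?x ?x n + c1 * d2 * DD ?x ?y n + c1 * d3 * DD ?x ?z n
      + c2 * d1 * DD ?y ?x n + c2 * d2 * DD ?y ?y n + c2 * d3 * DD ?y ?z n
      + c3 * d1 * DD ?z ?x n + c3 * d2 * DD ?z ?y n + c3 * d3 * DD ?z ?z n)"
      by (simp add: DD_def i)
    then show ?thesis by (simp add: \<theta>_def algebra_simps add_divide_distrib)
  qed
  have "(\<lambda>n. expectation (\<lambda>\<omega>. U s c1 c2 c3 n \<omega> * U s d1 d2 d3 n \<omega>)) \<longlonglongrightarrow>
      c1 * d1 * (2 * \<gamma>) + c1 * d2 * (2 * \<gamma>) + c1 * d3 * (2 * \<gamma>)
    + c2 * d1 * (2 * \<gamma>) + c2 * d2 * (2 * \<gamma>) + c2 * d3 * (2 * \<gamma>)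
    + c3 * d1 * (2 * \<gamma>) + c3 * d2 * (2 * \<gamma>) + c3 * d3 * (2 * \<gamma>)"
    unfolding eq by (intro tendsto_add tendsto_mult tendsto_const DD)
  then show ?thesis by (simp add: algebra_simps)
qed

text \<open>Nonnegativity comes from the limit of second moments: up to a positive factor the second
  summand of \<gamma> is the product of \<rho> + \<eta> 1 2 and \<rho> - \<eta> 1 2, which may be
  negative.\<close>

lemma \<gamma>_nonneg: "0 \<le> \<gamma>"
proof -
  have "(\<lambda>n. expectation (\<lambda>\<omega>. U 1 1 0 0 n \<omega> * U 1 1 0 0 n \<omega>)) \<longlonglongrightarrow> 2 * \<gamma>"
    using expectation_U_U_tendsto[of 1 1 0 0 1 0 0] by simp
  then have "0 \<le> 2 * \<gamma>" by (rule LIMSEQ_le_const) (auto intro!: integral_nonneg_AE)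
  then show ?thesis by simp
qed

end

section \<open>The simultaneous product sum as a quadratic form, and its normal limit\<close>

context bivariate_fou
begin

abbreviation "YY \<equiv> \<lambda>(i, t). Y i t"

definition PP :: "nat \<Rightarrow> (nat \<times> real) set" where
  "PP n = {1, 2} \<times> real ` {1..n}"

definition \<theta> :: "nat \<Rightarrow> real" where
  "\<theta> n = 1 / sqrt (real n * ln (real n))"

text \<open>Each product is split evenly over the two orders of its factors to make the matrix
  symmetric; the norming is built in.\<close>

definition AA :: "nat \<Rightarrow> nat \<times> real \<Rightarrow> nat \<times> real \<Rightarrow> real" where
  "AA n p q = (if fst p \<noteq> fst q \<and> snd p = snd q then \<theta> n / 2 else 0)"

lemma gaussian_quadratic_n: "gaussian_quadratic M (PP n) YY (AA n)"
proof (intro gaussian_quadratic.intro gaussian_quadratic_axioms.intro)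
  show "gaussian_vector M (PP n) YY" by (rule Y_gaussian_vector) (auto simp: PP_def)
  show "AA n p q = AA n q p" for p q by (auto simp: AA_def)
qed

lemma sum_PP: "(\<Sum>p\<in>PP n. f p) = (\<Sum>t=1..n. f (1, real t)) + (\<Sum>t=1..n. f (2, real t))"
proof -
  have "(\<Sum>p\<in>PP n. f p) = (\<Sum>i\<in>{1, 2}. \<Sum>t\<in>real ` {1..n}. f (i, t))"
    unfolding PP_def by (rule sum.cartesian_product')
  also have "\<dots> = (\<Sum>i\<in>{1, 2}. \<Sum>t=1..n. f (i, real t))"
    by (intro sum.cong refl, subst sum.reindex) auto
  finally show ?thesis by simp
qed

lemma sum_AA:
  assumes "t \<in> {1..n}"
  shows "(\<Sum>q\<in>PP n. AA n (1, real t) q * f q) = \<theta> n / 2 * f (2, real t)"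
    and "(\<Sum>q\<in>PP n. AA n (2, real t) q * f q) = \<theta> n / 2 * f (1, real t)"
proof -
  have d: "(\<Sum>u=1..n. (if t = u then \<theta> n / 2 else 0) * g u) = \<theta> n / 2 * g t" for g
    using assms by (simp add: if_distrib[of "\<lambda>x. x * _"] cong: if_cong)
  show "(\<Sum>q\<in>PP n. AA n (1, real t) q * f q) = \<theta> n / 2 * f (2, real t)"
    unfolding sum_PP using d[of "\<lambda>u. f (2, real u)"] by (simp add: AA_def)
  show "(\<Sum>q\<in>PP n. AA n (2, real t) q * f q) = \<theta> n / 2 * f (1, real t)"
    unfolding sum_PP using d[of "\<lambda>u. f (1, real u)"] by (simp add: AA_def)
qed

lemma C_eq_cov: "gaussian_vector.C M YY (i, real t) (j, real u) = cov i j t u"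
proof -
  \<comment> \<open>\<open>C\<close> is determined by M and the process, so any instance serves to
    unfold it.\<close>
  interpret gaussian_quadratic M "PP 0" YY "AA 0" by (rule gaussian_quadratic_n)
  show ?thesis by (simp add: C_def cov_def)
qed

lemma Q_eq_U: "gaussian_quadratic.Q M (PP n) YY (AA n) = U s 1 0 0 n"
proof
  fix \<omega>
  interpret V: gaussian_quadratic M "PP n" YY "AA n" by (rule gaussian_quadratic_n)
  have T0: "V.T 0 = (\<Sum>t=1..n. \<theta> n * mean 0 0)"
  proof -
    have "V.T 0 = (\<Sum>t=1..n. \<theta> n / 2 * cov 2 1 t t) + (\<Sum>t=1..n. \<theta> n / 2 * cov 1 2 t t)"
      unfolding V.T_def V.tr_def V.mm_def V.pow.simps sum_PP[of "\<lambda>p. \<Sum>r\<in>PP n. AA n p r * V.C r p"]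
      by (intro arg_cong2[where f="(+)"] sum.cong refl) (simp_all only: sum_AA C_eq_cov)
    also have "\<dots> = (\<Sum>t=1..n. \<theta> n / 2 * mean 0 0) + (\<Sum>t=1..n. \<theta> n / 2 * mean 0 0)"
    proof -
      have "cov 1 2 t t = mean 0 0" for t using cov_shift[of 1 2 0 t 0] by (simp add: mean_def)
      then show ?thesis by (simp only: cov_commute[of 2 1])
    qed
    finally show ?thesis by (simp add: sum.distrib[symmetric])
  qed
  have "(\<Sum>p\<in>PP n. \<Sum>q\<in>PP n. AA n p q * (YY p \<omega> * YY q \<omega>)) =
    (\<Sum>t=1..n. \<theta> n / 2 * (Y 1 (real t) \<omega> * Y 2 (real t) \<omega>)) + (\<Sum>t=1..n. \<theta> n / 2 * (Y 2 (real t) \<omega> * Y 1 (real t) \<omega>))"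
    unfolding sum_PP[of "\<lambda>p. \<Sum>q\<in>PP n. AA n p q * (YY p \<omega> * YY q \<omega>)"]
    by (intro arg_cong2[where f="(+)"] sum.cong refl) (simp_all only: sum_AA prod.case)
  also have "\<dots> = (\<Sum>t=1..n. \<theta> n * (Y 1 (real t) \<omega> * Y 2 (real t) \<omega>))"
    unfolding sum.distrib[symmetric] by (intro sum.cong refl) (simp add: field_simps)
  finally have "V.Q \<omega> = (\<Sum>t=1..n. \<theta> n * (Y 1 (real t) \<omega> * Y 2 (real t) \<omega> - mean 0 0))"
    unfolding V.Q_def T0 by (simp only: sum_subtractf[symmetric] right_diff_distrib)
  then show "V.Q \<omega> = U s 1 0 0 n \<omega>"
    by (simp add: U_def D_def \<theta>_def sum_distrib_left)
qed

lemma cov_row_sum: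
  assumes i: "i \<in> {1, 2}" and j: "j \<in> {1, 2}"
  shows "\<exists>K>0. \<forall>n. \<forall>t\<in>{1..n}. (\<Sum>u=1..n. \<bar>cov i j t u\<bar>) \<le> K * real n powr (h i j - 1)"
proof -
  obtain K where K: "K > 0" "\<And>m. \<bar>r i j (real m)\<bar> \<le> K * (real m + 1) powr (h i j - 2)" by (rule cov_bound[OF i j]) auto
  obtain K' where K': "K' > 0" "\<And>m. \<bar>r j i (real m)\<bar> \<le> K' * (real m + 1) powr (h i j - 2)"
    using cov_bound[OF j i] by (metis add.commute h_def)
  have e: "-1 < h i j - 2" "h i j - 2 < 0" using power_kernel_ij[OF i j] by (auto simp: power_kernel_def)
  interpret G: toeplitz_kernel "\<lambda>t u. cov i j (Suc t) (Suc u)" "\<lambda>m. r i j (real m)" "\<lambda>m. r j i (real m)"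
  proof
    show "cov i j (Suc (t + m)) (Suc t) = r i j (real m)" for t m using cov_lower[OF i j, of "Suc t" m] by simp
    show "cov i j (Suc t) (Suc (t + m)) = r j i (real m)" for t m using cov_upper[OF i j, of "Suc t" m] by simp
  qed
  have S: "(\<Sum>m<n. (real m + 1) powr (h i j - 2)) \<le> real n powr (h i j - 1) / (h i j - 1)" for n
    using sum_powr_le[OF e, of n] by simp
  show ?thesis
  proof (intro exI[of _ "(K + K') / (h i j - 1)"] conjI allI ballI)
    show "0 < (K + K') / (h i j - 1)" using K K' e by simp
    fix n t :: nat assume t: "t \<in> {1..n}"
    then obtain t' where t': "t = Suc t'" "t' < n" by (cases t) auto
    have "(\<Sum>u=1..n. \<bar>cov i j t u\<bar>) = (\<Sum>u<n. \<bar>cov i j (Suc t') (Suc u)\<bar>)"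
      unfolding t' by (simp add: sum.atLeast1_atMost_eq)
    also have "\<dots> \<le> (\<Sum>m<n. \<bar>r i j (real m)\<bar>) + (\<Sum>m<n. \<bar>r j i (real m)\<bar>)" by (rule G.row_le[OF t'(2)])
    also have "\<dots> \<le> (\<Sum>m<n. K * (real m + 1) powr (h i j - 2)) + (\<Sum>m<n. K' * (real m + 1) powr (h i j - 2))"
      by (intro add_mono sum_mono K K')
    also have "\<dots> = (K + K') * (\<Sum>m<n. (real m + 1) powr (h i j - 2))"
      by (subst distrib_right) (simp only: sum_distrib_left)
    also have "\<dots> \<le> (K + K') * (real n powr (h i j - 1) / (h i j - 1))"
      using K K' by (intro mult_left_mono S) auto
    finally show "(\<Sum>u=1..n. \<bar>cov i j t u\<bar>) \<le> (K + K') / (h i j - 1) * real n powr (h i j - 1)" by simp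
  qed
qed

lemma cov_row_sum_uniform:
  obtains K where "K > 0" "\<And>i j n t. i \<in> {1, 2} \<Longrightarrow> j \<in> {1, 2} \<Longrightarrow> t \<in> {1..n} \<Longrightarrow>
    (\<Sum>u=1..n. \<bar>cov i j t u\<bar>) \<le> K * real n powr (h i j - 1)"
proof -
  have "\<forall>i\<in>{1, 2}. \<forall>j\<in>{1, 2}. \<exists>K>0. \<forall>n. \<forall>t\<in>{1..n}. (\<Sum>u=1..n. \<bar>cov i j t u\<bar>) \<le> K * real n powr (h i j - 1)"
    using cov_row_sum by blast
  then obtain k where k: "\<And>i j. i \<in> {1, 2} \<Longrightarrow> j \<in> {1, 2} \<Longrightarrow> k i j > 0"
    "\<And>i j n t. i \<in> {1, 2} \<Longrightarrow> j \<in> {1, 2} \<Longrightarrow> t \<in> {1..n} \<Longrightarrow> (\<Sum>u=1..n. \<bar>cov i j t u\<bar>) \<le> k i j * real n powr (h i j - 1)"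
    by metis
  define K where "K = k 1 1 + k 1 2 + (k 2 1 + k 2 2)"
  have p: "k 1 1 > 0" "k 1 2 > 0" "k 2 1 > 0" "k 2 2 > 0" using k(1) by auto
  have le: "k i j \<le> K" if "i \<in> {1, 2}" "j \<in> {1, 2}" for i j using that p unfolding K_def by auto
  show ?thesis
  proof (rule that)
    show "K > 0" using p by (simp add: K_def)
    show "(\<Sum>u=1..n. \<bar>cov i j t u\<bar>) \<le> K * real n powr (h i j - 1)" if "i \<in> {1, 2}" "j \<in> {1, 2}" "t \<in> {1..n}" for i j n t
      using k(2)[OF that] le[OF that(1,2)] by (meson mult_right_mono order_trans powr_ge_zero)
  qed
qed

text \<open>The weights \<open>n powr - H i\<close> balance the growth rates \<open>n powr (H i + H j - 1)\<close> of the row sums of the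
  four covariance blocks; this is where \<open>H 1 + H 2 = 3 / 2\<close> enters the size of the spectral radius.\<close>

lemma T_tendsto_0:
  assumes j: "j \<ge> 2"
  shows "(\<lambda>n. gaussian_quadratic.T M (PP n) YY (AA n) j) \<longlonglongrightarrow> 0"
proof -
  obtain K where K: "K > 0" "\<And>i j n t. i \<in> {1, 2} \<Longrightarrow> j \<in> {1, 2} \<Longrightarrow> t \<in> {1..n} \<Longrightarrow>
    (\<Sum>u=1..n. \<bar>cov i j t u\<bar>) \<le> K * real n powr (h i j - 1)" by (rule cov_row_sum_uniform) blast
  \<comment> \<open>\<open>T_decay\<close> leaves at least one factor \<open>R n\<close>, which
    tends to 0, beside the trace \<open>T 1\<close>, which converges to \<gamma>.\<close>
  obtain j' where j': "j = Suc j'" "j' \<ge> 1" using j by (cases j) auto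
  define R where "R n = K / sqrt (ln (real n))" for n
  define T1 where "T1 n = gaussian_quadratic.T M (PP n) YY (AA n) 1" for n
  have bound: "\<bar>gaussian_quadratic.T M (PP n) YY (AA n) (Suc j')\<bar> \<le> R n ^ j' * T1 n" if n: "n \<ge> 2" for n
  proof -
    interpret V: gaussian_quadratic M "PP n" YY "AA n" by (rule gaussian_quadratic_n)
    have ln: "ln (real n) > 0" using n by simp
    define w where "w p = real n powr (- H (fst p))" for p :: "nat \<times> real"
    have th: "\<theta> n = 1 / (sqrt (real n) * sqrt (ln (real n)))" by (simp add: \<theta>_def real_sqrt_mult)
    have th0: "\<theta> n > 0" using n ln by (simp add: th)
    \<comment> \<open>From H a + H b = 3/2 one gets H a - 1 = 1/2 - H b; the square root of n
      cancels against the norming and only 1 / sqrt (ln n) is left.\<close>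
    have thR: "\<theta> n * K * real n powr (H a - 1) = R n * real n powr (- H b)" if "H a + H b = 3 / 2" for a b
    proof -
      have "real n powr (H a - 1) = real n powr (1 / 2 + - H b)" using that by (intro arg_cong[where f="\<lambda>x. real n powr x"]) simp
      also have "\<dots> = sqrt (real n) * real n powr (- H b)" unfolding powr_add using n by (simp add: powr_half_sqrt)
      finally show ?thesis unfolding th R_def using n ln by (simp add: field_simps)
    qed
    have row: "(\<Sum>q\<in>PP n. \<bar>V.mm (AA n) V.C p q\<bar> * w q) \<le> R n * w p" if p: "p \<in> PP n" for p
    proof -
      obtain a t where a: "p = (a, real t)" "a \<in> {1, 2}" "t \<in> {1..n}" using p by (auto simp: PP_def)
      \<comment> \<open>The other component: A exchanges the two components, so a row of A C is a
        multiple of a row of C for component b.\<close>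
      define b :: nat where "b = 3 - a"
      have b: "b \<in> {1, 2}" "H b + H a = 3 / 2" using a(2) H_sum by (auto simp: b_def)
      have mm: "V.mm (AA n) V.C p q = \<theta> n / 2 * V.C (b, real t) q" for q
        using a(2) sum_AA[OF a(3), of "\<lambda>r. V.C r q"] unfolding V.mm_def a(1) b_def by auto
      have e: "(\<Sum>u=1..n. \<bar>\<theta> n / 2 * cov b c t u\<bar> * real n powr (- H c)) \<le> \<theta> n / 2 * K * real n powr (H b - 1)"
        if c: "c \<in> {1, 2}" for c
      proof -
        have "(\<Sum>u=1..n. \<bar>\<theta> n / 2 * cov b c t u\<bar> * real n powr (- H c)) = \<theta> n / 2 * real n powr (- H c) * (\<Sum>u=1..n. \<bar>cov b c t u\<bar>)"
          using th0 by (simp add: sum_distrib_left abs_mult mult_ac)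
        also have "\<dots> \<le> \<theta> n / 2 * real n powr (- H c) * (K * real n powr (h b c - 1))"
          using th0 by (intro mult_left_mono K(2) b c a) auto
        also have "\<dots> = \<theta> n / 2 * K * (real n powr (- H c) * real n powr (h b c - 1))" by simp
        \<comment> \<open>The weight of column block c cancels \<open>H c\<close> in the growth rate
          of the row sum, so both blocks obey the same bound.\<close>
        also have "real n powr (- H c) * real n powr (h b c - 1) = real n powr (H b - 1)"
          unfolding powr_add[symmetric] by (rule arg_cong[where f="\<lambda>x. real n powr x"]) (simp add: h_def)
        finally show ?thesis .
      qed
      have "(\<Sum>q\<in>PP n. \<bar>V.mm (AA n) V.C p q\<bar> * w q) =
        (\<Sum>u=1..n. \<bar>\<theta> n / 2 * cov b 1 t u\<bar> * real n powr (- H 1)) + (\<Sum>u=1..n. \<bar>\<theta> n / 2 * cov b 2 t u\<bar> * real n powr (- H 2))"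
        unfolding mm sum_PP w_def C_eq_cov fst_conv ..
      also have "\<dots> \<le> \<theta> n / 2 * K * real n powr (H b - 1) + \<theta> n / 2 * K * real n powr (H b - 1)"
        by (intro add_mono e) auto
      also have "\<dots> = R n * w p" using thR[OF b(2)] by (simp add: w_def a(1))
      finally show ?thesis .
    qed
    show ?thesis
      unfolding T1_def
    proof (rule V.T_decay[where w=w])
      show "R n > 0" using K ln by (simp add: R_def)
    qed (use row n in \<open>auto simp: w_def\<close>)
  qed
  have "(\<lambda>n. expectation (\<lambda>\<omega>. U 1 1 0 0 n \<omega> * U 1 1 0 0 n \<omega>)) \<longlonglongrightarrow> 2 * \<gamma>"
    using expectation_U_U_tendsto[of 1 1 0 0 1 0 0] by simp
  moreover have "expectation (\<lambda>\<omega>. U 1 1 0 0 n \<omega> * U 1 1 0 0 n \<omega>) = 2 * T1 n" for n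
  proof -
    interpret V: gaussian_quadratic M "PP n" YY "AA n" by (rule gaussian_quadratic_n)
    show ?thesis using V.m_2 unfolding V.m_def Q_eq_U[of n 1] T1_def by (simp add: power2_eq_square)
  qed
  ultimately have "(\<lambda>n. 2 * T1 n) \<longlonglongrightarrow> 2 * \<gamma>" by simp
  from tendsto_mult[OF tendsto_const[of "1/2"] this] have T1: "T1 \<longlonglongrightarrow> \<gamma>" by simp
  have "R \<longlonglongrightarrow> 0" unfolding R_def by real_asymp
  then have "(\<lambda>n. R n ^ j' * T1 n) \<longlonglongrightarrow> 0 ^ j' * \<gamma>" by (intro tendsto_mult tendsto_power T1)
  then have "(\<lambda>n. R n ^ j' * T1 n) \<longlonglongrightarrow> 0" using j' by (simp add: power_0_left)
  then show ?thesis
    unfolding j'(1)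
    by (rule Lim_null_comparison[rotated]) (use bound in \<open>auto simp: eventually_sequentially intro!: exI[of _ 2]\<close>)
qed

lemma U_weak_conv: "weak_conv_m (\<lambda>n. distr M borel (U s 1 0 0 n)) (normal_law 0 (2 * \<gamma>))"
proof (rule moments_imp_weak_conv_normal)
  have Um: "U s 1 0 0 n \<in> borel_measurable M" for n by (rule all_moments_measurable[OF all_moments_U])
  have Ui: "integrable M (\<lambda>\<omega>. U s 1 0 0 n \<omega> ^ k)" for n k by (intro all_moments_integrable all_moments_power all_moments_U)
  show "real_distribution (distr M borel (U s 1 0 0 n))" for n by (rule real_distribution_distr[OF Um])
  show "integrable (distr M borel (U s 1 0 0 n)) (\<lambda>x. x ^ k)" for n k
    using Um Ui by (subst integrable_distr_eq) auto
  show v: "0 \<le> 2 * \<gamma>" using \<gamma>_nonneg by simp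
  fix k
  let ?m = "\<lambda>n. gaussian_quadratic.m M (PP n) YY (AA n)" and ?u = "\<lambda>n. gaussian_quadratic.u M (PP n) YY (AA n)"
    and ?T = "\<lambda>n. gaussian_quadratic.T M (PP n) YY (AA n)"
  have "(\<lambda>n. ?m n k) \<longlonglongrightarrow> (LINT x|normal_law 0 (2 * \<gamma>). x ^ k)"
  proof (rule second_chaos_moments_tendsto[where u="?u" and T="?T"])
    show "?m n 0 = 1" for n by (rule gaussian_quadratic.m_0[OF gaussian_quadratic_n])
    show "?m n (Suc k) = 2 * real k * ?u n 1 (k - 1)" for n k by (rule gaussian_quadratic.m_Suc[OF gaussian_quadratic_n])
    show "?u n j k = ?T n j * ?m n k + 2 * real k * ?u n (Suc j) (k - 1)" for n j k
      by (rule gaussian_quadratic.u_rec[OF gaussian_quadratic_n])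
    show "(\<lambda>n. ?T n j) \<longlonglongrightarrow> 0" if "j \<ge> 2" for j by (rule T_tendsto_0[OF that])
    have "2 * ?T n 1 = expectation (\<lambda>\<omega>. U s 1 0 0 n \<omega> * U s 1 0 0 n \<omega>)" for n
      using gaussian_quadratic.m_2[OF gaussian_quadratic_n, of n]
      unfolding gaussian_quadratic.m_def[OF gaussian_quadratic_n] Q_eq_U[of n s] by (simp add: power2_eq_square)
    then show "(\<lambda>n. 2 * ?T n 1) \<longlonglongrightarrow> 2 * \<gamma>" using expectation_U_U_tendsto[of s 1 0 0 1 0 0] by simp
  qed (rule v)
  moreover have "?m n k = (LINT x|distr M borel (U s 1 0 0 n). x ^ k)" for n
    unfolding gaussian_quadratic.m_def[OF gaussian_quadratic_n] Q_eq_U[of n s]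
    using Um by (subst integral_distr) auto
  ultimately show "(\<lambda>n. LINT x|distr M borel (U s 1 0 0 n). x ^ k) \<longlonglongrightarrow> (LINT x|normal_law 0 (2 * \<gamma>). x ^ k)" by simp
qed

section \<open>Estimation errors and their reduction to a single sum\<close>

definition err :: "nat \<Rightarrow> real \<Rightarrow> real \<Rightarrow> real \<Rightarrow> real \<Rightarrow> nat \<Rightarrow> 'a \<Rightarrow> real" where
  "err s c1 c2 c3 z n \<omega> = sqrt (real n / ln (real n)) * (cross_estimator c1 c2 c3 s Y n \<omega> - z)"

text \<open>The lagged sums have n - s terms but are divided by n; this is the resulting
  deterministic error after norming, of order 1 / sqrt (n ln n).\<close>

definition bias :: "nat \<Rightarrow> real \<Rightarrow> real \<Rightarrow> nat \<Rightarrow> real" where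
  "bias s c2 c3 n = - (sqrt (real n / ln (real n)) * (real s / real n) * (c2 * mean s 0 + c3 * mean 0 s))"

lemma bias_tendsto: "(\<lambda>n. bias s c2 c3 n) \<longlonglongrightarrow> 0"
proof -
  have "(\<lambda>n. - (sqrt (real n / ln (real n)) * (real s / real n) * (c2 * mean s 0 + c3 * mean 0 s))) \<longlonglongrightarrow> - (0 * (c2 * mean s 0 + c3 * mean 0 s))"
    by (intro tendsto_minus tendsto_mult tendsto_const) real_asymp
  then show ?thesis unfolding bias_def by simp
qed

lemma all_moments_err: "all_moments M (err s c1 c2 c3 z n)"
  unfolding err_def cross_estimator_def
  by (intro all_moments_intros all_moments_Y) auto

text \<open>The condition on z says that the same combination of true covariances equals the
  parameter. n \<ge> 2 makes ln n positive, and n \<ge> s rules out truncation in n - s.\<close>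

lemma err_eq:
  assumes z: "c1 * mean 0 0 + c2 * mean s 0 + c3 * mean 0 s = z" and n: "n \<ge> 2" "n \<ge> s"
  shows "err s c1 c2 c3 z n \<omega> = U s c1 c2 c3 n \<omega> + bias s c2 c3 n"
proof -
  define S1 where "S1 = (\<Sum>j=1..n. Y 1 (real j) \<omega> * Y 2 (real j) \<omega>)"
  define S2 where "S2 = (\<Sum>j=1..n - s. Y 1 (real (j + s)) \<omega> * Y 2 (real j) \<omega>)"
  define S3 where "S3 = (\<Sum>j=1..n - s. Y 1 (real j) \<omega> * Y 2 (real (j + s)) \<omega>)"
  define q where "q = sqrt (real n / ln (real n))"
  have n0: "real n \<noteq> 0" using n by simp
  have ln: "ln (real n) > 0" using n by simp
  have D: "D 0 0 0 n \<omega> = S1 - real n * mean 0 0" "D s 0 s n \<omega> = S2 - (real n - real s) * mean s 0"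
    "D 0 s s n \<omega> = S3 - (real n - real s) * mean 0 s"
    using n by (simp_all add: D_def S1_def S2_def S3_def sum_subtractf of_nat_diff)
  have q: "1 / sqrt (real n * ln (real n)) = q / real n"
  proof -
    have "q / real n = (sqrt (real n) / real n) / sqrt (ln (real n))" by (simp add: q_def real_sqrt_divide)
    also have "sqrt (real n) / real n = 1 / sqrt (real n)" using n0 by (simp add: real_div_sqrt field_simps)
    finally show ?thesis by (simp add: real_sqrt_mult)
  qed
  have "cross_estimator c1 c2 c3 s Y n \<omega> = (c1 * S1 + c2 * S2 + c3 * S3) / real n"
    by (simp add: cross_estimator_def S1_def S2_def S3_def add_divide_distrib)
  then have "err s c1 c2 c3 z n \<omega> = q * ((c1 * S1 + c2 * S2 + c3 * S3) / real n - z)"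
    by (simp add: err_def q_def)
  also have "\<dots> = q / real n * (c1 * S1 + c2 * S2 + c3 * S3 - real n * z)"
    using n0 by (simp add: field_simps)
  also have "\<dots> = q / real n * (c1 * D 0 0 0 n \<omega> + c2 * D s 0 s n \<omega> + c3 * D 0 s s n \<omega>) + bias s c2 c3 n"
    unfolding D z[symmetric] bias_def q_def[symmetric] using n0 by (simp add: field_simps)
  finally show ?thesis unfolding U_def q .
qed

lemma eventually_err_eq:
  assumes "c1 * mean 0 0 + c2 * mean s 0 + c3 * mean 0 s = z"
  shows "eventually (\<lambda>n. \<forall>\<omega>. err s c1 c2 c3 z n \<omega> = U s c1 c2 c3 n \<omega> + bias s c2 c3 n) sequentially"
  using eventually_ge_at_top[of "max 2 s"] by eventually_elim (auto intro: err_eq[OF assms])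

lemma U_integrable: "integrable M (U s c1 c2 c3 n)" "integrable M (\<lambda>\<omega>. U s c1 c2 c3 n \<omega> * U s d1 d2 d3 n \<omega>)"
  by (intro all_moments_integrable all_moments_intros all_moments_U)+

lemma expectation_U_plus:
  "expectation (\<lambda>\<omega>. (U s c1 c2 c3 n \<omega> + x) * (U s d1 d2 d3 n \<omega> + y)) = expectation (\<lambda>\<omega>. U s c1 c2 c3 n \<omega> * U s d1 d2 d3 n \<omega>) + x * y"
proof -
  have "expectation (\<lambda>\<omega>. (U s c1 c2 c3 n \<omega> + x) * (U s d1 d2 d3 n \<omega> + y)) =
    expectation (\<lambda>\<omega>. U s c1 c2 c3 n \<omega> * U s d1 d2 d3 n \<omega> + y * U s c1 c2 c3 n \<omega> + x * U s d1 d2 d3 n \<omega> + x * y)"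
    by (simp add: algebra_simps)
  then show ?thesis using U_integrable by (simp add: expectation_U prob_space)
qed

lemma variance_err_tendsto:
  assumes z: "c1 * mean 0 0 + c2 * mean s 0 + c3 * mean 0 s = z"
  shows "(\<lambda>n. variance (err s c1 c2 c3 z n)) \<longlonglongrightarrow> (c1 + c2 + c3)\<^sup>2 * (2 * \<gamma>)"
proof -
  have "(\<lambda>n. expectation (\<lambda>\<omega>. U s c1 c2 c3 n \<omega> * U s c1 c2 c3 n \<omega>)) \<longlonglongrightarrow> (c1 + c2 + c3)\<^sup>2 * (2 * \<gamma>)"
    using expectation_U_U_tendsto[of s c1 c2 c3 c1 c2 c3] by (simp add: power2_eq_square)
  moreover have "eventually (\<lambda>n. expectation (\<lambda>\<omega>. U s c1 c2 c3 n \<omega> * U s c1 c2 c3 n \<omega>) = variance (err s c1 c2 c3 z n)) sequentially"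
    using eventually_err_eq[OF z]
  proof eventually_elim
    case (elim n)
    have "err s c1 c2 c3 z n = (\<lambda>\<omega>. U s c1 c2 c3 n \<omega> + bias s c2 c3 n)" using elim by auto
    moreover have "expectation (\<lambda>\<omega>. U s c1 c2 c3 n \<omega> + bias s c2 c3 n) = bias s c2 c3 n"
      using U_integrable by (simp add: expectation_U prob_space)
    ultimately show ?case by (simp add: power2_eq_square)
  qed
  ultimately show ?thesis by (rule Lim_transform_eventually)
qed

lemma expectation_err_err_tendsto:
  assumes z: "c1 * mean 0 0 + c2 * mean s 0 + c3 * mean 0 s = z" and y: "d1 * mean 0 0 + d2 * mean s 0 + d3 * mean 0 s = y"
  shows "(\<lambda>n. expectation (\<lambda>\<omega>. err s c1 c2 c3 z n \<omega> * err s d1 d2 d3 y n \<omega>)) \<longlonglongrightarrow> (c1 + c2 + c3) * (d1 + d2 + d3) * (2 * \<gamma>)"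
proof -
  have "(\<lambda>n. expectation (\<lambda>\<omega>. U s c1 c2 c3 n \<omega> * U s d1 d2 d3 n \<omega>) + bias s c2 c3 n * bias s d2 d3 n)
      \<longlonglongrightarrow> (c1 + c2 + c3) * (d1 + d2 + d3) * (2 * \<gamma>) + 0 * 0"
    by (intro tendsto_add tendsto_mult bias_tendsto expectation_U_U_tendsto)
  then have l: "(\<lambda>n. expectation (\<lambda>\<omega>. U s c1 c2 c3 n \<omega> * U s d1 d2 d3 n \<omega>) + bias s c2 c3 n * bias s d2 d3 n)
      \<longlonglongrightarrow> (c1 + c2 + c3) * (d1 + d2 + d3) * (2 * \<gamma>)" by simp
  show ?thesis
  proof (rule Lim_transform_eventually[OF l])
    show "eventually (\<lambda>n. expectation (\<lambda>\<omega>. U s c1 c2 c3 n \<omega> * U s d1 d2 d3 n \<omega>) + bias s c2 c3 n * bias s d2 d3 n =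
      expectation (\<lambda>\<omega>. err s c1 c2 c3 z n \<omega> * err s d1 d2 d3 y n \<omega>)) sequentially"
      using eventually_err_eq[OF z] eventually_err_eq[OF y] by eventually_elim (simp add: expectation_U_plus)
  qed
qed

text \<open>Subtracting the multiple c1 + c2 + c3 of the simultaneous sum leaves coefficients that
  add up to 0, for which the limiting second moment vanishes.\<close>

lemma err_approx:
  assumes z: "c1 * mean 0 0 + c2 * mean s 0 + c3 * mean 0 s = z"
  shows "(\<lambda>n. expectation (\<lambda>\<omega>. (err s c1 c2 c3 z n \<omega> - (c1 + c2 + c3) * U s 1 0 0 n \<omega>)\<^sup>2)) \<longlonglongrightarrow> 0"
proof -
  let ?c = "c1 - (c1 + c2 + c3)"
  have "(\<lambda>n. expectation (\<lambda>\<omega>. U s ?c c2 c3 n \<omega> * U s ?c c2 c3 n \<omega>) + bias s c2 c3 n * bias s c2 c3 n) \<longlonglongrightarrow> (?c + c2 + c3) * (?c + c2 + c3) * (2 * \<gamma>) + 0 * 0"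
    by (intro tendsto_add tendsto_mult bias_tendsto expectation_U_U_tendsto)
  then have l: "(\<lambda>n. expectation (\<lambda>\<omega>. U s ?c c2 c3 n \<omega> * U s ?c c2 c3 n \<omega>) + bias s c2 c3 n * bias s c2 c3 n) \<longlonglongrightarrow> 0" by simp
  have U: "U s c1 c2 c3 n \<omega> + b - (c1 + c2 + c3) * U s 1 0 0 n \<omega> = U s ?c c2 c3 n \<omega> + b" for n \<omega> b
    by (simp add: U_def algebra_simps add_divide_distrib)
  show ?thesis
  proof (rule Lim_transform_eventually[OF l])
    show "eventually (\<lambda>n. expectation (\<lambda>\<omega>. U s ?c c2 c3 n \<omega> * U s ?c c2 c3 n \<omega>) + bias s c2 c3 n * bias s c2 c3 n =
      expectation (\<lambda>\<omega>. (err s c1 c2 c3 z n \<omega> - (c1 + c2 + c3) * U s 1 0 0 n \<omega>)\<^sup>2)) sequentially"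
      using eventually_err_eq[OF z] by eventually_elim (simp only: U power2_eq_square expectation_U_plus)
  qed
qed

text \<open>Up to a mean-square error the pair is (c Z, d Z) with one scalar Z, hence a continuous
  image of Z, and joint convergence follows from weak convergence on the real line.\<close>

lemma err_pair_conv:
  assumes z: "c1 * mean 0 0 + c2 * mean s 0 + c3 * mean 0 s = z" and y: "d1 * mean 0 0 + d2 * mean s 0 + d3 * mean 0 s = y"
    and f: "continuous_on UNIV f" "bounded (range f)"
  shows "(\<lambda>n. expectation (\<lambda>\<omega>. f (err s c1 c2 c3 z n \<omega>, err s d1 d2 d3 y n \<omega>))) \<longlonglongrightarrow>
    (LINT x|normal_law 0 (2 * \<gamma>). f ((c1 + c2 + c3) * x, (d1 + d2 + d3) * x) :: real)"
proof -
  define c where "c = c1 + c2 + c3"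
  define d where "d = d1 + d2 + d3"
  define Z where "Z = U s 1 0 0"
  define X where "X n \<omega> = (c * Z n \<omega>, d * Z n \<omega>)" for n \<omega>
  define X' where "X' n \<omega> = (err s c1 c2 c3 z n \<omega>, err s d1 d2 d3 y n \<omega>)" for n \<omega>
  have Zm: "all_moments M (Z n)" for n unfolding Z_def by (rule all_moments_U)
  have [measurable]: "Z n \<in> borel_measurable M" for n by (rule all_moments_measurable[OF Zm])
  have [measurable]: "err s a1 a2 a3 w n \<in> borel_measurable M" for a1 a2 a3 w n by (rule all_moments_measurable[OF all_moments_err])
  have np: "(norm (a, b))\<^sup>2 = a\<^sup>2 + b\<^sup>2" for a b :: real by (simp add: norm_Pair)
  have nX: "(norm (X n \<omega>))\<^sup>2 = (c\<^sup>2 + d\<^sup>2) * (Z n \<omega> * Z n \<omega>)" for n \<omega>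
    unfolding X_def np by (simp add: power2_eq_square algebra_simps)
  have nD: "(norm (X' n \<omega> - X n \<omega>))\<^sup>2 = (err s c1 c2 c3 z n \<omega> - c * Z n \<omega>)\<^sup>2 + (err s d1 d2 d3 y n \<omega> - d * Z n \<omega>)\<^sup>2" for n \<omega>
    by (simp add: X_def X'_def norm_Pair)
  have iD: "integrable M (\<lambda>\<omega>. (err s a1 a2 a3 w n \<omega> - e * Z n \<omega>)\<^sup>2)" for a1 a2 a3 w n e
    by (intro all_moments_integrable all_moments_intros all_moments_err Zm)
  have "(\<lambda>n. expectation (\<lambda>\<omega>. Z n \<omega> * Z n \<omega>)) \<longlonglongrightarrow> 2 * \<gamma>"
    using expectation_U_U_tendsto[of s 1 0 0 1 0 0] by (simp add: Z_def)
  then have "Bseq (\<lambda>n. expectation (\<lambda>\<omega>. Z n \<omega> * Z n \<omega>))" by (intro convergent_imp_Bseq convergentI)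
  then obtain K where K: "K > 0" "\<And>n. norm (expectation (\<lambda>\<omega>. Z n \<omega> * Z n \<omega>)) \<le> K" by (auto elim: BseqE)
  have "(\<lambda>n. expectation (\<lambda>\<omega>. f (X' n \<omega>)) - expectation (\<lambda>\<omega>. f (X n \<omega>))) \<longlonglongrightarrow> 0"
  proof (rule expectation_diff_tendsto_0[OF _ _ _ _ _ _ f])
    show "X n \<in> borel_measurable M" for n unfolding X_def[abs_def] by measurable
    show "X' n \<in> borel_measurable M" for n unfolding X'_def[abs_def] by measurable
    show "integrable M (\<lambda>\<omega>. (norm (X n \<omega>))\<^sup>2)" for n
      unfolding nX by (intro all_moments_integrable all_moments_intros Zm)
    show "integrable M (\<lambda>\<omega>. (norm (X' n \<omega> - X n \<omega>))\<^sup>2)" for n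
      unfolding nD by (intro Bochner_Integration.integrable_add iD)
    show "expectation (\<lambda>\<omega>. (norm (X n \<omega>))\<^sup>2) \<le> (c\<^sup>2 + d\<^sup>2) * K" for n
      unfolding nX using K(2)[of n] by (simp add: mult_left_mono)
    have "(\<lambda>n. expectation (\<lambda>\<omega>. (err s c1 c2 c3 z n \<omega> - c * Z n \<omega>)\<^sup>2) + expectation (\<lambda>\<omega>. (err s d1 d2 d3 y n \<omega> - d * Z n \<omega>)\<^sup>2)) \<longlonglongrightarrow> 0 + 0"
      unfolding c_def d_def Z_def by (intro tendsto_add err_approx z y)
    then show "(\<lambda>n. expectation (\<lambda>\<omega>. (norm (X' n \<omega> - X n \<omega>))\<^sup>2)) \<longlonglongrightarrow> 0"
      unfolding nD using iD by simp
  qed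
  moreover have "(\<lambda>n. expectation (\<lambda>\<omega>. f (X n \<omega>))) \<longlonglongrightarrow> (LINT x|normal_law 0 (2 * \<gamma>). f (c * x, d * x))"
  proof -
    let ?g = "\<lambda>x. f (c * x, d * x)"
    have g: "continuous_on UNIV ?g"
      by (rule continuous_on_compose2[OF f(1)]) (auto intro!: continuous_intros)
    obtain b where b: "\<And>x. \<bar>f x\<bar> \<le> b" using f(2) by (auto simp: bounded_iff)
    have "(\<lambda>n. integral\<^sup>L (distr M borel (Z n)) ?g) \<longlonglongrightarrow> integral\<^sup>L (normal_law 0 (2 * \<gamma>)) ?g"
    proof (rule weak_conv_imp_integral_bdd_continuous_conv)
      show "real_distribution (distr M borel (Z n))" for n by (rule real_distribution_distr) measurable
      show "real_distribution (normal_law 0 (2 * \<gamma>))" using \<gamma>_nonneg by (intro real_distribution_normal_law) simp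
      show "weak_conv_m (\<lambda>n. distr M borel (Z n)) (normal_law 0 (2 * \<gamma>))" unfolding Z_def by (rule U_weak_conv)
      show "isCont ?g x" for x using g by (simp add: continuous_on_eq_continuous_at)
      show "norm (?g x) \<le> b" for x using b by (simp only: real_norm_def)
    qed
    moreover have "?g \<in> borel_measurable borel" by (rule borel_measurable_continuous_onI[OF g])
    ultimately show ?thesis by (simp add: integral_distr X_def)
  qed
  ultimately have "(\<lambda>n. (expectation (\<lambda>\<omega>. f (X' n \<omega>)) - expectation (\<lambda>\<omega>. f (X n \<omega>))) + expectation (\<lambda>\<omega>. f (X n \<omega>))) \<longlonglongrightarrow>
     0 + (LINT x|normal_law 0 (2 * \<gamma>). f (c * x, d * x))" by (rule tendsto_add)
  then show ?thesis by (simp add: X'_def c_def d_def)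
qed

end

section \<open>The identities that explain the coefficients of the estimators\<close>

context bivariate_fou
begin

lemma mean_r: "mean 0 0 = r 1 2 0" "mean s 0 = r 1 2 (real s)" "mean 0 s = r 2 1 (real s)" "r 2 1 0 = r 1 2 0"
proof -
  show "mean 0 0 = r 1 2 0" using cov_lower[of 1 2 0 0] by (simp add: mean_def)
  show "mean s 0 = r 1 2 (real s)" using cov_lower[of 1 2 0 s] by (simp add: mean_def)
  show "mean 0 s = r 2 1 (real s)" using cov_upper[of 1 2 0 s] by (simp add: mean_def)
  show "r 2 1 0 = r 1 2 0" using cov_lower[of 1 2 0 0] cov_lower[of 2 1 0 0] cov_commute[of 1 2 0 0] by simp
qed

text \<open>Dividing the two instances of \<open>r_decompose\<close> by K I and K J gives (\<rho> +
  \<eta> 1 2) / 2 + m0 / (K I) and (\<rho> - \<eta> 1 2) / 2 + m0 / (K J). Their sum and difference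
  yield the parameters, and \<open>a1_coef\<close> and \<open>b1_coef\<close> are what removes the
  simultaneous covariance m0.\<close>

lemma estimator_identities:
  assumes s: "s \<ge> 1"
  shows "a1_coef \<alpha> \<nu> (H 1 + H 2) s * mean 0 0 + a2_coef \<alpha> \<nu> (H 1 + H 2) s * mean s 0 + a3_coef \<alpha> \<nu> (H 1 + H 2) s * mean 0 s = \<rho>"
    and "b1_coef \<alpha> \<nu> (H 1 + H 2) s * mean 0 0 + b2_coef \<alpha> \<nu> (H 1 + H 2) s * mean s 0 + b3_coef \<alpha> \<nu> (H 1 + H 2) s * mean 0 s = \<eta> 1 2"
proof -
  define h' where "h' = H 1 + H 2"
  define I where "I = I_coef \<alpha> h' 1 2 s"
  define J where "J = I_coef \<alpha> h' 2 1 s"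
  define K where "K = \<nu> 1 * \<nu> 2 * h' * (h' - 1)"
  define m0 where "m0 = r 1 2 0"
  have hh: "h 1 2 = h'" "h 2 1 = h'" by (simp_all add: h_def h'_def)
  have I: "I \<noteq> 0" and J: "J \<noteq> 0"
    using I_coef_pos[of 1 2 s] I_coef_pos[of 2 1 s] s unfolding I_def J_def hh by auto
  have K: "K \<noteq> 0" using pos[of 1] pos[of 2] H_sum by (simp add: K_def h'_def)
  have eta: "\<eta> 2 1 = - \<eta> 1 2" using fBm unfolding bivariate_fBm_def by simp
  have kB: "kB 1 2 = h' * (h' - 1) * (\<rho> + \<eta> 1 2) / 2" "kB 2 1 = h' * (h' - 1) * (\<rho> - \<eta> 1 2) / 2"
    unfolding kB_def hh by (simp_all add: rr_def ee_def eta del: One_nat_def)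
  have d1: "exp (\<alpha> 1 * real s) * r 1 2 (real s) = m0 + K * (\<rho> + \<eta> 1 2) / 2 * I"
    using r_decompose[of 1 2 s] unfolding hh I_def[symmetric] kB m0_def[symmetric] by (simp add: K_def)
  have d2: "exp (\<alpha> 2 * real s) * r 2 1 (real s) = m0 + K * (\<rho> - \<eta> 1 2) / 2 * J"
    using r_decompose[of 2 1 s] unfolding hh J_def[symmetric] kB mean_r(4) m0_def[symmetric] by (simp add: K_def)
  have c2: "a2_coef \<alpha> \<nu> h' s * r 1 2 (real s) = (m0 + K * (\<rho> + \<eta> 1 2) / 2 * I) / (K * I)"
    unfolding d1[symmetric] a2_coef_def K_def[symmetric] I_def[symmetric] by simp
  have c3: "a3_coef \<alpha> \<nu> h' s * r 2 1 (real s) = (m0 + K * (\<rho> - \<eta> 1 2) / 2 * J) / (K * J)"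
    unfolding d2[symmetric] a3_coef_def K_def[symmetric] J_def[symmetric] by simp
  have "a1_coef \<alpha> \<nu> h' s * m0 + a2_coef \<alpha> \<nu> h' s * r 1 2 (real s) + a3_coef \<alpha> \<nu> h' s * r 2 1 (real s) = \<rho>"
    unfolding c2 c3 a1_coef_def I_def[symmetric] J_def[symmetric] K_def[symmetric]
    using I J K by (simp add: field_simps)
  then show "a1_coef \<alpha> \<nu> (H 1 + H 2) s * mean 0 0 + a2_coef \<alpha> \<nu> (H 1 + H 2) s * mean s 0 + a3_coef \<alpha> \<nu> (H 1 + H 2) s * mean 0 s = \<rho>"
    unfolding mean_r(1) unfolding mean_r(2,3) h'_def m0_def .
  have "b1_coef \<alpha> \<nu> h' s * m0 + a2_coef \<alpha> \<nu> h' s * r 1 2 (real s) - a3_coef \<alpha> \<nu> h' s * r 2 1 (real s) = \<eta> 1 2"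
    unfolding c2 c3 b1_coef_def I_def[symmetric] J_def[symmetric] K_def[symmetric]
    using I J K by (simp add: field_simps)
  then show "b1_coef \<alpha> \<nu> (H 1 + H 2) s * mean 0 0 + b2_coef \<alpha> \<nu> (H 1 + H 2) s * mean s 0 + b3_coef \<alpha> \<nu> (H 1 + H 2) s * mean 0 s = \<eta> 1 2"
    unfolding mean_r(1) unfolding mean_r(2,3) h'_def m0_def b2_coef_def b3_coef_def by simp
qed

end

theorem theorem6p1p13:
  fixes M :: "'a measure"
    and H \<alpha> \<nu> :: "nat \<Rightarrow> real"
    and \<rho> :: real
    and \<eta> :: "nat \<Rightarrow> nat \<Rightarrow> real"
    and B Y :: "nat \<Rightarrow> real \<Rightarrow> 'a \<Rightarrow> real"
    and s :: nat
  assumes "prob_space M"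
    and "\<And>i. i \<in> {1, 2} \<Longrightarrow> H i \<in> {0<..<1} - {1 / 2}"
    and "H 1 + H 2 = 3 / 2"
    and "\<And>i. i \<in> {1, 2} \<Longrightarrow> \<alpha> i > 0 \<and> \<nu> i > 0"
    and "bivariate_fBm M H \<rho> \<eta> B"
    and "bivariate_fOU M \<alpha> \<nu> B Y"
    and "s \<ge> 1"
  defines "R \<equiv> \<lambda>n \<omega>. sqrt (real n / ln (real n)) * (rho_hat \<alpha> \<nu> (H 1 + H 2) s Y n \<omega> - \<rho>)"
    and "E \<equiv> \<lambda>n \<omega>. sqrt (real n / ln (real n)) * (eta12_hat \<alpha> \<nu> (H 1 + H 2) s Y n \<omega> - \<eta> 1 2)"
  shows "\<exists>\<sigma>\<rho> \<sigma>\<eta> \<kappa> :: real.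
     (\<lambda>n. prob_space.variance M (R n)) \<longlonglongrightarrow> \<sigma>\<rho>\<^sup>2 \<and>
     (\<lambda>n. prob_space.variance M (E n)) \<longlonglongrightarrow> \<sigma>\<eta>\<^sup>2 \<and>
     (\<lambda>n. real n / ln (real n) *
        (LINT \<omega>|M. (rho_hat \<alpha> \<nu> (H 1 + H 2) s Y n \<omega> - \<rho>)
                   * (eta12_hat \<alpha> \<nu> (H 1 + H 2) s Y n \<omega> - \<eta> 1 2))) \<longlonglongrightarrow> \<kappa> \<and>
     (\<exists>(Q :: (real \<times> real) measure) N\<rho> N\<eta>.
        prob_space Q \<and>
        centered_gaussian_process Q {..<2} (\<lambda>i. [N\<rho>, N\<eta>] ! i) \<and>
        distr Q borel N\<rho> = normal_law 0 (\<sigma>\<rho>\<^sup>2) \<and>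
        distr Q borel N\<eta> = normal_law 0 (\<sigma>\<eta>\<^sup>2) \<and>
        covariance Q N\<rho> N\<eta> = \<kappa> \<and>
        weak_conv_m (\<lambda>n. distr M borel (R n)) (distr Q borel N\<rho>) \<and>
        weak_conv_m (\<lambda>n. distr M borel (E n)) (distr Q borel N\<eta>) \<and>
        conv_in_distribution M (\<lambda>n \<omega>. (R n \<omega>, E n \<omega>)) Q (\<lambda>\<omega>. (N\<rho> \<omega>, N\<eta> \<omega>)))"
proof -
  interpret prob_space M by fact
  interpret bivariate_fou M H \<alpha> \<nu> \<rho> \<eta> B Y
  proof unfold_locales
    \<comment> \<open>Each index is below 1 and they add up to 3/2, so both exceed 1/2.\<close>
    show "1 / 2 < H i \<and> H i < 1" if "i \<in> {1, 2}" for i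
      using assms(2)[of 1] assms(2)[of 2] assms(3) that by auto
  qed (use assms in auto)
  let ?h = "H 1 + H 2"
  define a1 where "a1 = a1_coef \<alpha> \<nu> ?h s"
  define a2 where "a2 = a2_coef \<alpha> \<nu> ?h s"
  define a3 where "a3 = a3_coef \<alpha> \<nu> ?h s"
  define b1 where "b1 = b1_coef \<alpha> \<nu> ?h s"
  define b2 where "b2 = b2_coef \<alpha> \<nu> ?h s"
  define b3 where "b3 = b3_coef \<alpha> \<nu> ?h s"
  note ida = estimator_identities(1)[OF assms(7), folded a1_def a2_def a3_def]
    and idb = estimator_identities(2)[OF assms(7), folded b1_def b2_def b3_def]
  have R: "R = err s a1 a2 a3 \<rho>" and E: "E = err s b1 b2 b3 (\<eta> 1 2)"
    by (auto simp: R_def E_def err_def rho_hat_def eta12_hat_def a1_def a2_def a3_def b1_def b2_def b3_def fun_eq_iff)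
  define a where "a = a1 + a2 + a3"
  define b where "b = b1 + b2 + b3"
  define v where "v = 2 * \<gamma>"
  have v: "v \<ge> 0" using \<gamma>_nonneg by (simp add: v_def)
  define N where "N = normal_law 0 v"
  interpret N: real_distribution N unfolding N_def by (rule real_distribution_normal_law[OF v])
  \<comment> \<open>The limit vector is supported on a line, so one normal variable embedded in the
    plane carries both components; they are the multiples a and b of its first coordinate.\<close>
  define Q where "Q = distr N borel (\<lambda>x. (x, 0 :: real))"
  define N\<rho> where "N\<rho> = (\<lambda>\<omega> :: real \<times> real. a * fst \<omega>)"
  define N\<eta> where "N\<eta> = (\<lambda>\<omega> :: real \<times> real. b * fst \<omega>)"
  have Rm: "R n \<in> borel_measurable M" and Em: "E n \<in> borel_measurable M" for n
    unfolding R E by (rule all_moments_measurable[OF all_moments_err])+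
  have emb: "(\<lambda>x. (x, 0 :: real)) \<in> N \<rightarrow>\<^sub>M borel" by simp
  have Q: "prob_space Q" unfolding Q_def by (rule N.prob_space_distr[OF emb])
  have Q_borel: "sets Q = sets borel" by (simp add: Q_def)
  have Q_int: "(LINT \<omega>|Q. g \<omega>) = (LINT x|N. g (x, 0))" if "g \<in> borel_measurable borel" for g :: "real \<times> real \<Rightarrow> real"
    unfolding Q_def by (rule integral_distr[OF emb that])
  have lin: "distr Q borel (\<lambda>\<omega>. c * fst \<omega>) = normal_law 0 (c\<^sup>2 * v)" for c
  proof -
    have "distr Q borel (\<lambda>\<omega>. c * fst \<omega>) = distr N borel ((\<lambda>\<omega>. c * fst \<omega>) \<circ> (\<lambda>x. (x, 0 :: real)))"
      unfolding Q_def by (rule distr_distr[OF _ emb]) (simp add: borel_prod[symmetric])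
    also have "\<dots> = normal_law 0 (c\<^sup>2 * v)"
      using distr_normal_law_scale[OF v, of c] by (simp add: o_def N_def)
    finally show ?thesis .
  qed
  have fst_meas: "(\<lambda>\<omega>. c * fst \<omega>) \<in> borel_measurable (borel :: (real \<times> real) measure)" for c :: real
    by (simp add: borel_prod[symmetric])
  have gauss: "centered_gaussian_process Q {..<2} (\<lambda>i. [N\<rho>, N\<eta>] ! i)"
    unfolding centered_gaussian_process_def
  proof (intro conjI ballI allI impI)
    have nth: "([N\<rho>, N\<eta>] ! i) = (\<lambda>\<omega>. ([a, b] ! i) * fst \<omega>)" if "i < 2" for i
      using that by (auto simp: N\<rho>_def N\<eta>_def less_2_cases_iff)
    show "[N\<rho>, N\<eta>] ! i \<in> borel_measurable Q" if "i \<in> {..<2}" for i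
      using fst_meas nth that Q_borel by (simp cong: measurable_cong_sets)
    fix J :: "nat set" and c :: "nat \<Rightarrow> real" assume J: "finite J \<and> J \<subseteq> {..<2}"
    have "(\<Sum>i\<in>J. c i * ([N\<rho>, N\<eta>] ! i) \<omega>) = (\<Sum>i\<in>J. c i * [a, b] ! i) * fst \<omega>" for \<omega>
      unfolding sum_distrib_right using J by (intro sum.cong refl) (auto simp: nth)
    then show "\<exists>u\<ge>0. distr Q borel (\<lambda>\<omega>. \<Sum>i\<in>J. c i * ([N\<rho>, N\<eta>] ! i) \<omega>) = normal_law 0 u"
      using lin v by (intro exI[of _ "(\<Sum>i\<in>J. c i * [a, b] ! i)\<^sup>2 * v"]) simp
  qed
  have sq: "(c * sqrt v)\<^sup>2 = c\<^sup>2 * v" for c using v by (simp add: power_mult_distrib)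
  have cov: "covariance Q N\<rho> N\<eta> = a * b * v"
  proof -
    have "(LINT x|N. x) = 0" unfolding N_def using normal_law_odd_moment[OF v, of 1] by simp
    then have mean0: "(LINT \<omega>|Q. c * fst \<omega>) = 0" for c using Q_int[OF fst_meas, of c] by simp
    have "covariance Q N\<rho> N\<eta> = (LINT \<omega>|Q. (a * fst \<omega>) * (b * fst \<omega>))"
      unfolding covariance_def N\<rho>_def N\<eta>_def mean0 by simp
    also have "\<dots> = (LINT x|N. a * b * x\<^sup>2)"
      using Q_int[OF borel_measurable_times[OF fst_meas fst_meas], of a b] by (simp add: power2_eq_square mult_ac)
    also have "\<dots> = a * b * v" unfolding N_def using normal_law_variance[OF v] by simp
    finally show ?thesis .
  qed
  have pair: "(\<lambda>n. LINT \<omega>|M. f (R n \<omega>, E n \<omega>)) \<longlonglongrightarrow> (LINT x|N. f (a * x, b * x))"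
    if "continuous_on UNIV f" "bounded (range f)" for f :: "real \<times> real \<Rightarrow> real"
    unfolding R E a_def b_def N_def v_def by (rule err_pair_conv[OF ida idb that])
  have weak: "weak_conv_m (\<lambda>n. distr M borel (V n)) (distr Q borel (\<lambda>\<omega>. c * fst \<omega>))"
    if V: "\<And>n. V n \<in> borel_measurable M"
      and lim: "\<And>f :: real \<Rightarrow> real. continuous_on UNIV f \<Longrightarrow> bounded (range f) \<Longrightarrow> (\<lambda>n. LINT \<omega>|M. f (V n \<omega>)) \<longlonglongrightarrow> (LINT x|N. f (c * x))"
    for V c
  proof (rule integral_bdd_continuous_conv_imp_weak_conv)
    show "real_distribution (distr M borel (V n))" for n by (rule real_distribution_distr[OF V])
    show "real_distribution (distr Q borel (\<lambda>\<omega>. c * fst \<omega>))"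
      unfolding lin using v by (intro real_distribution_normal_law) simp
    fix f :: "real \<Rightarrow> real" assume f: "\<And>x. isCont f x" "\<And>x. \<bar>f x\<bar> \<le> 1"
    have fc: "continuous_on UNIV f" using f(1) by (simp add: continuous_on_eq_continuous_at)
    have fm: "f \<in> borel_measurable borel" by (rule borel_measurable_continuous_onI[OF fc])
    have fb: "bounded (range f)" using f(2) by (auto simp: bounded_iff)
    have "integral\<^sup>L (distr Q borel (\<lambda>\<omega>. c * fst \<omega>)) f = (LINT \<omega>|Q. f (c * fst \<omega>))"
      using fst_meas fm Q_borel by (intro integral_distr) (auto cong: measurable_cong_sets)
    also have "\<dots> = (LINT x|N. f (c * x))"
      using Q_int[OF measurable_compose[OF fst_meas fm], of c] by simp
    finally have eq: "integral\<^sup>L (distr Q borel (\<lambda>\<omega>. c * fst \<omega>)) f = (LINT x|N. f (c * x))" .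
    show "(\<lambda>n. integral\<^sup>L (distr M borel (V n)) f) \<longlonglongrightarrow> integral\<^sup>L (distr Q borel (\<lambda>\<omega>. c * fst \<omega>)) f"
      unfolding eq integral_distr[OF V fm] by (rule lim[OF fc fb])
  qed
  \<comment> \<open>The marginal limits are obtained from the joint one by testing with functions of
    a single coordinate.\<close>
  have comp: "continuous_on UNIV (\<lambda>x. f (g x))" "bounded (range (\<lambda>x. f (g x)))"
    if "continuous_on UNIV f" "bounded (range f)" "continuous_on UNIV g" for f :: "real \<Rightarrow> real" and g :: "real \<times> real \<Rightarrow> real"
    using that(2) by (auto intro: continuous_on_compose2[OF that(1,3)] elim: bounded_subset)
  show ?thesis
  \<comment> \<open>These witnesses may be negative or zero; only their squares enter, and a zero
    gives a point mass.\<close>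
  proof (rule exI[of _ "a * sqrt v"], rule exI[of _ "b * sqrt v"], rule exI[of _ "a * b * v"], intro conjI)
    show "(\<lambda>n. prob_space.variance M (R n)) \<longlonglongrightarrow> (a * sqrt v)\<^sup>2"
      unfolding sq unfolding R a_def v_def by (rule variance_err_tendsto[OF ida])
    show "(\<lambda>n. prob_space.variance M (E n)) \<longlonglongrightarrow> (b * sqrt v)\<^sup>2"
      unfolding sq unfolding E b_def v_def by (rule variance_err_tendsto[OF idb])
    have "real n / ln (real n) * (LINT \<omega>|M. (rho_hat \<alpha> \<nu> ?h s Y n \<omega> - \<rho>) * (eta12_hat \<alpha> \<nu> ?h s Y n \<omega> - \<eta> 1 2)) =
        (LINT \<omega>|M. R n \<omega> * E n \<omega>)" for n
    proof -
      have nn: "0 \<le> real n / ln (real n)" by (cases "n = 0") auto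
      have sq': "sqrt (real n / ln (real n)) * sqrt (real n / ln (real n)) = real n / ln (real n)"
        using real_sqrt_pow2[OF nn] by (simp only: power2_eq_square)
      have "R n \<omega> * E n \<omega> = (sqrt (real n / ln (real n)) * sqrt (real n / ln (real n))) * ((rho_hat \<alpha> \<nu> ?h s Y n \<omega> - \<rho>) * (eta12_hat \<alpha> \<nu> ?h s Y n \<omega> - \<eta> 1 2))" for \<omega>
        unfolding R_def E_def by (simp only: mult_ac)
      then have "R n \<omega> * E n \<omega> = real n / ln (real n) * ((rho_hat \<alpha> \<nu> ?h s Y n \<omega> - \<rho>) * (eta12_hat \<alpha> \<nu> ?h s Y n \<omega> - \<eta> 1 2))" for \<omega>
        unfolding sq' .
      then show ?thesis by simp
    qed
    moreover have "(\<lambda>n. LINT \<omega>|M. R n \<omega> * E n \<omega>) \<longlonglongrightarrow> a * b * v"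
      unfolding R E a_def b_def v_def by (rule expectation_err_err_tendsto[OF ida idb])
    ultimately show "(\<lambda>n. real n / ln (real n) *
        (LINT \<omega>|M. (rho_hat \<alpha> \<nu> ?h s Y n \<omega> - \<rho>) * (eta12_hat \<alpha> \<nu> ?h s Y n \<omega> - \<eta> 1 2))) \<longlonglongrightarrow> a * b * v"
      by simp
    show "\<exists>(Q :: (real \<times> real) measure) N\<rho> N\<eta>.
        prob_space Q \<and>
        centered_gaussian_process Q {..<2} (\<lambda>i. [N\<rho>, N\<eta>] ! i) \<and>
        distr Q borel N\<rho> = normal_law 0 ((a * sqrt v)\<^sup>2) \<and>
        distr Q borel N\<eta> = normal_law 0 ((b * sqrt v)\<^sup>2) \<and>
        covariance Q N\<rho> N\<eta> = a * b * v \<and>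
        weak_conv_m (\<lambda>n. distr M borel (R n)) (distr Q borel N\<rho>) \<and>
        weak_conv_m (\<lambda>n. distr M borel (E n)) (distr Q borel N\<eta>) \<and>
        conv_in_distribution M (\<lambda>n \<omega>. (R n \<omega>, E n \<omega>)) Q (\<lambda>\<omega>. (N\<rho> \<omega>, N\<eta> \<omega>))"
    proof (rule exI[of _ Q], rule exI[of _ N\<rho>], rule exI[of _ N\<eta>], intro conjI Q gauss cov)
      show "distr Q borel N\<rho> = normal_law 0 ((a * sqrt v)\<^sup>2)" unfolding sq N\<rho>_def by (rule lin)
      show "distr Q borel N\<eta> = normal_law 0 ((b * sqrt v)\<^sup>2)" unfolding sq N\<eta>_def by (rule lin)
      show "weak_conv_m (\<lambda>n. distr M borel (R n)) (distr Q borel N\<rho>)"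
        unfolding N\<rho>_def
      proof (rule weak[OF Rm])
        fix f :: "real \<Rightarrow> real" assume "continuous_on UNIV f" "bounded (range f)"
        from pair[OF comp[OF this, of fst]]
        show "(\<lambda>n. LINT \<omega>|M. f (R n \<omega>)) \<longlonglongrightarrow> (LINT x|N. f (a * x))"
          by (simp add: continuous_on_fst)
      qed
      show "weak_conv_m (\<lambda>n. distr M borel (E n)) (distr Q borel N\<eta>)"
        unfolding N\<eta>_def
      proof (rule weak[OF Em])
        fix f :: "real \<Rightarrow> real" assume "continuous_on UNIV f" "bounded (range f)"
        from pair[OF comp[OF this, of snd]]
        show "(\<lambda>n. LINT \<omega>|M. f (E n \<omega>)) \<longlonglongrightarrow> (LINT x|N. f (b * x))"
          by (simp add: continuous_on_snd)
      qed
      show "conv_in_distribution M (\<lambda>n \<omega>. (R n \<omega>, E n \<omega>)) Q (\<lambda>\<omega>. (N\<rho> \<omega>, N\<eta> \<omega>))"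
        unfolding conv_in_distribution_def
      proof (intro allI impI)
        fix f :: "real \<times> real \<Rightarrow> real" assume f: "continuous_on UNIV f \<and> bounded (range f)"
        have "continuous_on UNIV (\<lambda>\<omega>. f (N\<rho> \<omega>, N\<eta> \<omega>))"
          unfolding N\<rho>_def N\<eta>_def
          by (rule continuous_on_compose2[OF conjunct1[OF f]]) (auto intro!: continuous_intros)
        then have "(LINT \<omega>|Q. f (N\<rho> \<omega>, N\<eta> \<omega>)) = (LINT x|N. f (a * x, b * x))"
          using Q_int[OF borel_measurable_continuous_onI] by (simp add: N\<rho>_def N\<eta>_def)
        then show "(\<lambda>n. LINT \<omega>|M. f (R n \<omega>, E n \<omega>)) \<longlonglongrightarrow> (LINT \<omega>|Q. f (N\<rho> \<omega>, N\<eta> \<omega>))"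
          using pair f by simp
      qed
    qed
  qed
qed

end
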